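(* Suppose that the global Sobolev inequalities \[ \left(\int_\Omega|u|^{q_1}w_1\,dx\right)^{\frac1{q_1}}\le C\left(\int_\Omega|\nabla u|^pw_1\,dx\right)^{\frac1p},\qquad \left(\int_\Omega|u|^{q}w_2\,dx\right)^{\frac1{q}}\le C\left(\int_\Omega|\nabla u|^pw_1\,dx\right)^{\frac1p} \] hold for some constant $C>0$ and all $u\in C^1_c(\Omega)$. Suppose $u\in D^{1,p,w_1}(\Omega)$ is a weak solution of \[ -\operatorname{div}\left(w_1|\nabla u|^{p-2}\nabla u\right)=w_2|u|^{q-2}u\quad\text{in }\Omega. \] Then there exist $R_0>1$, $C>0$ and $\lambda>0$ such that \[ |u(x)|\le\frac{C}{|x|^{\frac{p}{q_1-p}+\lambda}} \] for all $|x|>R_0$ in $\Omega$.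
   Context: Setting. $\Omega\subseteq\mathbb R^N$ is open (bounded or not); balls are open, $l(B)$ is the radius of $B$, and $\rho B$ is the ball with the same center as $B$ and radius multiplied by $\rho>0$. Weights. $w_1,w_2$ are non-negative locally integrable functions on $\Omega$. For $w\in\{w_1,w_2\}$ write $w(B)=\int_B w\,dx$ and $⨍_B f w\,dx=\frac1{w(B)}\int_B f w\,dx$. Standing assumptions: (i) each $w\in\{w_1,w_2\}$ is doubling: there is $\gamma>0$ with $w(2B)\le\gamma w(B)$ for every ball with $2B\subset\Omega$ (the smallest such $\gamma$ is denoted $\gamma_w$), and $0<w<\infty$ Lebesgue-a.e.; (ii) $w_1$ satisfies the local $(1,p)$-Poincaré inequality: there are $\rho\ge1$ and $C_1>0$ such that for $u\in C^1(\Omega)$ and all balls $B$ with $\rho B\subset\Omega$, $⨍_B|u-u_{B,w_1}|w_1\,dx\le C_1 l(B)\left(⨍_{\rho B}|\nabla u|^p w_1\,dx\right)^{1/p}$, where $u_{B,w_1}=⨍_B u\,w_1\,dx$; (iii) there are $q>p$ and $C>0$ such that $\frac rR\left(\frac{w_2(B_r)}{w_2(B_R)}\right)^{1/q}\le C\left(\frac{w_1(B_r)}{w_1(B_R)}\right)^{1/p}$ for all balls $B_r\subset B_R\subset\Omega$ of radii $r$, $R$; the exponent $q$ in the equation and in the second global Sobolev inequality is this $q$. Put $D_1=\log_2\gamma_{w_1}$, $D=\frac{qp}{q-p}$ and $q_1=\frac{D_1p}{D_1-p}$; it is assumed that $1<p<\min\{D_1,D\}$. Function spaces. $L^{s,w}(\Omega)$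 is the space of measurable $u$ with $\|u\|_{s,w}=(\int_\Omega|u|^sw\,dx)^{1/s}<\infty$. $D^{1,p,w_1}(\Omega)$ is the closure (completion) of $C_c^\infty(\Omega)$ under $\|\nabla u\|_{p,w_1}$; by the global Sobolev inequalities it embeds continuously into $L^{q_1,w_1}(\Omega)$ and $L^{q,w_2}(\Omega)$. Weak solution: $\int_\Omega|\nabla u|^{p-2}\nabla u\cdot\nabla\varphi\,w_1\,dx=\int_\Omega|u|^{q-2}u\,\varphi\,w_2\,dx$ for all $\varphi\in C_c^\infty(\Omega)$. Pointwise bounds for $u$ are understood almost everywhere. *)

theory Defs
  imports "HOL-Analysis.Analysis"
begin

(* Ck_on is meant for open S; the partial derivatives of f are the components of grad f. *)

definition grad :: "('a::euclidean_space \<Rightarrow> real) \<Rightarrow> 'a \<Rightarrow> 'a" where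
  "grad f x = (THE D. GDERIV f x :> D)"

primrec Ck_on :: "nat \<Rightarrow> 'a::euclidean_space set \<Rightarrow> ('a \<Rightarrow> real) \<Rightarrow> bool" where
  "Ck_on 0 S f \<longleftrightarrow> continuous_on S f"
| "Ck_on (Suc k) S f \<longleftrightarrow> (\<forall>x\<in>S. \<exists>D. GDERIV f x :> D) \<and>
     (\<forall>b\<in>Basis. Ck_on k S (\<lambda>x. grad f x \<bullet> b))"

definition compact_support_in :: "'a::euclidean_space set \<Rightarrow> ('a \<Rightarrow> real) \<Rightarrow> bool" where
  "compact_support_in \<Omega> f \<longleftrightarrow>
     compact (closure {x. f x \<noteq> 0}) \<and> closure {x. f x \<noteq> 0} \<subseteq> \<Omega>"

(* Compactly supported functions on \<Omega> are identified with their extension by zero. *)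

definition C1c :: "'a::euclidean_space set \<Rightarrow> ('a \<Rightarrow> real) set" where
  "C1c \<Omega> = {f. Ck_on 1 UNIV f \<and> compact_support_in \<Omega> f}"

definition Cinfc :: "'a::euclidean_space set \<Rightarrow> ('a \<Rightarrow> real) set" where
  "Cinfc \<Omega> = {f. (\<forall>k. Ck_on k UNIV f) \<and> compact_support_in \<Omega> f}"

(* The measure w dx on \<Omega>. Weights take values in [0,\<infinity>], and their values outside \<Omega>
   are irrelevant. *)

definition weighted :: "'a::euclidean_space set \<Rightarrow> ('a \<Rightarrow> ennreal) \<Rightarrow> 'a measure" where
  "weighted \<Omega> w = density (lebesgue_on \<Omega>) w"

definition wavg :: "'a measure \<Rightarrow> 'a set \<Rightarrow> ('a \<Rightarrow> real) \<Rightarrow> real" where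
  "wavg M B f = (LINT x:B|M. f x) / measure M B"

definition loc_integrable_weight :: "'a::euclidean_space set \<Rightarrow> ('a \<Rightarrow> ennreal) \<Rightarrow> bool" where
  "loc_integrable_weight \<Omega> w \<longleftrightarrow> w \<in> borel_measurable (lebesgue_on \<Omega>) \<and>
     (\<forall>K. compact K \<and> K \<subseteq> \<Omega> \<longrightarrow> emeasure (weighted \<Omega> w) K < \<infinity>)"

(* Comparing emeasure rather than measure: doubling thus forces w(2B) to be finite even when 2B
   is not relatively compact in \<Omega>. *)

definition doubling_consts :: "'a::euclidean_space set \<Rightarrow> ('a \<Rightarrow> ennreal) \<Rightarrow> real set" where
  "doubling_consts \<Omega> w = {\<gamma>. \<gamma> > 0 \<and>
     (\<forall>x r. r > 0 \<and> ball x (2 * r) \<subseteq> \<Omega> \<longrightarrow>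
        emeasure (weighted \<Omega> w) (ball x (2 * r))
          \<le> ennreal \<gamma> * emeasure (weighted \<Omega> w) (ball x r))}"

definition doubling :: "'a::euclidean_space set \<Rightarrow> ('a \<Rightarrow> ennreal) \<Rightarrow> bool" where
  "doubling \<Omega> w \<longleftrightarrow> doubling_consts \<Omega> w \<noteq> {}"

definition doubling_const :: "'a::euclidean_space set \<Rightarrow> ('a \<Rightarrow> ennreal) \<Rightarrow> real" where
  "doubling_const \<Omega> w = Inf (doubling_consts \<Omega> w)"

definition admissible_weight :: "'a::euclidean_space set \<Rightarrow> ('a \<Rightarrow> ennreal) \<Rightarrow> bool" where
  "admissible_weight \<Omega> w \<longleftrightarrow> loc_integrable_weight \<Omega> w \<and> doubling \<Omega> w \<and>
     (AE x in lebesgue_on \<Omega>. 0 < w x \<and> w x < \<infinity>)"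

(* The Poincare inequality is an inequality in [0,\<infinity>]. It says nothing when the integral of
   |grad u|^p over \<rho>B diverges; otherwise its left-hand side is finite, so u is integrable. *)

definition local_poincare ::
  "'a::euclidean_space set \<Rightarrow> real \<Rightarrow> ('a \<Rightarrow> ennreal) \<Rightarrow> bool" where
  "local_poincare \<Omega> p w \<longleftrightarrow>
     (\<exists>\<rho>\<ge>1. \<exists>C>0. \<forall>u x r. Ck_on 1 \<Omega> u \<and> r > 0 \<and> ball x (\<rho> * r) \<subseteq> \<Omega> \<and>
        set_integrable (weighted \<Omega> w) (ball x (\<rho> * r)) (\<lambda>y. norm (grad u y) powr p) \<longrightarrow>
        set_integrable (weighted \<Omega> w) (ball x r) u \<and>
        wavg (weighted \<Omega> w) (ball x r)
            (\<lambda>y. \<bar>u y - wavg (weighted \<Omega> w) (ball x r) u\<bar>)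
          \<le> C * r * wavg (weighted \<Omega> w) (ball x (\<rho> * r))
                      (\<lambda>y. norm (grad u y) powr p) powr (1 / p))"

definition weights_balance ::
  "'a::euclidean_space set \<Rightarrow> real \<Rightarrow> real \<Rightarrow> ('a \<Rightarrow> ennreal) \<Rightarrow> ('a \<Rightarrow> ennreal) \<Rightarrow> bool" where
  "weights_balance \<Omega> p q w1 w2 \<longleftrightarrow>
     (\<exists>C>0. \<forall>x y r R. 0 < r \<and> 0 < R \<and> ball x r \<subseteq> ball y R \<and> ball y R \<subseteq> \<Omega> \<longrightarrow>
        r / R * (measure (weighted \<Omega> w2) (ball x r)
                  / measure (weighted \<Omega> w2) (ball y R)) powr (1 / q)
          \<le> C * (measure (weighted \<Omega> w1) (ball x r)
                  / measure (weighted \<Omega> w1) (ball y R)) powr (1 / p))"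

(* An element of the completion of C_c^inf(\<Omega>) under the L^p(w) norm of the gradient, as a pair:
   G is the L^p(w) limit of the gradients of a sequence of test functions, i.e. the gradient of
   the element, and u is the function representing it, i.e. the limit of the same sequence in
   L^s(w), where s is an exponent for which the global Sobolev inequality holds. *)

definition D1p :: "'a::euclidean_space set \<Rightarrow> real \<Rightarrow> real \<Rightarrow> ('a \<Rightarrow> ennreal) \<Rightarrow>
    (('a \<Rightarrow> real) \<times> ('a \<Rightarrow> 'a)) set" where
  "D1p \<Omega> p s w = {(u, G).
     u \<in> borel_measurable (lebesgue_on \<Omega>) \<and> G \<in> borel_measurable (lebesgue_on \<Omega>) \<and>
     (\<exists>\<phi>. (\<forall>n::nat. \<phi> n \<in> Cinfc \<Omega>) \<and>
        (\<lambda>n. \<integral>\<^sup>+x. ennreal (norm (grad (\<phi> n) x - G x) powr p) \<partial>weighted \<Omega> w) \<longlonglongrightarrow> 0 \<and>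
        (\<lambda>n. \<integral>\<^sup>+x. ennreal (\<bar>\<phi> n x - u x\<bar> powr s) \<partial>weighted \<Omega> w) \<longlonglongrightarrow> 0)}"

(* G plays the role of grad u. *)

definition weak_solution :: "'a::euclidean_space set \<Rightarrow> real \<Rightarrow> real \<Rightarrow> ('a \<Rightarrow> ennreal) \<Rightarrow>
    ('a \<Rightarrow> ennreal) \<Rightarrow> ('a \<Rightarrow> real) \<Rightarrow> ('a \<Rightarrow> 'a) \<Rightarrow> bool" where
  "weak_solution \<Omega> p q w1 w2 u G \<longleftrightarrow>
     (\<forall>\<phi>\<in>Cinfc \<Omega>.
        (LINT x|weighted \<Omega> w1. norm (G x) powr (p - 2) * (G x \<bullet> grad \<phi> x))
          = (LINT x|weighted \<Omega> w2. \<bar>u x\<bar> powr (q - 2) * u x * \<phi> x))"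

end

theory Submission
  imports Defs
begin

text \<open>By the equation, the energy \<open>E k\<close> of \<open>u\<close> below a level \<open>k\<close> equals the integral of
  \<open>u\<^bsup>q-1\<^esup> min u k\<close> against \<open>w\<^sub>2\<close>, so the Sobolev inequality gives
  \<open>E k \<le> E (2 k) / 2 + K E (2 k)\<^bsup>q/p\<^esup>\<close>, and \<open>E k\<close> decays like a power of \<open>k\<close>. A De Giorgi
  iteration on exterior regions shows that \<open>u \<le> 2 \<mu> R\<^bsup>-p/(q1-p)\<^esup>\<close> for \<open>\<bar>x\<bar> > 2 R\<close> as soon as the
  critical norms of \<open>u\<close> outside the ball of radius \<open>R\<close> are below a fixed power of \<open>\<mu>\<close>.
  With \<open>\<mu> = 1\<close> this gives the decay without \<open>\<lambda>\<close>; then \<open>u\<close> coincides far out with its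
  truncation at a small level, so the decay of \<open>E\<close> makes the critical norms decay like a power of
  \<open>R\<close>, and the iteration applies again with \<open>\<mu> = R\<^bsup>-\<lambda>\<^esup>\<close>. No volume growth enters, because low levels are
  controlled through \<open>E\<close> and not by comparing norms on large balls.\<close>

section \<open>Smooth functions and cutoffs\<close>

text \<open>The equation may be tested only with smooth compactly supported functions, whereas the
  argument needs truncations of \<open>u\<close> multiplied by cutoffs that do not vanish at
  infinity. Moreover \<open>u\<close> is known to lie only in the critical spaces, so nothing puts
  \<open>u\<close> times the gradient of a cutoff into \<open>L^p(w1)\<close>. Two devices meet
  this. The truncations combined with cutoffs live above positive levels, where \<open>u > k\<close>
  turns the power \<open>p\<close> into the critical power \<open>q1\<close>. And admissibility of a
  test function is recorded as a list of facts that are stable under dominated limits, not as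
  membership in a function space.

  The exponent \<open>p / (q1 - p)\<close> is the one for which
  \<open>R powr (- p) * \<kappa> powr (- (q1 - p))\<close> equals 1 at
  \<open>\<kappa> = R powr (- p / (q1 - p))\<close>. This product is the coefficient through which
  radius and level enter the iteration. At a lower level it exceeds 1, and the mass that the
  iteration tolerates shrinks like a negative power of it; \<open>lam\<close> is as large as half of
  the decay of the energy can pay for, the other half being spent on constants.\<close>

lemma grad_eq:
  assumes "GDERIV f x :> D"
  shows "grad f x = D"
  unfolding grad_def
proof (rule the_equality)
  fix D' assume "GDERIV f x :> D'"
  then have "(\<lambda>h. h \<bullet> D') = (\<lambda>h. h \<bullet> D)"
    using assms unfolding gderiv_def by (rule has_derivative_unique)
  then show "D' = D"
    by (metis vector_eq_ldot)
qed (use assms in simp)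

text \<open>\<open>grad\<close> is a definite description, so smoothness is proved by exhibiting a
  gradient and checking the regularity of its components on the explicit formula.\<close>

lemma Ck_on_SucI:
  assumes "\<And>x. GDERIV f x :> D x" "\<And>b. b \<in> Basis \<Longrightarrow> Ck_on k UNIV (\<lambda>x. D x \<bullet> b)"
  shows "Ck_on (Suc k) UNIV f"
proof -
  have "grad f = D"
    using assms(1) by (auto simp: fun_eq_iff intro: grad_eq)
  then show ?thesis
    using assms by auto
qed

lemma Ck_on_Suc_gderiv:
  assumes "Ck_on (Suc k) UNIV f"
  shows "GDERIV f x :> grad f x"
  using assms by (auto dest: grad_eq)

lemma Ck_on_Suc_partial: "Ck_on (Suc k) UNIV f \<Longrightarrow> b \<in> Basis \<Longrightarrow> Ck_on k UNIV (\<lambda>x. grad f x \<bullet> b)"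
  by simp

lemma gderiv_isCont: "GDERIV f x :> D \<Longrightarrow> isCont f x"
  unfolding gderiv_def by (rule has_derivative_continuous)

text \<open>The product and chain rules leave factors undifferentiated; these must be lowered by one
  order before the induction hypotheses apply.\<close>

lemma Ck_on_mono_Suc: "Ck_on (Suc k) UNIV f \<Longrightarrow> Ck_on k UNIV f"
proof (induction k arbitrary: f)
  case 0
  then show ?case
    by (auto intro!: continuous_at_imp_continuous_on gderiv_isCont[OF Ck_on_Suc_gderiv[of 0]])
next
  case (Suc k)
  show ?case
  proof (rule Ck_on_SucI[OF Ck_on_Suc_gderiv[OF Suc.prems]])
    fix b :: 'a assume "b \<in> Basis"
    then show "Ck_on k UNIV (\<lambda>x. grad f x \<bullet> b)"
      by (intro Suc.IH Ck_on_Suc_partial[OF Suc.prems])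
  qed
qed

lemma Ck_on_const: "Ck_on k UNIV (\<lambda>x. c)"
proof (induction k arbitrary: c)
  case (Suc k)
  show ?case
    by (rule Ck_on_SucI[where D="\<lambda>x. 0"]) (use Suc[of 0] in \<open>simp_all add: GDERIV_const\<close>)
qed simp

lemma Ck_on_inner: "Ck_on k UNIV (\<lambda>x. x \<bullet> a)"
proof (cases k)
  case (Suc n)
  show ?thesis
    unfolding Suc
    by (rule Ck_on_SucI[where D="\<lambda>x. a"])
      (auto simp: Ck_on_const gderiv_def intro!: bounded_linear_imp_has_derivative bounded_linear_inner_left)
qed (auto intro!: continuous_intros)

lemma Ck_on_add: "Ck_on k UNIV f \<Longrightarrow> Ck_on k UNIV g \<Longrightarrow> Ck_on k UNIV (\<lambda>x. f x + g x)"
proof (induction k arbitrary: f g)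
  case (Suc k)
  show ?case
    by (rule Ck_on_SucI[OF GDERIV_add[OF Ck_on_Suc_gderiv[OF Suc.prems(1)] Ck_on_Suc_gderiv[OF Suc.prems(2)]]])
      (use Suc in \<open>simp add: inner_add_left\<close>)
qed (auto intro!: continuous_intros)

lemma Ck_on_mult: "Ck_on k UNIV f \<Longrightarrow> Ck_on k UNIV g \<Longrightarrow> Ck_on k UNIV (\<lambda>x. f x * g x)"
proof (induction k arbitrary: f g)
  case (Suc k)
  show ?case
  proof (rule Ck_on_SucI[OF GDERIV_mult[OF Ck_on_Suc_gderiv[OF Suc.prems(1)] Ck_on_Suc_gderiv[OF Suc.prems(2)]]])
    fix b :: 'a assume b: "b \<in> Basis"
    show "Ck_on k UNIV (\<lambda>x. (f x *\<^sub>R grad g x + g x *\<^sub>R grad f x) \<bullet> b)"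
      unfolding inner_add_left inner_scaleR_left
      by (intro Ck_on_add Suc.IH Suc.prems[THEN Ck_on_mono_Suc] Suc.prems[THEN Ck_on_Suc_partial] b)
  qed
qed (auto intro!: continuous_intros)

lemma Ck_on_diff: "Ck_on k UNIV f \<Longrightarrow> Ck_on k UNIV g \<Longrightarrow> Ck_on k UNIV (\<lambda>x. f x - g x)"
  using Ck_on_add[OF _ Ck_on_mult[OF Ck_on_const[of k "-1"]], of f g] by simp

lemma Ck_on_sum:
  assumes "finite I" "\<And>i. i \<in> I \<Longrightarrow> Ck_on k UNIV (f i)"
  shows "Ck_on k UNIV (\<lambda>x. \<Sum>i\<in>I. f i x)"
  using assms by (induction I) (simp_all add: Ck_on_const Ck_on_add)

lemma Ck_on_inner_self: "Ck_on k UNIV (\<lambda>x::'a::euclidean_space. x \<bullet> x)"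
proof -
  have "(\<lambda>x::'a. x \<bullet> x) = (\<lambda>x. \<Sum>b\<in>Basis. (x \<bullet> b) * (x \<bullet> b))"
    by (rule ext) (rule euclidean_inner)
  then show ?thesis
    by (simp only:) (intro Ck_on_sum Ck_on_mult Ck_on_inner finite_Basis)
qed

lemma Ck_on_compose:
  fixes F :: "real \<Rightarrow> real"
  shows "Ck_on k UNIV F \<Longrightarrow> Ck_on k UNIV f \<Longrightarrow> Ck_on k UNIV (\<lambda>x. F (f x))"
proof (induction k arbitrary: F f)
  case 0
  then show ?case
    using continuous_on_compose2[of UNIV F UNIV f] by simp
next
  case (Suc k)
  have F: "DERIV F t :> grad F t" for t
    using Ck_on_Suc_gderiv[OF Suc.prems(1)] by simp
  show ?case
  proof (rule Ck_on_SucI[OF GDERIV_DERIV_compose[OF Ck_on_Suc_gderiv[OF Suc.prems(2)] F]])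
    fix b :: 'a assume b: "b \<in> Basis"
    have "Ck_on k UNIV (grad F)"
      using Ck_on_Suc_partial[OF Suc.prems(1), of 1] by simp
    then show "Ck_on k UNIV (\<lambda>x. (grad F (f x) *\<^sub>R grad f x) \<bullet> b)"
      unfolding inner_scaleR_left
      by (rule Ck_on_mult[OF Suc.IH[OF _ Suc.prems(2)[THEN Ck_on_mono_Suc]] Suc.prems(2)[THEN Ck_on_Suc_partial, OF b]])
  qed
qed

lemma C1_continuous_grad:
  assumes "Ck_on 1 UNIV f"
  shows "continuous_on UNIV (grad f)"
proof (subst continuous_on_componentwise, rule ballI)
  fix b :: 'a assume "b \<in> Basis"
  then show "continuous_on UNIV (\<lambda>x. grad f x \<bullet> b)"
    using assms by simp
qed

text \<open>The family is closed under differentiation, since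
  \<open>g\<^sub>n' = g\<^bsub>n+2\<^esub> - n g\<^bsub>n+1\<^esub>\<close>; this makes \<open>g\<^sub>0 = exp (- 1 / t)\<close> smooth.\<close>

definition exp_bump :: "nat \<Rightarrow> real \<Rightarrow> real" where
  "exp_bump n t = (if t > 0 then (1 / t) ^ n * exp (- (1 / t)) else 0)"

lemma exp_bump_nonneg: "0 \<le> exp_bump n t"
  by (simp add: exp_bump_def)

text \<open>A single term of the exponential series gives \<open>y ^ n / fact n \<le> exp y\<close>,
  taken at \<open>y = 1 / t\<close>. The resulting bound 1 for \<open>n = 0\<close> and
  \<open>n = 1\<close> later controls the regularized truncations and their derivatives.\<close>

lemma exp_bump_le: "exp_bump n t \<le> fact n"
proof (cases "t > 0")
  case True
  have "(1 / t) ^ n / fact n \<le> exp (1 / t)"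
    using sum_le_suminf[OF summable_exp[of "1 / t"], of "{n}"] True by (simp add: exp_def field_simps)
  then show ?thesis
    using True by (simp add: exp_bump_def exp_minus field_simps)
qed (simp add: exp_bump_def)

lemma tendsto_exp_bump_0: "(exp_bump n \<longlongrightarrow> 0) (at_right 0)"
proof -
  have "((\<lambda>s. s ^ n / exp s) \<longlongrightarrow> (0::real)) at_top"
    by (rule tendsto_power_div_exp_0)
  then have "((\<lambda>t::real. (inverse t) ^ n / exp (inverse t)) \<longlongrightarrow> 0) (at_right 0)"
    by (rule filterlim_compose) (rule filterlim_inverse_at_top_right)
  moreover have "eventually (\<lambda>t. (inverse t) ^ n / exp (inverse t) = exp_bump n t) (at_right 0)"
    unfolding eventually_at_right_field
    by (intro exI[of _ 1]) (auto simp: exp_bump_def exp_minus field_simps)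
  ultimately show ?thesis
    by (rule Lim_transform_eventually)
qed

lemma DERIV_exp_bump: "DERIV (exp_bump n) t :> exp_bump (n + 2) t - real n * exp_bump (n + 1) t"
proof -
  consider "t > 0" | "t < 0" | "t = 0" by linarith
  then show ?thesis
  proof cases
    case 1
    have d: "DERIV (\<lambda>t. 1 / t) t :> - ((1 / t) * (1 / t))"
      using 1 by (auto intro!: derivative_eq_intros simp: field_simps)
    have e: "DERIV (\<lambda>t. exp (- (1 / t))) t :> exp (- (1 / t)) * ((1 / t) * (1 / t))"
      using DERIV_chain2[OF DERIV_exp DERIV_minus[OF d]] by simp
    have "DERIV (\<lambda>t. (1 / t) ^ n * exp (- (1 / t))) t :> exp_bump (n + 2) t - real n * exp_bump (n + 1) t"
    proof (cases n)
      case 0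
      then show ?thesis
        using e 1 by (simp add: exp_bump_def power2_eq_square algebra_simps)
    next
      case (Suc m)
      show ?thesis
        unfolding Suc
        by (rule DERIV_cong[OF DERIV_mult[OF DERIV_power_Suc[OF d, of m] e]])
          (use 1 in \<open>simp add: exp_bump_def algebra_simps\<close>)
    qed
    then show ?thesis
      by (rule has_field_derivative_transform_within_open[where S="{0<..}"])
        (use 1 in \<open>auto simp: exp_bump_def\<close>)
  next
    case 2
    have "DERIV (\<lambda>t. 0) t :> exp_bump (n + 2) t - real n * exp_bump (n + 1) t"
      using 2 by (simp add: exp_bump_def)
    then show ?thesis
      by (rule has_field_derivative_transform_within_open[where S="{..<0}"])
        (use 2 in \<open>auto simp: exp_bump_def\<close>)
  next
    case 3
    \<comment> \<open>Since \<open>exp_bump n 0 = 0\<close>, the right difference quotient at 0 is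
      itself a member of the family, one index higher.\<close>
    have R: "((\<lambda>y. (exp_bump n y - exp_bump n 0) / (y - 0)) \<longlongrightarrow> 0) (at_right 0)"
    proof (rule Lim_transform_eventually[OF tendsto_exp_bump_0[of "Suc n"]])
      show "eventually (\<lambda>y. exp_bump (Suc n) y = (exp_bump n y - exp_bump n 0) / (y - 0)) (at_right 0)"
        unfolding eventually_at_right_field
        by (intro exI[of _ 1]) (auto simp: exp_bump_def)
    qed
    have L: "((\<lambda>y. (exp_bump n y - exp_bump n 0) / (y - 0)) \<longlongrightarrow> 0) (at_left 0)"
    proof (rule Lim_transform_eventually[OF tendsto_const[of 0]])
      show "eventually (\<lambda>y. 0 = (exp_bump n y - exp_bump n 0) / (y - 0)) (at_left 0)"
        unfolding eventually_at_left_field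
        by (intro exI[of _ "-1"]) (auto simp: exp_bump_def)
    qed
    show ?thesis
      using filterlim_split_at[OF L R] 3
      by (simp add: has_field_derivative_iff exp_bump_def)
  qed
qed

lemma Ck_on_exp_bump: "Ck_on k UNIV (exp_bump n)"
proof (induction k arbitrary: n)
  case 0
  show ?case
    by (auto intro!: continuous_at_imp_continuous_on DERIV_isCont DERIV_exp_bump)
next
  case (Suc k)
  show ?case
  proof (rule Ck_on_SucI)
    show "GDERIV (exp_bump n) t :> exp_bump (n + 2) t - real n * exp_bump (n + 1) t" for t
      using DERIV_exp_bump by simp
    show "Ck_on k UNIV (\<lambda>t. (exp_bump (n + 2) t - real n * exp_bump (n + 1) t) \<bullet> b)" if "b \<in> Basis" for b
      using that by (simp only: Basis_real_def singleton_iff inner_real_def mult_1_right)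
        (intro Ck_on_diff Ck_on_mult Ck_on_const Suc)
  qed
qed


text \<open>With \<open>t = (\<bar>x\<bar>\<^sup>2 - a\<^sup>2) / (b\<^sup>2 - a\<^sup>2)\<close>, the function \<open>exp (- 1 / t)\<close> is its own
  cutoff: its derivative \<open>t\<^sup>-\<^sup>2 exp (- 1 / t)\<close> is bounded by a multiple of its power \<open>1 - 1 / p\<close>,
  which is what Caccioppoli's inequality needs.\<close>

definition cutoff :: "real \<Rightarrow> real \<Rightarrow> 'a::euclidean_space \<Rightarrow> real" where
  "cutoff a b x = exp_bump 0 ((x \<bullet> x - a\<^sup>2) / (b\<^sup>2 - a\<^sup>2))"

lemma Ck_on_cutoff: "Ck_on k UNIV (cutoff a b)"
proof -
  have "Ck_on k UNIV (\<lambda>x::'a. exp_bump 0 ((1 / (b\<^sup>2 - a\<^sup>2)) * (x \<bullet> x - a\<^sup>2)))"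
    by (intro Ck_on_compose[OF Ck_on_exp_bump] Ck_on_mult Ck_on_diff Ck_on_const Ck_on_inner_self)
  then show ?thesis
    unfolding cutoff_def[abs_def] by simp
qed

lemma grad_cutoff:
  "grad (cutoff a b) x
     = (exp_bump 2 ((x \<bullet> x - a\<^sup>2) / (b\<^sup>2 - a\<^sup>2)) * (2 / (b\<^sup>2 - a\<^sup>2))) *\<^sub>R x"
proof -
  have "GDERIV (\<lambda>x. (x \<bullet> x - a\<^sup>2) / (b\<^sup>2 - a\<^sup>2)) x :> (2 / (b\<^sup>2 - a\<^sup>2)) *\<^sub>R x"
    unfolding gderiv_def
    by (auto intro!: derivative_eq_intros simp: fun_eq_iff inner_commute divide_inverse)
  from GDERIV_DERIV_compose[OF this DERIV_exp_bump[of 0]]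
  have "GDERIV (\<lambda>x. exp_bump 0 ((x \<bullet> x - a\<^sup>2) / (b\<^sup>2 - a\<^sup>2))) x
     :> (exp_bump 2 ((x \<bullet> x - a\<^sup>2) / (b\<^sup>2 - a\<^sup>2)) * (2 / (b\<^sup>2 - a\<^sup>2))) *\<^sub>R x"
    by (simp add: numeral_2_eq_2)
  then show ?thesis
    unfolding cutoff_def[abs_def] by (rule grad_eq)
qed

lemma cutoff_bounds: "0 \<le> cutoff a b x" "cutoff a b x \<le> 1"
  using exp_bump_nonneg exp_bump_le[of 0] by (simp_all add: cutoff_def)

lemma inner_self_less_iff: "0 \<le> a \<Longrightarrow> a\<^sup>2 < x \<bullet> x \<longleftrightarrow> a < norm x"
  by (metis norm_ge_zero power2_norm_eq_inner power_mono_iff linorder_not_le pos2)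

lemma cutoff_eq_0:
  assumes "0 \<le> a" "a < b" "norm x \<le> a"
  shows "cutoff a b x = 0" "grad (cutoff a b) x = 0"
proof -
  have "a\<^sup>2 < b\<^sup>2"
    using assms by (intro power_strict_mono) auto
  moreover have "x \<bullet> x \<le> a\<^sup>2"
    using assms inner_self_less_iff[of a x] by linarith
  ultimately have "(x \<bullet> x - a\<^sup>2) / (b\<^sup>2 - a\<^sup>2) \<le> 0"
    by (simp add: divide_nonpos_pos)
  then show "cutoff a b x = 0" "grad (cutoff a b) x = 0"
    by (simp_all add: cutoff_def grad_cutoff exp_bump_def)
qed

text \<open>The cutoff never reaches 1. The bound from below by \<open>1 / e\<close> suffices, as it
  costs only a factor \<open>exp s\<close> in an integral of a power \<open>s\<close>.\<close>

lemma cutoff_ge: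
  assumes "0 \<le> a" "a < b" "b \<le> norm x"
  shows "exp (- 1) \<le> cutoff a b x"
proof -
  define t where "t = (x \<bullet> x - a\<^sup>2) / (b\<^sup>2 - a\<^sup>2)"
  have "a\<^sup>2 < b\<^sup>2"
    using assms by (intro power_strict_mono) auto
  moreover have "b\<^sup>2 \<le> x \<bullet> x"
    using assms by (simp flip: power2_norm_eq_inner add: power_mono)
  ultimately have "1 \<le> t"
    by (simp add: t_def)
  then have "1 / t \<le> 1" "0 < t"
    by simp_all
  then show ?thesis
    unfolding cutoff_def t_def[symmetric] by (simp add: exp_bump_def)
qed

text \<open>With \<open>y = 1 / t\<close> the cutoff is \<open>exp (- y)\<close> and its gradient
  carries \<open>y\<^sup>2 * exp (- y)\<close>. Splitting \<open>exp (- y)\<close> into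
  \<open>exp (- (y / p))\<close> and \<open>exp (- y * (1 - 1 / p))\<close>, the first factor bounds
  the polynomial in \<open>y\<close> and the second is the asserted power of the cutoff.\<close>

lemma norm_grad_cutoff_le:
  assumes "0 \<le> a" "a < b" "0 < p"
  shows "norm (grad (cutoff a b) x) \<le> (8 * p\<^sup>2 + 2 * p) / (b - a) * cutoff a b x powr (1 - 1 / p)"
proof -
  define t where "t = (x \<bullet> x - a\<^sup>2) / (b\<^sup>2 - a\<^sup>2)"
  have ab: "a\<^sup>2 < b\<^sup>2"
    using assms by (intro power_strict_mono) auto
  have gc: "grad (cutoff a b) x = (exp_bump 2 t * (2 / (b\<^sup>2 - a\<^sup>2))) *\<^sub>R x"
    and c: "cutoff a b x = exp_bump 0 t"
    by (simp_all only: grad_cutoff cutoff_def t_def)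
  show ?thesis
  proof (cases "0 < t")
    case False
    then show ?thesis
      by (simp add: gc c exp_bump_def)
  next
    case True
    define y where "y = 1 / t"
    have y: "0 < y" using True by (simp add: y_def)
    have x2: "(norm x)\<^sup>2 = a\<^sup>2 + t * (b\<^sup>2 - a\<^sup>2)"
      using ab by (simp add: t_def power2_norm_eq_inner)
    \<comment> \<open>The gradient contains the unbounded factor \<open>x\<close>. As
      \<open>norm x\<close> grows at most like \<open>b * (2 + t)\<close>, the factor
      \<open>y\<^sup>2\<close> absorbs it and the estimate holds out to infinity.\<close>
    have nx: "norm x * y\<^sup>2 \<le> b * (2 * y\<^sup>2 + y)"
    proof -
      have "(norm x)\<^sup>2 \<le> b\<^sup>2 * (1 + t)"
      proof -
        have "t * (b\<^sup>2 - a\<^sup>2) \<le> t * b\<^sup>2"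
          using True by (intro mult_left_mono) auto
        then show ?thesis using ab x2 by (simp add: algebra_simps)
      qed
      also have "\<dots> \<le> b\<^sup>2 * (2 + t)\<^sup>2"
        using True by (intro mult_left_mono) (auto simp: power2_eq_square algebra_simps)
      finally have "(norm x)\<^sup>2 \<le> (b * (2 + t))\<^sup>2"
        by (simp add: power_mult_distrib)
      then have "norm x \<le> b * (2 + t)"
        by (rule power2_le_imp_le) (use True assms in auto)
      then have "norm x * y\<^sup>2 \<le> b * (2 + t) * y\<^sup>2"
        by (intro mult_right_mono) auto
      also have "\<dots> = b * (2 * y\<^sup>2 + y)"
        using True by (simp add: y_def field_simps power2_eq_square)
      finally show ?thesis .
    qed
    have e1: "y * exp (- (y / p)) \<le> p"
    proof -
      have "y / p \<le> exp (y / p)"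
        using exp_ge_add_one_self[of "y / p"] by linarith
      then show ?thesis
        using assms by (simp add: exp_minus field_simps)
    qed
    have e2: "y\<^sup>2 * exp (- (y / p)) \<le> 2 * p\<^sup>2"
    proof -
      have "(y / p)\<^sup>2 / 2 \<le> exp (y / p)"
        using exp_lower_Taylor_quadratic[of "y / p"] y assms
        by (smt (verit) divide_nonneg_nonneg)
      then show ?thesis
        using assms by (simp add: exp_minus field_simps power_divide)
    qed
    \<comment> \<open>Cancels the factor \<open>b\<close> of the previous bound, so that only
      \<open>1 / (b - a)\<close> remains, without dependence on the radii themselves.\<close>
    have bb: "b * (b - a) \<le> b\<^sup>2 - a\<^sup>2"
      using assms by (simp add: power2_eq_square algebra_simps mult_left_mono)
    have "norm (grad (cutoff a b) x) = y\<^sup>2 * exp (- y) * (2 / (b\<^sup>2 - a\<^sup>2)) * norm x"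
      using True ab by (simp add: gc exp_bump_def y_def)
    also have "\<dots> = 2 * (norm x * y\<^sup>2) * exp (- y) / (b\<^sup>2 - a\<^sup>2)"
      by simp
    also have "\<dots> \<le> 2 * (b * (2 * y\<^sup>2 + y)) * exp (- y) / (b * (b - a))"
      using nx bb ab assms y
      by (intro frac_le mult_right_mono mult_left_mono mult_nonneg_nonneg add_nonneg_nonneg) auto
    also have "\<dots> = 2 * (2 * (y\<^sup>2 * exp (- (y / p))) + y * exp (- (y / p))) * exp (- y * (1 - 1 / p)) / (b - a)"
    proof -
      have e: "exp (- y) = exp (- (y / p)) * exp (- y * (1 - 1 / p))"
        using assms by (simp flip: exp_add add: right_diff_distrib)
      have "2 * (b * (2 * y\<^sup>2 + y)) * exp (- y) / (b * (b - a)) = 2 * (2 * y\<^sup>2 + y) * exp (- y) / (b - a)"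
        using assms by simp
      also have "\<dots> = 2 * (2 * (y\<^sup>2 * exp (- (y / p))) + y * exp (- (y / p))) * exp (- y * (1 - 1 / p)) / (b - a)"
        unfolding e by (simp only: algebra_simps)
      finally show ?thesis .
    qed
    also have "\<dots> \<le> 2 * (2 * (2 * p\<^sup>2) + p) * exp (- y * (1 - 1 / p)) / (b - a)"
      using e1 e2 assms by (intro divide_right_mono mult_right_mono mult_left_mono add_mono) auto
    also have "exp (- y * (1 - 1 / p)) = cutoff a b x powr (1 - 1 / p)"
      using True by (simp add: c exp_bump_def y_def powr_def)
    also have "2 * (2 * (2 * p\<^sup>2) + p) * cutoff a b x powr (1 - 1 / p) / (b - a)
        = (8 * p\<^sup>2 + 2 * p) / (b - a) * cutoff a b x powr (1 - 1 / p)"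
      by simp
    finally show ?thesis .
  qed
qed

section \<open>Weighted measures and approximation\<close>

lemma powr_add_le:
  fixes a b s :: real
  assumes "0 \<le> a" "0 \<le> b" "0 \<le> s"
  shows "(a + b) powr s \<le> 2 powr s * (a powr s + b powr s)"
proof -
  have "(a + b) powr s \<le> (2 * max a b) powr s"
    using assms by (intro powr_mono2) auto
  also have "\<dots> = 2 powr s * max a b powr s"
    using assms by (simp add: powr_mult)
  also have "max a b powr s \<le> a powr s + b powr s"
    by (simp add: max_def)
  finally show ?thesis by simp
qed

lemma powr_mult_powr_le:
  fixes a b s :: real
  assumes "0 \<le> a" "0 \<le> b" "1 < s"
  shows "a powr (s - 1) * b \<le> a powr s + b powr s"
proof -
  have *: "c powr (s - 1) * c = c powr s" if "0 \<le> c" for c :: real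
    using powr_mult_base[OF that, of "s - 1"] by (simp add: mult.commute)
  show ?thesis
  proof (cases "a \<le> b")
    case True
    then have "a powr (s - 1) * b \<le> b powr (s - 1) * b"
      using assms by (intro mult_right_mono powr_mono2) auto
    then show ?thesis
      using *[OF assms(2)] by (smt (verit) powr_ge_zero)
  next
    case False
    then have "a powr (s - 1) * b \<le> a powr (s - 1) * a"
      using assms by (intro mult_left_mono) auto
    then show ?thesis
      using *[OF assms(1)] by (smt (verit) powr_ge_zero)
  qed
qed

text \<open>The partial converse of dominated convergence, as in the Riesz-Fischer theorem: along a
  subsequence whose integrals are summable, the sum of the functions is an integrable majorant, and
  it forces pointwise convergence because the terms of a convergent series tend to 0.\<close>

lemma dominated_subsequence:
  fixes d :: "nat \<Rightarrow> 'b \<Rightarrow> real"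
  assumes [measurable]: "\<And>n. d n \<in> borel_measurable M"
    and nonneg: "\<And>n x. 0 \<le> d n x"
    and lim: "(\<lambda>n. \<integral>\<^sup>+x. ennreal (d n x) \<partial>M) \<longlonglongrightarrow> 0"
  obtains r :: "nat \<Rightarrow> nat" and g where "strict_mono r" "integrable M g" "\<And>x. 0 \<le> g x"
    "AE x in M. (\<forall>n. d (r n) x \<le> g x) \<and> (\<lambda>n. d (r n) x) \<longlonglongrightarrow> 0"
proof -
  have "\<exists>N. \<forall>n\<ge>N. (\<integral>\<^sup>+x. ennreal (d n x) \<partial>M) < ennreal ((1 / 2) ^ k)" for k
    using order_tendstoD(2)[OF lim, of "ennreal ((1 / 2) ^ k)"] by (simp add: eventually_sequentially)
  then obtain N where N: "\<And>k n. N k \<le> n \<Longrightarrow> (\<integral>\<^sup>+x. ennreal (d n x) \<partial>M) < ennreal ((1 / 2) ^ k)"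
    by metis
  \<comment> \<open>Summing the thresholds and adding \<open>k\<close> makes the selection strictly
    increasing while it stays above \<open>N k\<close>.\<close>
  define r where "r k = (\<Sum>i\<le>k. N i) + k" for k
  have r: "strict_mono r"
    by (rule strict_mono_Suc_iff[THEN iffD2]) (simp add: r_def)
  have rN: "N k \<le> r k" for k
  proof -
    have "N k \<le> (\<Sum>i\<le>k. N i)"
      by (rule member_le_sum) auto
    then show ?thesis by (simp add: r_def)
  qed
  define S where "S x = (\<Sum>k. ennreal (d (r k) x))" for x
  have [measurable]: "S \<in> borel_measurable M"
    unfolding S_def by measurable
  have "(\<integral>\<^sup>+x. S x \<partial>M) = (\<Sum>k. \<integral>\<^sup>+x. ennreal (d (r k) x) \<partial>M)"
    unfolding S_def by (rule nn_integral_suminf) measurable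
  also have "\<dots> \<le> (\<Sum>k. ennreal ((1 / 2) ^ k))"
    using N[OF rN] by (intro suminf_le less_imp_le) auto
  also have "\<dots> = ennreal (\<Sum>k. (1 / 2) ^ k)"
    by (intro suminf_ennreal2) auto
  finally have fin: "(\<integral>\<^sup>+x. S x \<partial>M) < \<infinity>"
    by (simp add: le_less_trans)
  then have AE: "AE x in M. S x \<noteq> \<infinity>"
    by (intro nn_integral_noteq_infinite) auto
  show thesis
  proof (rule that[OF r])
    \<comment> \<open>\<open>S\<close> may be infinite on a null set, where \<open>enn2real\<close>
      returns 0; the domination is claimed only almost everywhere.\<close>
    show "integrable M (\<lambda>x. enn2real (S x))"
    proof (rule integrableI_bounded)
      have "(\<integral>\<^sup>+x. ennreal (norm (enn2real (S x))) \<partial>M) \<le> (\<integral>\<^sup>+x. S x \<partial>M)"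
        by (intro nn_integral_mono) (auto simp: ennreal_enn2real_if)
      then show "(\<integral>\<^sup>+x. ennreal (norm (enn2real (S x))) \<partial>M) < \<infinity>"
        using fin by (rule le_less_trans)
    qed simp
    show "AE x in M. (\<forall>n. d (r n) x \<le> enn2real (S x)) \<and> (\<lambda>n. d (r n) x) \<longlonglongrightarrow> 0"
      using AE
    proof eventually_elim
      case (elim x)
      have sm: "summable (\<lambda>n. d (r n) x)"
        using elim nonneg unfolding S_def by (intro summable_suminf_not_top) auto
      then have s: "enn2real (S x) = (\<Sum>n. d (r n) x)"
        unfolding S_def using nonneg by (subst suminf_ennreal2) (simp_all add: suminf_nonneg)
      have "d (r n) x \<le> (\<Sum>n. d (r n) x)" for n
        using sum_le_suminf[OF sm, of "{n}"] nonneg by simp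
      then show ?case
        unfolding s using summable_LIMSEQ_zero[OF sm] by blast
    qed
  qed simp
qed

section \<open>Measurability and integrability of test functions with respect to a weight\<close>

lemma continuous_imp_measurable_lebesgue_on:
  assumes "continuous_on UNIV f"
  shows "f \<in> borel_measurable (lebesgue_on \<Omega>)"
  using borel_measurable_continuous_onI[OF assms]
  by (intro measurable_restrict_space1 measurable_completion) simp

lemma measurable_weighted [simp]: "borel_measurable (weighted \<Omega> w) = borel_measurable (lebesgue_on \<Omega>)"
  unfolding weighted_def by (rule measurable_cong_sets) simp_all

lemma space_weighted [simp]: "space (weighted \<Omega> w) = \<Omega>"
  by (simp add: weighted_def space_restrict_space)

text \<open>A density that is positive almost everywhere leaves the null sets unchanged, so
  exceptional sets for the two weights can be merged into one.\<close>

lemma AE_weighted_iff: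
  assumes "w \<in> borel_measurable (lebesgue_on \<Omega>)" "AE x in lebesgue_on \<Omega>. 0 < w x"
  shows "(AE x in weighted \<Omega> w. P x) \<longleftrightarrow> (AE x in lebesgue_on \<Omega>. P x)"
  unfolding weighted_def AE_density[OF assms(1)] using assms(2) by fastforce

lemma Cinfc_subset_C1c: "Cinfc \<Omega> \<subseteq> C1c \<Omega>"
  unfolding Cinfc_def C1c_def by blast

lemma C1c_continuous:
  assumes "f \<in> C1c \<Omega>"
  shows "continuous_on UNIV f" "continuous_on UNIV (grad f)"
proof -
  have f: "Ck_on (Suc 0) UNIV f"
    using assms by (simp add: C1c_def del: Ck_on.simps)
  show "continuous_on UNIV f"
    using Ck_on_mono_Suc[OF f] by simp
  show "continuous_on UNIV (grad f)"
    using C1_continuous_grad f by (simp del: Ck_on.simps)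
qed

lemma grad_outside_support:
  assumes "x \<notin> closure {x. f x \<noteq> 0}"
  shows "grad f x = 0"
proof (rule grad_eq)
  define S where "S = closure {x. f x \<noteq> 0}"
  have S: "f y = 0" if "y \<notin> S" for y
    using that closure_subset[of "{x. f x \<noteq> 0}"] unfolding S_def by blast
  have "x \<in> - S" "open (- S)"
    using assms by (auto simp: S_def)
  then have "x \<in> - S \<Longrightarrow> GDERIV f x :> 0"
    using has_derivative_transform_within_open[OF GDERIV_const[of 0 x, unfolded gderiv_def], of "- S" f] S
    unfolding gderiv_def by auto
  then show "GDERIV f x :> 0"
    using assms by (simp add: S_def)
qed

lemma integrable_compact_support:
  fixes f :: "'a::euclidean_space \<Rightarrow> real"
  assumes "loc_integrable_weight \<Omega> w" "continuous_on UNIV f" "compact S" "S \<subseteq> \<Omega>"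
    and "\<And>x. x \<notin> S \<Longrightarrow> f x = 0"
  shows "integrable (weighted \<Omega> w) f"
proof -
  have "compact (f ` S)"
    using compact_continuous_image[OF continuous_on_subset[OF assms(2)] assms(3)] by simp
  then obtain B where B: "\<And>x. x \<in> S \<Longrightarrow> norm (f x) \<le> B"
    using compact_imp_bounded bounded_iff by (metis imageI)
  have "S \<in> sets lebesgue"
    using assms(3) by (simp add: borel_closed compact_imp_closed)
  then have S: "S \<in> sets (weighted \<Omega> w)"
    using assms(4) by (auto simp: weighted_def sets_restrict_space image_iff intro!: exI[of _ S])
  show ?thesis
  proof (rule integrableI_bounded_set[OF S])
    show "emeasure (weighted \<Omega> w) S < \<infinity>"
      using assms by (simp add: loc_integrable_weight_def)
  qed (use assms B in \<open>auto simp: continuous_imp_measurable_lebesgue_on\<close>)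
qed

lemma continuous_on_norm_powr:
  fixes f :: "'a::topological_space \<Rightarrow> 'b::real_normed_vector"
  assumes "continuous_on S f" "0 < s"
  shows "continuous_on S (\<lambda>x. norm (f x) powr s)"
  using assms by (intro continuous_on_powr' continuous_intros) auto

lemma C1c_integrable:
  assumes "loc_integrable_weight \<Omega> w" "f \<in> C1c \<Omega>" "0 < s"
  shows "integrable (weighted \<Omega> w) (\<lambda>x. \<bar>f x\<bar> powr s)"
    and "integrable (weighted \<Omega> w) (\<lambda>x. norm (grad f x) powr s)"
proof -
  define S where "S = closure {x. f x \<noteq> 0}"
  have S: "compact S" "S \<subseteq> \<Omega>"
    using assms(2) by (simp_all add: S_def C1c_def compact_support_in_def)
  have "f x = 0" "grad f x = 0" if "x \<notin> S" for x
    using that grad_outside_support[of x f] closure_subset[of "{x. f x \<noteq> 0}"] by (auto simp: S_def)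
  then show "integrable (weighted \<Omega> w) (\<lambda>x. \<bar>f x\<bar> powr s)"
    and "integrable (weighted \<Omega> w) (\<lambda>x. norm (grad f x) powr s)"
    using continuous_on_norm_powr[OF C1c_continuous(1)[OF assms(2)] assms(3)]
      continuous_on_norm_powr[OF C1c_continuous(2)[OF assms(2)] assms(3)]
    by (auto intro!: integrable_compact_support[OF assms(1) _ S])
qed

lemma compact_support_in_subset:
  assumes "compact T" "T \<subseteq> \<Omega>" "\<And>x. x \<notin> T \<Longrightarrow> f x = 0"
  shows "compact_support_in \<Omega> f"
proof -
  have sub: "closure {x. f x \<noteq> 0} \<subseteq> T"
    using assms(3) by (intro closure_minimal compact_imp_closed assms(1)) blast
  have "compact (T \<inter> closure {x. f x \<noteq> 0})"
    using assms(1) by (rule compact_Int_closed) (rule closed_closure)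
  moreover have "T \<inter> closure {x. f x \<noteq> 0} = closure {x. f x \<noteq> 0}"
    using sub by (rule Int_absorb1)
  ultimately show ?thesis
    using sub assms(2) unfolding compact_support_in_def by (metis order_trans)
qed

lemma C1c_diff:
  assumes "f \<in> C1c \<Omega>" "g \<in> C1c \<Omega>"
  shows "(\<lambda>x. f x - g x) \<in> C1c \<Omega>" "grad (\<lambda>x. f x - g x) x = grad f x - grad g x"
proof -
  have f: "Ck_on (Suc 0) UNIV f" and g: "Ck_on (Suc 0) UNIV g"
    and supp: "compact_support_in \<Omega> f" "compact_support_in \<Omega> g"
    using assms by (simp_all add: C1c_def del: Ck_on.simps)
  define T where "T = closure {x. f x \<noteq> 0} \<union> closure {x. g x \<noteq> 0}"
  have "compact T" "T \<subseteq> \<Omega>"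
    using supp unfolding T_def compact_support_in_def by blast+
  moreover have "f x - g x = 0" if "x \<notin> T" for x
  proof -
    have "f x = 0"
      using that closure_subset[of "{x. f x \<noteq> 0}"] unfolding T_def by blast
    moreover have "g x = 0"
      using that closure_subset[of "{x. g x \<noteq> 0}"] unfolding T_def by blast
    ultimately show ?thesis by simp
  qed
  ultimately have "compact_support_in \<Omega> (\<lambda>x. f x - g x)"
    by (rule compact_support_in_subset)
  then show "(\<lambda>x. f x - g x) \<in> C1c \<Omega>"
    using Ck_on_diff[OF f g] by (simp add: C1c_def del: Ck_on.simps)
  show "grad (\<lambda>x. f x - g x) x = grad f x - grad g x"
    by (intro grad_eq GDERIV_diff Ck_on_Suc_gderiv[OF f] Ck_on_Suc_gderiv[OF g])
qed


text \<open>The Sobolev inequalities are raised to the powers \<open>q1\<close> and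
  \<open>q\<close>, with a common constant, to match the integrals of the iteration. All assumptions
  are stable under replacing \<open>u\<close> and \<open>G\<close> by their negatives, so an upper
  bound proved here also yields a lower bound.\<close>

locale critical_solution =
  fixes \<Omega> :: "'a::euclidean_space set"
    and w1 w2 :: "'a \<Rightarrow> ennreal"
    and p q q1 K :: real
    and u :: "'a \<Rightarrow> real" and G :: "'a \<Rightarrow> 'a"
  assumes loc1: "loc_integrable_weight \<Omega> w1" and loc2: "loc_integrable_weight \<Omega> w2"
    and pos1: "AE x in lebesgue_on \<Omega>. 0 < w1 x" and pos2: "AE x in lebesgue_on \<Omega>. 0 < w2 x"
    and p_gt_1: "1 < p" and p_less_q: "p < q" and p_less_q1: "p < q1" and K_pos: "0 < K"
    and sobolev1: "\<And>v. v \<in> C1c \<Omega> \<Longrightarrow> (LINT x|weighted \<Omega> w1. \<bar>v x\<bar> powr q1)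
        \<le> K * (LINT x|weighted \<Omega> w1. norm (grad v x) powr p) powr (q1 / p)"
    and sobolev2: "\<And>v. v \<in> C1c \<Omega> \<Longrightarrow> (LINT x|weighted \<Omega> w2. \<bar>v x\<bar> powr q)
        \<le> K * (LINT x|weighted \<Omega> w1. norm (grad v x) powr p) powr (q / p)"
    and D1p: "(u, G) \<in> D1p \<Omega> p q1 w1"
    and weak: "weak_solution \<Omega> p q w1 w2 u G"
begin

abbreviation "M1 \<equiv> weighted \<Omega> w1"
abbreviation "M2 \<equiv> weighted \<Omega> w2"
abbreviation "L \<equiv> lebesgue_on \<Omega>"

lemma AE_M1: "(AE x in M1. P x) \<longleftrightarrow> (AE x in L. P x)"
  and AE_M2: "(AE x in M2. P x) \<longleftrightarrow> (AE x in L. P x)"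
  using loc1 loc2 pos1 pos2 by (simp_all add: AE_weighted_iff loc_integrable_weight_def)

lemma u_measurable [measurable]: "u \<in> borel_measurable L"
  and G_measurable [measurable]: "G \<in> borel_measurable L"
  using D1p by (auto simp: D1p_def)

lemma Cinfc_measurable:
  assumes "f \<in> Cinfc \<Omega>"
  shows "f \<in> borel_measurable L" "grad f \<in> borel_measurable L"
  using C1c_continuous[of f \<Omega>] assms Cinfc_subset_C1c
  by (auto intro: continuous_imp_measurable_lebesgue_on)

text \<open>Membership in \<open>D1p\<close> speaks of \<open>w1\<close> only. The second Sobolev
  inequality, applied to differences, makes the approximating sequence Cauchy in
  \<open>L^q(w2)\<close>; almost everywhere convergence identifies the limit there as
  \<open>u\<close>. Passing to subsequences then supplies majorants in all three spaces.\<close>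

lemma approximation:
  obtains \<phi> A1 A2 B where "\<And>n::nat. \<phi> n \<in> Cinfc \<Omega>"
    "\<And>x. 0 \<le> A1 x" "\<And>x. 0 \<le> A2 x" "\<And>x. 0 \<le> B x"
    "A1 \<in> borel_measurable L" "A2 \<in> borel_measurable L" "B \<in> borel_measurable L"
    "integrable M1 (\<lambda>x. A1 x powr q1)" "integrable M2 (\<lambda>x. A2 x powr q)" "integrable M1 (\<lambda>x. B x powr p)"
    "AE x in L. (\<forall>n. \<bar>\<phi> n x\<bar> \<le> A1 x \<and> \<bar>\<phi> n x\<bar> \<le> A2 x \<and> norm (grad (\<phi> n) x) \<le> B x) \<and>
       (\<lambda>n. \<phi> n x) \<longlonglongrightarrow> u x \<and> (\<lambda>n. grad (\<phi> n) x) \<longlonglongrightarrow> G x"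
proof -
  have q1_pos: "0 < q1" and q_pos: "0 < q" and p_pos: "0 < p"
    using p_gt_1 p_less_q p_less_q1 by auto
  obtain \<psi> where \<psi>: "\<And>n::nat. \<psi> n \<in> Cinfc \<Omega>"
    and lims: "(\<lambda>n. \<integral>\<^sup>+x. ennreal (norm (grad (\<psi> n) x - G x) powr p) \<partial>M1) \<longlonglongrightarrow> 0"
      "(\<lambda>n. \<integral>\<^sup>+x. ennreal (\<bar>\<psi> n x - u x\<bar> powr q1) \<partial>M1) \<longlonglongrightarrow> 0"
    using D1p by (auto simp: D1p_def)
  have [measurable]: "\<psi> n \<in> borel_measurable L" "grad (\<psi> n) \<in> borel_measurable L" for n
    using \<psi> Cinfc_measurable by auto
  \<comment> \<open>Adding the two errors lets one subsequence and one majorant \<open>g\<close>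
    serve both the functions and the gradients.\<close>
  define d where "d n x = norm (grad (\<psi> n) x - G x) powr p + \<bar>\<psi> n x - u x\<bar> powr q1" for n x
  have [measurable]: "d n \<in> borel_measurable L" for n
    unfolding d_def by measurable
  have "(\<lambda>n. \<integral>\<^sup>+x. ennreal (d n x) \<partial>M1) \<longlonglongrightarrow> 0 + 0"
    unfolding d_def by (simp add: ennreal_plus nn_integral_add) (intro tendsto_add[OF lims, simplified])
  then have d_lim: "(\<lambda>n. \<integral>\<^sup>+x. ennreal (d n x) \<partial>M1) \<longlonglongrightarrow> 0" by simp
  obtain r g where r: "strict_mono r" and g: "integrable M1 g" "\<And>x. 0 \<le> g x"
    and AE_g: "AE x in M1. (\<forall>n. d (r n) x \<le> g x) \<and> (\<lambda>n. d (r n) x) \<longlonglongrightarrow> 0"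
    by (rule dominated_subsequence[OF _ _ d_lim]) (auto simp: d_def)
  have [measurable]: "g \<in> borel_measurable L"
    using borel_measurable_integrable[OF g(1)] by simp
  define \<phi> where "\<phi> n = \<psi> (r n)" for n
  have \<phi>: "\<phi> n \<in> Cinfc \<Omega>" for n
    using \<psi> by (simp add: \<phi>_def)
  then have \<phi>1: "\<phi> n \<in> C1c \<Omega>" for n
    using Cinfc_subset_C1c by auto
  have [measurable]: "\<phi> n \<in> borel_measurable L" "grad (\<phi> n) \<in> borel_measurable L" for n
    by (simp_all add: \<phi>_def)
  have AE1: "AE x in L. (\<forall>n. norm (grad (\<phi> n) x - G x) powr p \<le> g x \<and> \<bar>\<phi> n x - u x\<bar> powr q1 \<le> g x)
      \<and> (\<lambda>n. norm (grad (\<phi> n) x - G x) powr p) \<longlonglongrightarrow> 0 \<and> (\<lambda>n. \<phi> n x) \<longlonglongrightarrow> u x \<and> (\<lambda>n. grad (\<phi> n) x) \<longlonglongrightarrow> G x"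
    using AE_g unfolding AE_M1
  proof eventually_elim
    case (elim x)
    have le: "norm (grad (\<phi> n) x - G x) powr p \<le> d (r n) x" "\<bar>\<phi> n x - u x\<bar> powr q1 \<le> d (r n) x" for n
      by (simp_all add: d_def \<phi>_def)
    have l1: "(\<lambda>n. norm (grad (\<phi> n) x - G x) powr p) \<longlonglongrightarrow> 0"
      by (rule tendsto_sandwich[OF _ _ tendsto_const, of _ _ _ "\<lambda>n. d (r n) x"]) (use le elim in auto)
    have l2: "(\<lambda>n. \<bar>\<phi> n x - u x\<bar> powr q1) \<longlonglongrightarrow> 0"
      by (rule tendsto_sandwich[OF _ _ tendsto_const, of _ _ _ "\<lambda>n. d (r n) x"]) (use le elim in auto)
    have "(\<lambda>n. (norm (grad (\<phi> n) x - G x) powr p) powr (1 / p)) \<longlonglongrightarrow> 0 powr (1 / p)"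
      using p_pos by (intro tendsto_powr'[OF l1 tendsto_const]) auto
    then have "(\<lambda>n. norm (grad (\<phi> n) x - G x)) \<longlonglongrightarrow> 0"
      using p_pos by (simp add: powr_powr)
    then have l3: "(\<lambda>n. grad (\<phi> n) x) \<longlonglongrightarrow> G x"
      by (rule LIM_zero_cancel[OF tendsto_norm_zero_cancel])
    have "(\<lambda>n. (\<bar>\<phi> n x - u x\<bar> powr q1) powr (1 / q1)) \<longlonglongrightarrow> 0 powr (1 / q1)"
      using q1_pos by (intro tendsto_powr'[OF l2 tendsto_const]) auto
    then have "(\<lambda>n. \<bar>\<phi> n x - u x\<bar>) \<longlonglongrightarrow> 0"
      using q1_pos by (simp add: powr_powr)
    then have "(\<lambda>n. \<phi> n x) \<longlonglongrightarrow> u x"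
      by (rule LIM_zero_cancel[OF tendsto_rabs_zero_cancel])
    moreover have "norm (grad (\<phi> n) x - G x) powr p \<le> g x" "\<bar>\<phi> n x - u x\<bar> powr q1 \<le> g x" for n
      using le[of n] elim by (auto intro: order_trans)
    ultimately show ?case
      using l1 l3 by simp
  qed
  define e where "e n = (LINT x|M1. norm (grad (\<phi> n) x - G x) powr p)" for n
  have int_e: "integrable M1 (\<lambda>x. norm (grad (\<phi> n) x - G x) powr p)" for n
  proof (rule Bochner_Integration.integrable_bound[OF g(1)])
    show "AE x in M1. norm (norm (grad (\<phi> n) x - G x) powr p) \<le> norm (g x)"
      unfolding AE_M1 by (rule eventually_mono[OF AE1]) (simp add: g(2))
  qed simp
  have e_lim: "e \<longlonglongrightarrow> 0"
  proof -
    have "(\<lambda>n. LINT x|M1. norm (grad (\<phi> n) x - G x) powr p) \<longlonglongrightarrow> (LINT x|M1. 0)"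
    proof (rule integral_dominated_convergence[OF _ _ g(1)])
      show "AE x in M1. (\<lambda>n. norm (grad (\<phi> n) x - G x) powr p) \<longlonglongrightarrow> 0"
        unfolding AE_M1 by (rule eventually_mono[OF AE1]) simp
      show "AE x in M1. norm (norm (grad (\<phi> n) x - G x) powr p) \<le> g x" for n
        unfolding AE_M1 by (rule eventually_mono[OF AE1]) simp
    qed simp_all
    then show ?thesis by (simp add: e_def[abs_def])
  qed
  have e_nn: "0 \<le> e n" for n
    by (simp add: e_def)
  have cauchy: "(\<integral>\<^sup>+x. ennreal (\<bar>\<phi> n x - \<phi> m x\<bar> powr q) \<partial>M2)
      \<le> ennreal (K * (2 powr p * (e n + e m)) powr (q / p))" for n m
  proof -
    have "(LINT x|M1. norm (grad (\<phi> n) x - grad (\<phi> m) x) powr p)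
        \<le> (LINT x|M1. 2 powr p * (norm (grad (\<phi> n) x - G x) powr p + norm (grad (\<phi> m) x - G x) powr p))"
    proof (rule integral_mono)
      show "integrable M1 (\<lambda>x. norm (grad (\<phi> n) x - grad (\<phi> m) x) powr p)"
        using C1c_integrable(2)[OF loc1 C1c_diff(1)[OF \<phi>1 \<phi>1] p_pos] by (simp add: C1c_diff(2)[OF \<phi>1 \<phi>1])
      show "norm (grad (\<phi> n) x - grad (\<phi> m) x) powr p
        \<le> 2 powr p * (norm (grad (\<phi> n) x - G x) powr p + norm (grad (\<phi> m) x - G x) powr p)" for x
      proof -
        have "norm (grad (\<phi> n) x - grad (\<phi> m) x) \<le> norm (grad (\<phi> n) x - G x) + norm (grad (\<phi> m) x - G x)"
          by (metis dist_norm dist_triangle2)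
        then have "norm (grad (\<phi> n) x - grad (\<phi> m) x) powr p \<le> (norm (grad (\<phi> n) x - G x) + norm (grad (\<phi> m) x - G x)) powr p"
          using p_pos by (intro powr_mono2) auto
        also have "\<dots> \<le> 2 powr p * (norm (grad (\<phi> n) x - G x) powr p + norm (grad (\<phi> m) x - G x) powr p)"
          using p_pos by (intro powr_add_le) auto
        finally show ?thesis .
      qed
    qed (use int_e in auto)
    also have "\<dots> = 2 powr p * (e n + e m)"
      using int_e by (simp add: e_def)
    finally have le: "(LINT x|M1. norm (grad (\<phi> n) x - grad (\<phi> m) x) powr p) \<le> 2 powr p * (e n + e m)" .
    have "(\<integral>\<^sup>+x. ennreal (\<bar>\<phi> n x - \<phi> m x\<bar> powr q) \<partial>M2) = ennreal (LINT x|M2. \<bar>\<phi> n x - \<phi> m x\<bar> powr q)"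
      by (intro nn_integral_eq_integral C1c_integrable(1)[OF loc2 C1c_diff(1)[OF \<phi>1 \<phi>1] q_pos]) auto
    also have "\<dots> \<le> ennreal (K * (2 powr p * (e n + e m)) powr (q / p))"
    proof (rule ennreal_leI)
      have "(LINT x|M2. \<bar>\<phi> n x - \<phi> m x\<bar> powr q)
          \<le> K * (LINT x|M1. norm (grad (\<phi> n) x - grad (\<phi> m) x) powr p) powr (q / p)"
        using sobolev2[OF C1c_diff(1)[OF \<phi>1 \<phi>1]] by (simp add: C1c_diff(2)[OF \<phi>1 \<phi>1])
      also have "\<dots> \<le> K * (2 powr p * (e n + e m)) powr (q / p)"
        using le K_pos p_pos q_pos by (intro mult_left_mono powr_mono2) auto
      finally show "(LINT x|M2. \<bar>\<phi> n x - \<phi> m x\<bar> powr q) \<le> K * (2 powr p * (e n + e m)) powr (q / p)" .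
    qed
    finally show ?thesis .
  qed
  have M2_bound: "(\<integral>\<^sup>+x. ennreal (\<bar>\<phi> n x - u x\<bar> powr q) \<partial>M2)
      \<le> ennreal (K * (2 powr p * (e n + 0)) powr (q / p))" for n
  proof -
    \<comment> \<open>Fatou's lemma in \<open>m\<close> for fixed \<open>n\<close>: the Cauchy bound
      passes to the difference from \<open>u\<close>, with \<open>e m\<close> tending to 0.\<close>
    have "AE x in M2. ennreal (\<bar>\<phi> n x - u x\<bar> powr q) = liminf (\<lambda>m. ennreal (\<bar>\<phi> n x - \<phi> m x\<bar> powr q))"
      using AE1 unfolding AE_M2
    proof eventually_elim
      case (elim x)
      have "(\<lambda>m. ennreal (\<bar>\<phi> n x - \<phi> m x\<bar> powr q)) \<longlonglongrightarrow> ennreal (\<bar>\<phi> n x - u x\<bar> powr q)"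
        using q_pos elim by (intro tendsto_ennrealI tendsto_powr' tendsto_intros) auto
      then show ?case
        by (intro lim_imp_Liminf[symmetric]) auto
    qed
    then have "(\<integral>\<^sup>+x. ennreal (\<bar>\<phi> n x - u x\<bar> powr q) \<partial>M2)
        = (\<integral>\<^sup>+x. liminf (\<lambda>m. ennreal (\<bar>\<phi> n x - \<phi> m x\<bar> powr q)) \<partial>M2)"
      by (rule nn_integral_cong_AE)
    also have "\<dots> \<le> liminf (\<lambda>m. \<integral>\<^sup>+x. ennreal (\<bar>\<phi> n x - \<phi> m x\<bar> powr q) \<partial>M2)"
      by (rule nn_integral_liminf) simp
    also have "\<dots> \<le> liminf (\<lambda>m. ennreal (K * (2 powr p * (e n + e m)) powr (q / p)))"
      using cauchy by (intro Liminf_mono) auto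
    also have "\<dots> = ennreal (K * (2 powr p * (e n + 0)) powr (q / p))"
      using q_pos p_pos e_nn
      by (intro lim_imp_Liminf tendsto_ennrealI tendsto_mult tendsto_const tendsto_powr' tendsto_add e_lim) auto
    finally show ?thesis .
  qed
  have "(\<lambda>n. ennreal (K * (2 powr p * (e n + 0)) powr (q / p))) \<longlonglongrightarrow> ennreal (K * (2 powr p * (0 + 0)) powr (q / p))"
    using q_pos p_pos e_nn
    by (intro tendsto_ennrealI tendsto_mult tendsto_const tendsto_powr' tendsto_add e_lim) auto
  then have bound_lim: "(\<lambda>n. ennreal (K * (2 powr p * (e n + 0)) powr (q / p))) \<longlonglongrightarrow> 0"
    by simp
  have M2_lim: "(\<lambda>n. \<integral>\<^sup>+x. ennreal (\<bar>\<phi> n x - u x\<bar> powr q) \<partial>M2) \<longlonglongrightarrow> 0"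
    by (rule tendsto_sandwich[OF _ _ tendsto_const bound_lim]) (use M2_bound in auto)
  obtain s h where s: "strict_mono s" and h: "integrable M2 h" "\<And>x. 0 \<le> h x"
    and AE_h: "AE x in M2. (\<forall>n. \<bar>\<phi> (s n) x - u x\<bar> powr q \<le> h x) \<and> (\<lambda>n. \<bar>\<phi> (s n) x - u x\<bar> powr q) \<longlonglongrightarrow> 0"
    by (rule dominated_subsequence[OF _ _ M2_lim]) auto
  have [measurable]: "h \<in> borel_measurable L"
    using borel_measurable_integrable[OF h(1)] by simp
  have root: "a \<le> c powr (1 / t)" if "a powr t \<le> c" "0 \<le> a" "0 < t" for a c t :: real
    using powr_mono2[of "1 / t" "a powr t" c] that by (simp add: powr_powr)
  have add_root: "(a + c powr (1 / t)) powr t \<le> 2 powr t * (a powr t + c)" if "0 \<le> a" "0 \<le> c" "0 < t" for a c t :: real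
    using powr_add_le[of a "c powr (1 / t)" t] that by (simp add: powr_powr)
  \<comment> \<open>Each member of the sequence is compared with \<open>u\<close> and then
    \<open>u\<close> with the initial member, which costs the root of the majorant twice. The
    majorants are built around the initial member because its integrability is known, while that of
    \<open>u\<close> is derived from them later.\<close>
  define A1 where "A1 x = \<bar>\<phi> 0 x\<bar> + (g x powr (1 / q1) + g x powr (1 / q1))" for x
  define A2 where "A2 x = \<bar>\<phi> (s 0) x\<bar> + (h x powr (1 / q) + h x powr (1 / q))" for x
  define B where "B x = norm (grad (\<phi> 0) x) + (g x powr (1 / p) + g x powr (1 / p))" for x
  have powr2: "(a + (c powr (1 / t) + c powr (1 / t))) powr t \<le> 2 powr t * (a powr t + 2 powr t * c)"
    if "0 \<le> a" "0 \<le> c" "0 < t" for a c t :: real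
    using powr_add_le[of a "2 * c powr (1 / t)" t] that by (simp add: powr_mult powr_powr)
  show thesis
  proof (rule that[of "\<lambda>n. \<phi> (s n)" A1 A2 B])
    show "\<phi> (s n) \<in> Cinfc \<Omega>" for n by (rule \<phi>)
    show [measurable]: "A1 \<in> borel_measurable L" "A2 \<in> borel_measurable L" "B \<in> borel_measurable L"
      unfolding A1_def A2_def B_def by measurable
    show "0 \<le> A1 x" "0 \<le> A2 x" "0 \<le> B x" for x
      by (simp_all add: A1_def A2_def B_def)
    show "integrable M1 (\<lambda>x. A1 x powr q1)"
    proof (rule Bochner_Integration.integrable_bound)
      show "integrable M1 (\<lambda>x. 2 powr q1 * (\<bar>\<phi> 0 x\<bar> powr q1 + 2 powr q1 * g x))"
        using C1c_integrable(1)[OF loc1 \<phi>1 q1_pos] g by auto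
      show "AE x in M1. norm (A1 x powr q1) \<le> norm (2 powr q1 * (\<bar>\<phi> 0 x\<bar> powr q1 + 2 powr q1 * g x))"
        using powr2[of "\<bar>\<phi> 0 x\<bar>" "g x" q1 for x] g(2) q1_pos by (simp add: A1_def)
    qed simp
    show "integrable M2 (\<lambda>x. A2 x powr q)"
    proof (rule Bochner_Integration.integrable_bound)
      show "integrable M2 (\<lambda>x. 2 powr q * (\<bar>\<phi> (s 0) x\<bar> powr q + 2 powr q * h x))"
        using C1c_integrable(1)[OF loc2 \<phi>1 q_pos] h by auto
      show "AE x in M2. norm (A2 x powr q) \<le> norm (2 powr q * (\<bar>\<phi> (s 0) x\<bar> powr q + 2 powr q * h x))"
        using powr2[of "\<bar>\<phi> (s 0) x\<bar>" "h x" q for x] h(2) q_pos by (simp add: A2_def)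
    qed simp
    show "integrable M1 (\<lambda>x. B x powr p)"
    proof (rule Bochner_Integration.integrable_bound)
      show "integrable M1 (\<lambda>x. 2 powr p * (norm (grad (\<phi> 0) x) powr p + 2 powr p * g x))"
        using C1c_integrable(2)[OF loc1 \<phi>1 p_pos] g by auto
      show "AE x in M1. norm (B x powr p) \<le> norm (2 powr p * (norm (grad (\<phi> 0) x) powr p + 2 powr p * g x))"
        using powr2[of "norm (grad (\<phi> 0) x)" "g x" p for x] g(2) p_pos by (simp add: B_def)
    qed simp
    show "AE x in L. (\<forall>n. \<bar>\<phi> (s n) x\<bar> \<le> A1 x \<and> \<bar>\<phi> (s n) x\<bar> \<le> A2 x \<and> norm (grad (\<phi> (s n)) x) \<le> B x) \<and>
       (\<lambda>n. \<phi> (s n) x) \<longlonglongrightarrow> u x \<and> (\<lambda>n. grad (\<phi> (s n)) x) \<longlonglongrightarrow> G x"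
      using AE1 AE_h[unfolded AE_M2]
    proof eventually_elim
      case (elim x)
      have a: "\<bar>\<phi> n x - u x\<bar> \<le> g x powr (1 / q1)" for n
        using elim q1_pos by (intro root) auto
      have b: "norm (grad (\<phi> n) x - G x) \<le> g x powr (1 / p)" for n
        using elim p_pos by (intro root) auto
      have c: "\<bar>\<phi> (s n) x - u x\<bar> \<le> h x powr (1 / q)" for n
        using elim q_pos by (intro root) auto
      have "\<bar>\<phi> (s n) x\<bar> \<le> A1 x" "\<bar>\<phi> (s n) x\<bar> \<le> A2 x" for n
        using a[of "s n"] a[of 0] c[of n] c[of 0] by (simp_all add: A1_def A2_def)
      moreover have "norm (grad (\<phi> (s n)) x) \<le> B x" for n
      proof -
        have "norm (grad (\<phi> (s n)) x) \<le> norm (grad (\<phi> 0) x) + (norm (grad (\<phi> 0) x - G x) + norm (grad (\<phi> (s n)) x - G x))"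
          by norm
        then show ?thesis
          using b[of "s n"] b[of 0] by (simp add: B_def)
      qed
      ultimately show ?case
        using elim LIMSEQ_subseq_LIMSEQ[OF _ s, of "\<lambda>n. \<phi> n x" "u x"]
          LIMSEQ_subseq_LIMSEQ[OF _ s, of "\<lambda>n. grad (\<phi> n) x" "G x"] by (auto simp: o_def)
    qed
  qed
qed

section \<open>Truncations as test functions\<close>

lemma exponents_pos: "0 < p" "0 < q" "0 < q1"
  using p_gt_1 p_less_q p_less_q1 by auto

lemma u_integrable1: "integrable M1 (\<lambda>x. \<bar>u x\<bar> powr q1)"
  and u_integrable2: "integrable M2 (\<lambda>x. \<bar>u x\<bar> powr q)"
  and G_integrable: "integrable M1 (\<lambda>x. norm (G x) powr p)"
proof -
  obtain \<phi> A1 A2 B where "\<And>n::nat. \<phi> n \<in> Cinfc \<Omega>"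
    and nn: "\<And>x. 0 \<le> A1 x" "\<And>x. 0 \<le> A2 x" "\<And>x. 0 \<le> B x"
    and "A1 \<in> borel_measurable L" "A2 \<in> borel_measurable L" "B \<in> borel_measurable L"
    and int: "integrable M1 (\<lambda>x. A1 x powr q1)" "integrable M2 (\<lambda>x. A2 x powr q)" "integrable M1 (\<lambda>x. B x powr p)"
    and AE: "AE x in L. (\<forall>n. \<bar>\<phi> n x\<bar> \<le> A1 x \<and> \<bar>\<phi> n x\<bar> \<le> A2 x \<and> norm (grad (\<phi> n) x) \<le> B x) \<and>
       (\<lambda>n. \<phi> n x) \<longlonglongrightarrow> u x \<and> (\<lambda>n. grad (\<phi> n) x) \<longlonglongrightarrow> G x"
    by (rule approximation) blast
  have bd: "AE x in L. \<bar>u x\<bar> \<le> A1 x \<and> \<bar>u x\<bar> \<le> A2 x \<and> norm (G x) \<le> B x"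
    using AE
  proof eventually_elim
    case (elim x)
    have "(\<lambda>n. \<bar>\<phi> n x\<bar>) \<longlonglongrightarrow> \<bar>u x\<bar>" "(\<lambda>n. norm (grad (\<phi> n) x)) \<longlonglongrightarrow> norm (G x)"
      using elim by (auto intro: tendsto_rabs tendsto_norm)
    then show ?case
      using elim by (auto intro: LIMSEQ_le_const2)
  qed
  show "integrable M1 (\<lambda>x. \<bar>u x\<bar> powr q1)"
  proof (rule Bochner_Integration.integrable_bound[OF int(1)])
    show "AE x in M1. norm (\<bar>u x\<bar> powr q1) \<le> norm (A1 x powr q1)"
      unfolding AE_M1 by (rule eventually_mono[OF bd]) (use exponents_pos in \<open>auto intro!: powr_mono2\<close>)
  qed simp
  show "integrable M2 (\<lambda>x. \<bar>u x\<bar> powr q)"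
  proof (rule Bochner_Integration.integrable_bound[OF int(2)])
    show "AE x in M2. norm (\<bar>u x\<bar> powr q) \<le> norm (A2 x powr q)"
      unfolding AE_M2 by (rule eventually_mono[OF bd]) (use exponents_pos in \<open>auto intro!: powr_mono2\<close>)
  qed simp
  show "integrable M1 (\<lambda>x. norm (G x) powr p)"
  proof (rule Bochner_Integration.integrable_bound[OF int(3)])
    show "AE x in M1. norm (norm (G x) powr p) \<le> norm (B x powr p)"
      unfolding AE_M1 by (rule eventually_mono[OF bd]) (use exponents_pos in \<open>auto intro!: powr_mono2\<close>)
  qed simp
qed

text \<open>\<open>H\<close> stands for the gradient of \<open>v\<close>. Instead of placing
  \<open>v\<close> in a function space, the definition lists exactly what is wanted of a test
  function: integrability, both Sobolev inequalities and the weak equation. Unlike smoothness, all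
  of these survive dominated limits.\<close>

definition test_pair :: "('a \<Rightarrow> real) \<Rightarrow> ('a \<Rightarrow> 'a) \<Rightarrow> bool" where
  "test_pair v H \<longleftrightarrow>
     integrable M1 (\<lambda>x. \<bar>v x\<bar> powr q1) \<and> integrable M2 (\<lambda>x. \<bar>v x\<bar> powr q) \<and>
     integrable M1 (\<lambda>x. norm (H x) powr p) \<and>
     v \<in> borel_measurable L \<and> H \<in> borel_measurable L \<and>
     (LINT x|M1. \<bar>v x\<bar> powr q1) \<le> K * (LINT x|M1. norm (H x) powr p) powr (q1 / p) \<and>
     (LINT x|M2. \<bar>v x\<bar> powr q) \<le> K * (LINT x|M1. norm (H x) powr p) powr (q / p) \<and>
     (LINT x|M1. norm (G x) powr (p - 2) * (G x \<bullet> H x)) = (LINT x|M2. \<bar>u x\<bar> powr (q - 2) * u x * v x)"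

lemma test_pair_Cinfc:
  assumes "\<phi> \<in> Cinfc \<Omega>"
  shows "test_pair \<phi> (grad \<phi>)"
proof -
  have 1: "\<phi> \<in> C1c \<Omega>"
    using assms Cinfc_subset_C1c by blast
  show ?thesis
    unfolding test_pair_def
    using C1c_integrable[OF loc1 1] C1c_integrable[OF loc2 1] exponents_pos Cinfc_measurable[OF assms]
      sobolev1[OF 1] sobolev2[OF 1] weak assms
    unfolding weak_solution_def by blast
qed

text \<open>Stated in an inner product space so that it majorizes both sides of the weak equation:
  with vectors for the gradient term, and with real numbers for the term with
  \<open>u\<close>.\<close>

lemma powr_minus_2_bound:
  fixes g h :: "'b::real_inner" and s b :: real
  assumes "1 < s" "norm h \<le> b"
  shows "\<bar>norm g powr (s - 2) * (g \<bullet> h)\<bar> \<le> norm g powr s + b powr s"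
proof -
  have "\<bar>norm g powr (s - 2) * (g \<bullet> h)\<bar> \<le> norm g powr (s - 2) * (norm g * norm h)"
    unfolding abs_mult by (intro mult_mono Cauchy_Schwarz_ineq2) auto
  also have "\<dots> = norm g powr (s - 1) * norm h"
    using powr_mult_base[of "norm g" "s - 2"] by (simp add: mult_ac)
  also have "\<dots> \<le> norm g powr (s - 1) * b"
    using assms by (intro mult_left_mono) auto
  also have "\<dots> \<le> norm g powr s + b powr s"
    using assms order_trans[OF norm_ge_zero assms(2)] by (intro powr_mult_powr_le) auto
  finally show ?thesis .
qed

text \<open>Dominated convergence in five integrals: the two critical powers, the energy, and the
  two sides of the equation. The majorants for the last two come from
  \<open>powr_minus_2_bound\<close> together with the integrability of \<open>G\<close> and
  \<open>u\<close>.\<close>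

lemma test_pair_limit:
  assumes pair: "\<And>n::nat. test_pair (v n) (H n)"
    and [measurable]: "v' \<in> borel_measurable L" "H' \<in> borel_measurable L"
    and int: "integrable M1 (\<lambda>x. A1 x powr q1)" "integrable M2 (\<lambda>x. A2 x powr q)" "integrable M1 (\<lambda>x. B x powr p)"
    and dom: "AE x in L. \<forall>n. \<bar>v n x\<bar> \<le> A1 x \<and> \<bar>v n x\<bar> \<le> A2 x \<and> norm (H n x) \<le> B x"
    and lim: "AE x in L. (\<lambda>n. v n x) \<longlonglongrightarrow> v' x \<and> (\<lambda>n. H n x) \<longlonglongrightarrow> H' x"
  shows "test_pair v' H'"
proof -
  have [measurable]: "v n \<in> borel_measurable L" "H n \<in> borel_measurable L" for n
    using pair by (auto simp: test_pair_def)
  have l1: "AE x in M1. (\<lambda>n. \<bar>v n x\<bar> powr q1) \<longlonglongrightarrow> \<bar>v' x\<bar> powr q1"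
    unfolding AE_M1 by (rule eventually_mono[OF lim]) (use exponents_pos in \<open>auto intro!: tendsto_powr' tendsto_rabs\<close>)
  have l2: "AE x in M2. (\<lambda>n. \<bar>v n x\<bar> powr q) \<longlonglongrightarrow> \<bar>v' x\<bar> powr q"
    unfolding AE_M2 by (rule eventually_mono[OF lim]) (use exponents_pos in \<open>auto intro!: tendsto_powr' tendsto_rabs\<close>)
  have l3: "AE x in M1. (\<lambda>n. norm (H n x) powr p) \<longlonglongrightarrow> norm (H' x) powr p"
    unfolding AE_M1 by (rule eventually_mono[OF lim]) (use exponents_pos in \<open>auto intro!: tendsto_powr' tendsto_norm\<close>)
  have l4: "AE x in M1. (\<lambda>n. norm (G x) powr (p - 2) * (G x \<bullet> H n x)) \<longlonglongrightarrow> norm (G x) powr (p - 2) * (G x \<bullet> H' x)"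
    unfolding AE_M1 by (rule eventually_mono[OF lim]) (auto intro!: tendsto_intros)
  have l5: "AE x in M2. (\<lambda>n. \<bar>u x\<bar> powr (q - 2) * u x * v n x) \<longlonglongrightarrow> \<bar>u x\<bar> powr (q - 2) * u x * v' x"
    unfolding AE_M2 by (rule eventually_mono[OF lim]) (auto intro!: tendsto_intros)
  have b1: "AE x in M1. norm (\<bar>v n x\<bar> powr q1) \<le> A1 x powr q1" for n
    unfolding AE_M1 by (rule eventually_mono[OF dom]) (use exponents_pos in \<open>auto intro!: powr_mono2\<close>)
  have b2: "AE x in M2. norm (\<bar>v n x\<bar> powr q) \<le> A2 x powr q" for n
    unfolding AE_M2 by (rule eventually_mono[OF dom]) (use exponents_pos in \<open>auto intro!: powr_mono2\<close>)
  have b3: "AE x in M1. norm (norm (H n x) powr p) \<le> B x powr p" for n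
    unfolding AE_M1 by (rule eventually_mono[OF dom]) (use exponents_pos in \<open>auto intro!: powr_mono2\<close>)
  have b4: "AE x in M1. norm (norm (G x) powr (p - 2) * (G x \<bullet> H n x)) \<le> norm (G x) powr p + B x powr p" for n
    unfolding AE_M1 by (rule eventually_mono[OF dom]) (use p_gt_1 in \<open>auto intro!: powr_minus_2_bound\<close>)
  have b5: "AE x in M2. norm (\<bar>u x\<bar> powr (q - 2) * u x * v n x) \<le> \<bar>u x\<bar> powr q + A2 x powr q" for n
    unfolding AE_M2
    by (rule eventually_mono[OF dom])
      (use p_gt_1 p_less_q powr_minus_2_bound[of q "v n x" "A2 x" "u x" for x] in \<open>auto simp: mult_ac\<close>)
  have w4: "integrable M1 (\<lambda>x. norm (G x) powr p + B x powr p)"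
    using G_integrable int by simp
  have w5: "integrable M2 (\<lambda>x. \<bar>u x\<bar> powr q + A2 x powr q)"
    using u_integrable2 int by simp
  have c1: "(\<lambda>n. LINT x|M1. \<bar>v n x\<bar> powr q1) \<longlonglongrightarrow> (LINT x|M1. \<bar>v' x\<bar> powr q1)"
    by (rule integral_dominated_convergence[OF _ _ int(1) l1 b1]) simp_all
  have c2: "(\<lambda>n. LINT x|M2. \<bar>v n x\<bar> powr q) \<longlonglongrightarrow> (LINT x|M2. \<bar>v' x\<bar> powr q)"
    by (rule integral_dominated_convergence[OF _ _ int(2) l2 b2]) simp_all
  have c3: "(\<lambda>n. LINT x|M1. norm (H n x) powr p) \<longlonglongrightarrow> (LINT x|M1. norm (H' x) powr p)"
    by (rule integral_dominated_convergence[OF _ _ int(3) l3 b3]) simp_all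
  have c4: "(\<lambda>n. LINT x|M1. norm (G x) powr (p - 2) * (G x \<bullet> H n x)) \<longlonglongrightarrow> (LINT x|M1. norm (G x) powr (p - 2) * (G x \<bullet> H' x))"
    by (rule integral_dominated_convergence[OF _ _ w4 l4 b4]) simp_all
  have c5: "(\<lambda>n. LINT x|M2. \<bar>u x\<bar> powr (q - 2) * u x * v n x) \<longlonglongrightarrow> (LINT x|M2. \<bar>u x\<bar> powr (q - 2) * u x * v' x)"
    by (rule integral_dominated_convergence[OF _ _ w5 l5 b5]) simp_all
  have i1: "integrable M1 (\<lambda>x. \<bar>v' x\<bar> powr q1)"
    by (rule integrable_dominated_convergence[OF _ _ int(1) l1 b1]) simp_all
  have i2: "integrable M2 (\<lambda>x. \<bar>v' x\<bar> powr q)"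
    by (rule integrable_dominated_convergence[OF _ _ int(2) l2 b2]) simp_all
  have i3: "integrable M1 (\<lambda>x. norm (H' x) powr p)"
    by (rule integrable_dominated_convergence[OF _ _ int(3) l3 b3]) simp_all
  have r: "(\<lambda>n. K * (LINT x|M1. norm (H n x) powr p) powr (s / p)) \<longlonglongrightarrow> K * (LINT x|M1. norm (H' x) powr p) powr (s / p)"
    if "0 < s" for s
    using that exponents_pos by (intro tendsto_mult tendsto_const tendsto_powr' c3) auto
  have "(LINT x|M1. \<bar>v' x\<bar> powr q1) \<le> K * (LINT x|M1. norm (H' x) powr p) powr (q1 / p)"
    by (rule LIMSEQ_le[OF c1 r]) (use pair exponents_pos in \<open>auto simp: test_pair_def\<close>)
  moreover have "(LINT x|M2. \<bar>v' x\<bar> powr q) \<le> K * (LINT x|M1. norm (H' x) powr p) powr (q / p)"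
    by (rule LIMSEQ_le[OF c2 r]) (use pair exponents_pos in \<open>auto simp: test_pair_def\<close>)
  moreover have "(LINT x|M1. norm (G x) powr (p - 2) * (G x \<bullet> H' x)) = (LINT x|M2. \<bar>u x\<bar> powr (q - 2) * u x * v' x)"
    by (rule LIMSEQ_unique[OF c4]) (use pair c5 in \<open>simp add: test_pair_def\<close>)
  ultimately show ?thesis
    using i1 i2 i3 assms(2,3) unfolding test_pair_def by blast
qed

text \<open>By the product rule the gradient contains
  \<open>F n (\<phi> n x) *\<^sub>R grad \<zeta> x\<close>, which must be in \<open>L^p(w1)\<close>
  although only a majorant in \<open>L^q1(w1)\<close> is available. Hence the hypothesis with
  exponent \<open>q1 / p\<close>: the power \<open>p\<close> of its right-hand side is a multiple of
  the power \<open>q1\<close>. Both passages to the limit have this shape: first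
  \<open>\<phi> n\<close> moves with \<open>F\<close> fixed, then \<open>F n\<close> moves with the
  inner function \<open>u\<close>.\<close>

lemma test_pair_cut_limit:
  assumes pair: "\<And>n::nat. test_pair (\<lambda>x. \<zeta> x * F n (\<phi> n x))
      (\<lambda>x. F n (\<phi> n x) *\<^sub>R grad \<zeta> x + (\<zeta> x * F' n (\<phi> n x)) *\<^sub>R \<Gamma> n x)"
    and [measurable]: "f \<in> borel_measurable L" "f' \<in> borel_measurable L" "\<zeta> \<in> borel_measurable L"
      "grad \<zeta> \<in> borel_measurable L"
    and [measurable]: "A \<in> borel_measurable L" "A' \<in> borel_measurable L" "B \<in> borel_measurable L"
    and nn: "\<And>x. 0 \<le> A x" "\<And>x. 0 \<le> A' x" "\<And>x. 0 \<le> B x"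
    and int: "integrable M1 (\<lambda>x. A x powr q1)" "integrable M2 (\<lambda>x. A' x powr q)" "integrable M1 (\<lambda>x. B x powr p)"
    and dom: "AE x in L. \<forall>n. \<bar>\<phi> n x\<bar> \<le> A x \<and> \<bar>\<phi> n x\<bar> \<le> A' x \<and> norm (\<Gamma> n x) \<le> B x"
    and lim: "AE x in L. (\<lambda>n. F n (\<phi> n x)) \<longlonglongrightarrow> f x \<and> (\<lambda>n. F' n (\<phi> n x)) \<longlonglongrightarrow> f' x \<and> (\<lambda>n. \<Gamma> n x) \<longlonglongrightarrow> G x"
    and M: "\<And>n t. \<bar>F n t\<bar> \<le> M * \<bar>t\<bar>" "\<And>n t. \<bar>F' n t\<bar> \<le> M" "0 \<le> M"
    and \<zeta>: "\<And>x. \<bar>\<zeta> x\<bar> \<le> 1"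
    and c: "\<And>n t x. \<bar>F n t\<bar> * norm (grad \<zeta> x) \<le> c * \<bar>t\<bar> powr (q1 / p)" "0 \<le> c"
  shows "test_pair (\<lambda>x. \<zeta> x * f x) (\<lambda>x. f x *\<^sub>R grad \<zeta> x + (\<zeta> x * f' x) *\<^sub>R G x)"
proof (rule test_pair_limit[OF pair])
  show "(\<lambda>x. \<zeta> x * f x) \<in> borel_measurable L"
    by measurable
  show "(\<lambda>x. f x *\<^sub>R grad \<zeta> x + (\<zeta> x * f' x) *\<^sub>R G x) \<in> borel_measurable L"
    by measurable
  show "integrable M1 (\<lambda>x. (M * A x) powr q1)"
    using int(1) nn M(3) by (simp add: powr_mult)
  show "integrable M2 (\<lambda>x. (M * A' x) powr q)"
    using int(2) nn M(3) by (simp add: powr_mult)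
  show "integrable M1 (\<lambda>x. (c * A x powr (q1 / p) + M * B x) powr p)"
  proof (rule Bochner_Integration.integrable_bound)
    show "integrable M1 (\<lambda>x. 2 powr p * (c powr p * A x powr q1 + M powr p * B x powr p))"
      using int by simp
    show "AE x in M1. norm ((c * A x powr (q1 / p) + M * B x) powr p)
        \<le> norm (2 powr p * (c powr p * A x powr q1 + M powr p * B x powr p))"
    proof (rule AE_I2)
      fix x
      have "(c * A x powr (q1 / p) + M * B x) powr p
          \<le> 2 powr p * ((c * A x powr (q1 / p)) powr p + (M * B x) powr p)"
        using nn M(3) c(2) exponents_pos by (intro powr_add_le) auto
      then show "norm ((c * A x powr (q1 / p) + M * B x) powr p)
        \<le> norm (2 powr p * (c powr p * A x powr q1 + M powr p * B x powr p))"
        using nn M(3) c(2) p_gt_1 by (simp add: powr_mult powr_powr)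
    qed
  qed simp
  show "AE x in L. \<forall>n. \<bar>\<zeta> x * F n (\<phi> n x)\<bar> \<le> M * A x \<and> \<bar>\<zeta> x * F n (\<phi> n x)\<bar> \<le> M * A' x \<and>
     norm (F n (\<phi> n x) *\<^sub>R grad \<zeta> x + (\<zeta> x * F' n (\<phi> n x)) *\<^sub>R \<Gamma> n x) \<le> c * A x powr (q1 / p) + M * B x"
    using dom
  proof eventually_elim
    case (elim x)
    show ?case
    proof
      fix n
      have "\<bar>\<zeta> x * F n (\<phi> n x)\<bar> \<le> 1 * (M * \<bar>\<phi> n x\<bar>)"
        unfolding abs_mult by (intro mult_mono \<zeta> M(1)) auto
      moreover have "M * \<bar>\<phi> n x\<bar> \<le> M * A x" "M * \<bar>\<phi> n x\<bar> \<le> M * A' x"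
        using elim M(3) by (auto intro!: mult_left_mono)
      moreover have "norm (F n (\<phi> n x) *\<^sub>R grad \<zeta> x + (\<zeta> x * F' n (\<phi> n x)) *\<^sub>R \<Gamma> n x) \<le> c * A x powr (q1 / p) + M * B x"
      proof (rule norm_triangle_le, rule add_mono)
        have "norm (F n (\<phi> n x) *\<^sub>R grad \<zeta> x) \<le> c * \<bar>\<phi> n x\<bar> powr (q1 / p)"
          using c(1) by simp
        also have "\<dots> \<le> c * A x powr (q1 / p)"
          using elim c(2) exponents_pos by (intro mult_left_mono powr_mono2) auto
        finally show "norm (F n (\<phi> n x) *\<^sub>R grad \<zeta> x) \<le> c * A x powr (q1 / p)" .
        have "norm ((\<zeta> x * F' n (\<phi> n x)) *\<^sub>R \<Gamma> n x) \<le> (1 * M) * B x"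
          unfolding norm_scaleR abs_mult using elim M(3) by (intro mult_mono \<zeta> M(2)) auto
        then show "norm ((\<zeta> x * F' n (\<phi> n x)) *\<^sub>R \<Gamma> n x) \<le> M * B x" by simp
      qed
      ultimately show "\<bar>\<zeta> x * F n (\<phi> n x)\<bar> \<le> M * A x \<and> \<bar>\<zeta> x * F n (\<phi> n x)\<bar> \<le> M * A' x \<and>
         norm (F n (\<phi> n x) *\<^sub>R grad \<zeta> x + (\<zeta> x * F' n (\<phi> n x)) *\<^sub>R \<Gamma> n x) \<le> c * A x powr (q1 / p) + M * B x"
        by linarith
    qed
  qed
  show "AE x in L. (\<lambda>n. \<zeta> x * F n (\<phi> n x)) \<longlonglongrightarrow> \<zeta> x * f x \<and>
     (\<lambda>n. F n (\<phi> n x) *\<^sub>R grad \<zeta> x + (\<zeta> x * F' n (\<phi> n x)) *\<^sub>R \<Gamma> n x)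
       \<longlonglongrightarrow> f x *\<^sub>R grad \<zeta> x + (\<zeta> x * f' x) *\<^sub>R G x"
    by (rule eventually_mono[OF lim]) (auto intro!: tendsto_intros)
qed

end

text \<open>\<open>F 0 = 0\<close> keeps the support inside that of \<open>\<phi>\<close>, so
  \<open>\<zeta>\<close> may be a cutoff for an exterior region, whose support is not
  compact.\<close>

lemma Cinfc_cut:
  fixes F F' :: "real \<Rightarrow> real"
  assumes "\<phi> \<in> Cinfc \<Omega>" and \<zeta>: "\<And>k. Ck_on k UNIV \<zeta>"
    and F: "\<And>k. Ck_on k UNIV F" "F 0 = 0" "\<And>t. DERIV F t :> F' t"
  shows "(\<lambda>x. \<zeta> x * F (\<phi> x)) \<in> Cinfc \<Omega>"
    and "grad (\<lambda>x. \<zeta> x * F (\<phi> x)) x = F (\<phi> x) *\<^sub>R grad \<zeta> x + (\<zeta> x * F' (\<phi> x)) *\<^sub>R grad \<phi> x"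
proof -
  have \<phi>: "Ck_on k UNIV \<phi>" for k
    using assms(1) unfolding Cinfc_def by blast
  have "compact (closure {x. \<phi> x \<noteq> 0})" "closure {x. \<phi> x \<noteq> 0} \<subseteq> \<Omega>"
    using assms(1) unfolding Cinfc_def compact_support_in_def by blast+
  moreover have "\<zeta> x * F (\<phi> x) = 0" if "x \<notin> closure {x. \<phi> x \<noteq> 0}" for x
  proof -
    have "\<phi> x = 0"
      using that closure_subset[of "{x. \<phi> x \<noteq> 0}"] by blast
    then show ?thesis by (simp add: F)
  qed
  ultimately have "compact_support_in \<Omega> (\<lambda>x. \<zeta> x * F (\<phi> x))"
    by (rule compact_support_in_subset)
  moreover have "Ck_on k UNIV (\<lambda>x. \<zeta> x * F (\<phi> x))" for k
    by (rule Ck_on_mult[OF \<zeta> Ck_on_compose[OF F(1) \<phi>]])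
  ultimately show "(\<lambda>x. \<zeta> x * F (\<phi> x)) \<in> Cinfc \<Omega>"
    unfolding Cinfc_def by blast
  have "GDERIV (\<lambda>x. F (\<phi> x)) x :> F' (\<phi> x) *\<^sub>R grad \<phi> x"
    by (rule GDERIV_DERIV_compose[OF Ck_on_Suc_gderiv[OF \<phi>] F(3)])
  from GDERIV_mult[OF Ck_on_Suc_gderiv[OF \<zeta>] this]
  show "grad (\<lambda>x. \<zeta> x * F (\<phi> x)) x = F (\<phi> x) *\<^sub>R grad \<zeta> x + (\<zeta> x * F' (\<phi> x)) *\<^sub>R grad \<phi> x"
    by (intro grad_eq) (simp add: add.commute)
qed


text \<open>A smooth regularization of the positive part. It vanishes identically for
  \<open>t \<le> 0\<close>, so its derivatives converge at every point, with limit 0 at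
  \<open>t = 0\<close>. The gradient on the level set \<open>u = k\<close> is thereby settled by the
  construction, without an argument that it vanishes there.\<close>

definition soft_part :: "nat \<Rightarrow> real \<Rightarrow> real" where
  "soft_part n t = t * exp_bump 0 (real (Suc n) * t)"

lemma Ck_on_soft_part: "Ck_on k UNIV (\<lambda>t. soft_part n (t - c))"
proof -
  have "Ck_on k UNIV (\<lambda>t::real. t \<bullet> 1 - c)"
    by (intro Ck_on_diff Ck_on_inner Ck_on_const)
  then have 1: "Ck_on k UNIV (\<lambda>t::real. t - c)"
    by simp
  have 2: "Ck_on k UNIV (\<lambda>t. real (Suc n) * (t - c))"
    by (rule Ck_on_mult[OF Ck_on_const 1])
  show ?thesis
    unfolding soft_part_def by (rule Ck_on_mult[OF 1 Ck_on_compose[OF Ck_on_exp_bump 2]])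
qed

lemma DERIV_soft_part:
  "DERIV (\<lambda>t. soft_part n (t - c)) t
     :> exp_bump 0 (real (Suc n) * (t - c)) + exp_bump 1 (real (Suc n) * (t - c))"
proof -
  define N where "N = real (Suc n)"
  have lin: "DERIV (\<lambda>t. N * (t - c)) t :> N"
    by (auto intro!: derivative_eq_intros)
  have "DERIV (\<lambda>t. exp_bump 0 (N * (t - c))) t :> exp_bump 2 (N * (t - c)) * N"
    using DERIV_chain2[OF DERIV_exp_bump[of 0] lin] by (simp add: numeral_2_eq_2)
  moreover have "DERIV (\<lambda>t. t - c) t :> 1"
    by (auto intro!: derivative_eq_intros)
  ultimately have "DERIV (\<lambda>t. (t - c) * exp_bump 0 (N * (t - c))) t
      :> 1 * exp_bump 0 (N * (t - c)) + exp_bump 2 (N * (t - c)) * N * (t - c)"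
    by (rule DERIV_mult[rotated])
  moreover have "exp_bump 2 (N * (t - c)) * N * (t - c) = exp_bump 1 (N * (t - c))"
    by (simp add: exp_bump_def power2_eq_square)
  ultimately show ?thesis
    unfolding soft_part_def N_def by simp
qed

lemma soft_part_bounds: "0 \<le> soft_part n t" "soft_part n t \<le> max 0 t"
proof -
  show "0 \<le> soft_part n t"
    by (auto simp: soft_part_def exp_bump_def zero_less_mult_iff)
  show "soft_part n t \<le> max 0 t"
  proof (cases "0 < t")
    case True
    then have "t * exp_bump 0 (real (Suc n) * t) \<le> t * 1"
      using exp_bump_le[of 0] by (intro mult_left_mono) auto
    then show ?thesis by (simp add: soft_part_def)
  next
    case False
    then show ?thesis
      by (simp add: soft_part_def exp_bump_def zero_less_mult_iff)
  qed
qed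

lemma soft_part_nonpos: "t \<le> 0 \<Longrightarrow> soft_part n t = 0"
  using soft_part_bounds[of n t] by simp

lemma exp_bump_scaled_limit:
  "(\<lambda>n. exp_bump k (real (Suc n) * t)) \<longlonglongrightarrow> (if 0 < t \<and> k = 0 then 1 else 0)"
proof (cases "0 < t")
  case True
  have "(\<lambda>n. inverse (real (Suc n)) * (1 / t)) \<longlonglongrightarrow> 0 * (1 / t)"
    by (intro tendsto_mult LIMSEQ_inverse_real_of_nat tendsto_const)
  then have inv: "(\<lambda>n. 1 / (real (Suc n) * t)) \<longlonglongrightarrow> 0"
    by (simp add: field_simps)
  have "(\<lambda>n. (1 / (real (Suc n) * t)) ^ k * exp (- (1 / (real (Suc n) * t)))) \<longlonglongrightarrow> 0 ^ k * exp (- 0)"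
    by (intro tendsto_intros inv)
  moreover have "exp_bump k (real (Suc n) * t) = (1 / (real (Suc n) * t)) ^ k * exp (- (1 / (real (Suc n) * t)))" for n
    using True by (simp only: exp_bump_def) simp
  ultimately show ?thesis
    using True by (simp add: power_0_left)
next
  case False
  then have "exp_bump k (real (Suc n) * t) = 0" for n
    by (simp add: exp_bump_def zero_less_mult_iff)
  then show ?thesis
    using False by simp
qed

lemma soft_part_limit: "(\<lambda>n. soft_part n t) \<longlonglongrightarrow> max 0 t"
proof (cases "0 < t")
  case True
  then have "(\<lambda>n. t * exp_bump 0 (real (Suc n) * t)) \<longlonglongrightarrow> t * 1"
    using exp_bump_scaled_limit[of 0 t] by (intro tendsto_mult tendsto_const) simp
  then show ?thesis
    using True by (simp add: soft_part_def[abs_def])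
next
  case False
  then have "soft_part n t = 0" for n
    by (intro soft_part_nonpos) simp
  then show ?thesis
    using False by simp
qed

lemma soft_part_deriv_limit:
  "(\<lambda>n. exp_bump 0 (real (Suc n) * t) + exp_bump 1 (real (Suc n) * t)) \<longlonglongrightarrow> (if 0 < t then 1 else 0)"
  using tendsto_add[OF exp_bump_scaled_limit[of 0 t] exp_bump_scaled_limit[of 1 t]] by simp

context critical_solution
begin

text \<open>The first passage to the limit: test functions inside a fixed smooth \<open>F\<close>
  are replaced by \<open>u\<close>, using continuity of \<open>F\<close> and
  \<open>F'\<close>.\<close>

lemma test_pair_cut_smooth:
  fixes F F' :: "real \<Rightarrow> real"
  assumes \<zeta>: "\<And>k. Ck_on k UNIV \<zeta>" "\<And>x. \<bar>\<zeta> x\<bar> \<le> 1"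
    and F: "\<And>k. Ck_on k UNIV F" "F 0 = 0" "\<And>t. DERIV F t :> F' t"
    and M: "\<And>t. \<bar>F t\<bar> \<le> M * \<bar>t\<bar>" "\<And>t. \<bar>F' t\<bar> \<le> M" "0 \<le> M"
    and c: "\<And>t x. \<bar>F t\<bar> * norm (grad \<zeta> x) \<le> c * \<bar>t\<bar> powr (q1 / p)" "0 \<le> c"
  shows "test_pair (\<lambda>x. \<zeta> x * F (u x)) (\<lambda>x. F (u x) *\<^sub>R grad \<zeta> x + (\<zeta> x * F' (u x)) *\<^sub>R G x)"
proof -
  obtain \<phi> A1 A2 B where \<phi>: "\<And>n::nat. \<phi> n \<in> Cinfc \<Omega>"
    and nn: "\<And>x. 0 \<le> A1 x" "\<And>x. 0 \<le> A2 x" "\<And>x. 0 \<le> B x"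
    and meas: "A1 \<in> borel_measurable L" "A2 \<in> borel_measurable L" "B \<in> borel_measurable L"
    and int: "integrable M1 (\<lambda>x. A1 x powr q1)" "integrable M2 (\<lambda>x. A2 x powr q)" "integrable M1 (\<lambda>x. B x powr p)"
    and AE: "AE x in L. (\<forall>n. \<bar>\<phi> n x\<bar> \<le> A1 x \<and> \<bar>\<phi> n x\<bar> \<le> A2 x \<and> norm (grad (\<phi> n) x) \<le> B x) \<and>
       (\<lambda>n. \<phi> n x) \<longlonglongrightarrow> u x \<and> (\<lambda>n. grad (\<phi> n) x) \<longlonglongrightarrow> G x"
    by (rule approximation) blast
  have F'_eq: "F' = grad F"
    using F(3) by (auto simp: fun_eq_iff intro!: grad_eq[symmetric])
  have contF': "continuous_on UNIV F'"
    unfolding F'_eq by (rule C1_continuous_grad[OF F(1)])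
  have contF: "continuous_on UNIV F"
    using F(1)[of 0] by simp
  have [measurable]: "F \<in> borel_measurable borel" "F' \<in> borel_measurable borel"
    using contF contF' by (auto intro: borel_measurable_continuous_onI)
  have cont: "continuous_on UNIV \<zeta>" "continuous_on UNIV (grad \<zeta>)"
    using \<zeta>(1)[of 0] C1_continuous_grad[OF \<zeta>(1)] by simp_all
  show ?thesis
  proof (rule test_pair_cut_limit[where F="\<lambda>n. F" and F'="\<lambda>n. F'" and \<phi>=\<phi> and \<Gamma>="\<lambda>n. grad (\<phi> n)"])
    show "test_pair (\<lambda>x. \<zeta> x * F (\<phi> n x))
        (\<lambda>x. F (\<phi> n x) *\<^sub>R grad \<zeta> x + (\<zeta> x * F' (\<phi> n x)) *\<^sub>R grad (\<phi> n) x)" for n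
      using test_pair_Cinfc[OF Cinfc_cut(1)[OF \<phi> \<zeta>(1) F]] unfolding Cinfc_cut(2)[OF \<phi> \<zeta>(1) F] .
    show "(\<lambda>x. F (u x)) \<in> borel_measurable L" "(\<lambda>x. F' (u x)) \<in> borel_measurable L"
      by measurable
    show "\<zeta> \<in> borel_measurable L" "grad \<zeta> \<in> borel_measurable L"
      by (rule continuous_imp_measurable_lebesgue_on cont)+
    show "AE x in L. \<forall>n. \<bar>\<phi> n x\<bar> \<le> A1 x \<and> \<bar>\<phi> n x\<bar> \<le> A2 x \<and> norm (grad (\<phi> n) x) \<le> B x"
      by (rule eventually_mono[OF AE]) blast
    show "AE x in L. (\<lambda>n. F (\<phi> n x)) \<longlonglongrightarrow> F (u x) \<and> (\<lambda>n. F' (\<phi> n x)) \<longlonglongrightarrow> F' (u x) \<and> (\<lambda>n. grad (\<phi> n) x) \<longlonglongrightarrow> G x"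
      using AE
    proof eventually_elim
      case (elim x)
      have "isCont F (u x)" "isCont F' (u x)"
        using contF contF' by (simp_all add: continuous_on_eq_continuous_at)
      then show ?case
        using elim by (auto intro: isCont_tendsto_compose)
    qed
  qed (fact nn meas int M \<zeta>(2) c)+
qed

text \<open>The second passage to the limit, from \<open>soft_part\<close> to the positive part.
  Positivity of the level makes the truncation superlinear in \<open>u\<close>, which is what the
  growth condition on \<open>F\<close> times the gradient of the cutoff demands.\<close>

lemma test_pair_truncation:
  assumes \<zeta>: "\<And>k. Ck_on k UNIV \<zeta>" "\<And>x. \<bar>\<zeta> x\<bar> \<le> 1" "\<And>x. norm (grad \<zeta> x) \<le> d"
    and k: "0 < k"
  shows "test_pair (\<lambda>x. \<zeta> x * max 0 (u x - k))
    (\<lambda>x. max 0 (u x - k) *\<^sub>R grad \<zeta> x + (\<zeta> x * (if 0 < u x - k then 1 else 0)) *\<^sub>R G x)"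
proof -
  define F where "F n t = soft_part n (t - k)" for n t
  define F' where "F' n t = exp_bump 0 (real (Suc n) * (t - k)) + exp_bump 1 (real (Suc n) * (t - k))" for n t
  have F: "Ck_on j UNIV (F n)" "F n 0 = 0" "DERIV (F n) t :> F' n t" for n j t
    using Ck_on_soft_part DERIV_soft_part k soft_part_nonpos unfolding F_def[abs_def] F'_def by simp_all
  have Fb: "\<bar>F n t\<bar> \<le> max 0 (t - k)" for n t
    using soft_part_bounds[of n "t - k"] by (simp add: F_def)
  have M: "\<bar>F n t\<bar> \<le> 2 * \<bar>t\<bar>" "\<bar>F' n t\<bar> \<le> 2" for n t
    using Fb[of n t] k exp_bump_nonneg[of 0] exp_bump_nonneg[of 1] exp_bump_le[of 0] exp_bump_le[of 1]
    by (auto simp: F'_def intro: order_trans add_mono[of _ "1::real" _ 1, simplified])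
  have d: "0 \<le> d"
    using \<zeta>(3) norm_ge_zero order_trans by blast
  \<comment> \<open>Above the level \<open>k\<close>, \<open>t\<close> is at most
    \<open>k powr (1 - q1 / p) * t powr (q1 / p)\<close> because \<open>q1 > p\<close>; the factor
    \<open>d\<close> bounds the gradient of the cutoff.\<close>
  define c where "c = k powr (1 - q1 / p) * d"
  have c: "\<bar>F n t\<bar> * norm (grad \<zeta> x) \<le> c * \<bar>t\<bar> powr (q1 / p)" for n t x
  proof -
    have "max 0 (t - k) \<le> k powr (1 - q1 / p) * \<bar>t\<bar> powr (q1 / p)"
    proof (cases "k < t")
      case True
      have "t powr (1 - q1 / p) \<le> k powr (1 - q1 / p)"
        using True k p_less_q1 exponents_pos by (intro powr_mono2') auto
      then have "t powr (1 - q1 / p) * t powr (q1 / p) \<le> k powr (1 - q1 / p) * t powr (q1 / p)"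
        by (rule mult_right_mono) simp
      then show ?thesis
        using True k by (simp flip: powr_add)
    qed simp
    then have "\<bar>F n t\<bar> \<le> k powr (1 - q1 / p) * \<bar>t\<bar> powr (q1 / p)"
      using Fb order_trans by blast
    then have "\<bar>F n t\<bar> * norm (grad \<zeta> x) \<le> (k powr (1 - q1 / p) * \<bar>t\<bar> powr (q1 / p)) * d"
      using \<zeta>(3) by (intro mult_mono) auto
    then show ?thesis
      by (simp add: c_def mult_ac)
  qed
  have c_nn: "0 \<le> c"
    using d by (simp add: c_def)
  have cont: "continuous_on UNIV \<zeta>" "continuous_on UNIV (grad \<zeta>)"
    using \<zeta>(1)[of 0] C1_continuous_grad[OF \<zeta>(1)] by simp_all
  show ?thesis
  proof (rule test_pair_cut_limit[where F=F and F'=F' and \<phi>="\<lambda>n. u" and \<Gamma>="\<lambda>n. G"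
        and A="\<lambda>x. \<bar>u x\<bar>" and A'="\<lambda>x. \<bar>u x\<bar>" and B="\<lambda>x. norm (G x)" and M=2 and c=c])
    show "test_pair (\<lambda>x. \<zeta> x * F n (u x))
        (\<lambda>x. F n (u x) *\<^sub>R grad \<zeta> x + (\<zeta> x * F' n (u x)) *\<^sub>R G x)" for n
      by (rule test_pair_cut_smooth[OF \<zeta>(1,2) F M _ c c_nn]) simp
    show "(\<lambda>x. max 0 (u x - k)) \<in> borel_measurable L"
      "(\<lambda>x. (if 0 < u x - k then 1 else 0)::real) \<in> borel_measurable L"
      "(\<lambda>x. \<bar>u x\<bar>) \<in> borel_measurable L" "(\<lambda>x. norm (G x)) \<in> borel_measurable L"
      by measurable
    show "\<zeta> \<in> borel_measurable L" "grad \<zeta> \<in> borel_measurable L"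
      by (rule continuous_imp_measurable_lebesgue_on cont)+
    show "AE x in L. (\<lambda>n. F n (u x)) \<longlonglongrightarrow> max 0 (u x - k) \<and>
        (\<lambda>n. F' n (u x)) \<longlonglongrightarrow> (if 0 < u x - k then 1 else 0) \<and> (\<lambda>n. G x) \<longlonglongrightarrow> G x"
      unfolding F_def F'_def by (intro AE_I2 conjI soft_part_limit soft_part_deriv_limit tendsto_const)
    show "\<bar>F n t\<bar> * norm (grad \<zeta> x) \<le> c * \<bar>t\<bar> powr (q1 / p)" for n t x
      by (rule c)
  qed (use u_integrable1 u_integrable2 G_integrable \<zeta>(2) M c_nn in simp_all)
qed

text \<open>The truncation from above is the positive part of \<open>u\<close> minus that of
  \<open>u - k\<close>. Level 0 is harmless here: the cutoff is constant, so the growth condition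
  holds with constant 0. The derivatives of the regularizations stay within 2, being differences of
  two numbers between 0 and 2.\<close>

lemma test_pair_min:
  assumes k: "0 < k"
  shows "test_pair (\<lambda>x. min (max 0 (u x)) k) (\<lambda>x. (if 0 < u x \<and> u x \<le> k then 1 else 0) *\<^sub>R G x)"
proof -
  define F where "F n t = soft_part n (t - 0) - soft_part n (t - k)" for n t
  define F' where "F' n t = (exp_bump 0 (real (Suc n) * (t - 0)) + exp_bump 1 (real (Suc n) * (t - 0)))
      - (exp_bump 0 (real (Suc n) * (t - k)) + exp_bump 1 (real (Suc n) * (t - k)))" for n t
  have F: "Ck_on j UNIV (F n)" "F n 0 = 0" "DERIV (F n) t :> F' n t" for n j t
  proof -
    show "Ck_on j UNIV (F n)"
      unfolding F_def[abs_def] by (intro Ck_on_diff Ck_on_soft_part)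
    show "F n 0 = 0"
      using k by (simp add: F_def soft_part_nonpos)
    show "DERIV (F n) t :> F' n t"
      unfolding F_def[abs_def] F'_def by (intro DERIV_diff DERIV_soft_part)
  qed
  have M: "\<bar>F n t\<bar> \<le> 2 * \<bar>t\<bar>" "\<bar>F' n t\<bar> \<le> 2" for n t
    using k soft_part_bounds[of n t] soft_part_bounds[of n "t - k"]
      exp_bump_nonneg[of 0 "real (Suc n) * (t - 0)"] exp_bump_nonneg[of 1 "real (Suc n) * (t - 0)"]
      exp_bump_nonneg[of 0 "real (Suc n) * (t - k)"] exp_bump_nonneg[of 1 "real (Suc n) * (t - k)"]
      exp_bump_le[of 0 "real (Suc n) * (t - 0)"] exp_bump_le[of 1 "real (Suc n) * (t - 0)"]
      exp_bump_le[of 0 "real (Suc n) * (t - k)"] exp_bump_le[of 1 "real (Suc n) * (t - k)"]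
    unfolding F_def F'_def by (simp_all del: of_nat_Suc)
  have grad1: "grad (\<lambda>x::'a. 1::real) x = 0" for x
    by (rule grad_eq) (rule GDERIV_const)
  then have grad1': "grad (\<lambda>x::'a. 1::real) = (\<lambda>x. 0)"
    by (rule ext)
  have lim: "(\<lambda>n. F n t) \<longlonglongrightarrow> min (max 0 t) k"
    "(\<lambda>n. F' n t) \<longlonglongrightarrow> (if 0 < t \<and> t \<le> k then 1 else 0)" for t
  proof -
    have "(\<lambda>n. F n t) \<longlonglongrightarrow> max 0 (t - 0) - max 0 (t - k)"
      unfolding F_def by (intro tendsto_diff soft_part_limit)
    moreover have "max 0 (t - 0) - max 0 (t - k) = min (max 0 t) k"
      using k by (simp add: max_def min_def)
    ultimately show "(\<lambda>n. F n t) \<longlonglongrightarrow> min (max 0 t) k" by simp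
    have "(\<lambda>n. F' n t) \<longlonglongrightarrow> (if 0 < t - 0 then 1 else 0) - (if 0 < t - k then 1 else 0)"
      unfolding F'_def by (intro tendsto_diff soft_part_deriv_limit)
    moreover have "(if 0 < t - 0 then 1 else 0) - (if 0 < t - k then 1 else 0) = (if 0 < t \<and> t \<le> k then 1 else (0::real))"
      using k by simp
    ultimately show "(\<lambda>n. F' n t) \<longlonglongrightarrow> (if 0 < t \<and> t \<le> k then 1 else 0)" by simp
  qed
  have "test_pair (\<lambda>x. 1 * min (max 0 (u x)) k)
      (\<lambda>x. min (max 0 (u x)) k *\<^sub>R grad (\<lambda>x. 1) x + (1 * (if 0 < u x \<and> u x \<le> k then 1 else 0)) *\<^sub>R G x)"
  proof (rule test_pair_cut_limit[where F=F and F'=F' and \<phi>="\<lambda>n. u" and \<Gamma>="\<lambda>n. G"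
        and A="\<lambda>x. \<bar>u x\<bar>" and A'="\<lambda>x. \<bar>u x\<bar>" and B="\<lambda>x. norm (G x)" and M=2 and c=0])
    show "test_pair (\<lambda>x. 1 * F n (u x))
        (\<lambda>x. F n (u x) *\<^sub>R grad (\<lambda>x. 1) x + (1 * F' n (u x)) *\<^sub>R G x)" for n
      by (rule test_pair_cut_smooth[where \<zeta>="\<lambda>_. 1" and M=2 and c=0]) (use F M in \<open>simp_all add: grad1 Ck_on_const\<close>)
    show "(\<lambda>x. min (max 0 (u x)) k) \<in> borel_measurable L"
      "(\<lambda>x. (if 0 < u x \<and> u x \<le> k then 1 else 0)::real) \<in> borel_measurable L"
      "(\<lambda>x. \<bar>u x\<bar>) \<in> borel_measurable L" "(\<lambda>x. norm (G x)) \<in> borel_measurable L"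
      by measurable
    show "AE x in L. (\<lambda>n. F n (u x)) \<longlonglongrightarrow> min (max 0 (u x)) k \<and>
        (\<lambda>n. F' n (u x)) \<longlonglongrightarrow> (if 0 < u x \<and> u x \<le> k then 1 else 0) \<and> (\<lambda>n. G x) \<longlonglongrightarrow> G x"
      by (intro AE_I2 conjI lim tendsto_const)
  qed (use u_integrable1 u_integrable2 G_integrable M in \<open>simp_all add: grad1'\<close>)
  then show ?thesis
    by (simp add: grad1)
qed

end

section \<open>Caccioppoli and Sobolev inequalities on exterior regions\<close>

text \<open>Either \<open>2 * t \<le> g\<close>, and the product is at most half of
  \<open>g powr s\<close>, or \<open>g\<close> is replaced by \<open>2 * t\<close>. The coefficient
  one half is what Caccioppoli's inequality moves to the left-hand side.\<close>

lemma young_absorb: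
  fixes g t s :: real
  assumes "0 \<le> g" "0 \<le> t" "1 < s"
  shows "g powr (s - 1) * t \<le> g powr s / 2 + 2 powr s * t powr s"
proof -
  have *: "c powr (s - 1) * c = c powr s" if "0 \<le> c" for c :: real
    using powr_mult_base[OF that, of "s - 1"] by (simp add: mult.commute)
  show ?thesis
  proof (cases "2 * t \<le> g")
    case True
    then have "g powr (s - 1) * t \<le> g powr (s - 1) * (g / 2)"
      by (intro mult_left_mono) auto
    also have "\<dots> = g powr s / 2"
      using *[OF assms(1)] by simp
    also have "\<dots> \<le> g powr s / 2 + 2 powr s * t powr s"
      by simp
    finally show ?thesis .
  next
    case False
    then have "g powr (s - 1) * t \<le> (2 * t) powr (s - 1) * (2 * t)"
      using assms by (intro mult_mono powr_mono2) auto
    also have "\<dots> = 2 powr s * t powr s"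
      using *[of "2 * t"] assms by (simp add: powr_mult)
    also have "\<dots> \<le> g powr s / 2 + 2 powr s * t powr s"
      by simp
    finally show ?thesis .
  qed
qed

text \<open>De Giorgi's lemma on sequences with the dependence on \<open>T\<close> made explicit.
  The threshold scales like \<open>T powr (- (s / (s - 1)))\<close> because this is the positive
  fixed point of \<open>X \<mapsto> (T * X) powr s\<close>. With two exponents the smaller one
  decides, since the bases stay below 1.\<close>

lemma fast_geometric_convergence:
  fixes C \<alpha> \<beta> b :: real
  defines "s \<equiv> min \<alpha> \<beta>"
  assumes C: "0 < C" and \<alpha>: "1 < \<alpha>" and \<beta>: "1 < \<beta>" and b: "1 < b"
  shows "\<exists>\<epsilon>>0. \<forall>T\<ge>1. \<forall>X::nat \<Rightarrow> real. (\<forall>j. 0 \<le> X j) \<longrightarrow>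
    (\<forall>j. X (Suc j) \<le> C * ((b ^ (j + 2) * T * X j) powr \<alpha> + (b ^ (j + 2) * T * X j) powr \<beta>)) \<longrightarrow>
    X 0 \<le> \<epsilon> * T powr (- (s / (s - 1))) \<longrightarrow> X \<longlonglongrightarrow> 0"
proof -
  have s: "1 < s"
    using \<alpha> \<beta> by (simp add: s_def)
  \<comment> \<open>The relation \<open>(1 - m) * s = - m\<close> makes both \<open>\<tau>\<close>
    and the later \<open>P\<close> reproduce themselves: \<open>(b * \<tau>) powr s = \<tau>\<close>
    and \<open>(T * P) powr s = P\<close>. Hence a bound by
    \<open>\<epsilon> * P * \<tau> ^ j\<close> can be propagated.\<close>
  define m where "m = s / (s - 1)"
  have m: "1 < m" "m * s = m + s" 
    using s by (simp_all add: m_def field_simps)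
  define \<tau> where "\<tau> = b powr (- m)"
  have \<tau>: "0 < \<tau>" "\<tau> < 1"
    using b m by (simp_all add: \<tau>_def powr_less_one)
  have b\<tau>: "b * \<tau> = b powr (1 - m)" "b * \<tau> \<le> 1" "0 < b * \<tau>"
  proof -
    show "b * \<tau> = b powr (1 - m)"
      using b by (simp add: \<tau>_def powr_diff powr_minus divide_inverse)
    then show "b * \<tau> \<le> 1"
      using b m by (simp add: powr_le_one_le powr_less_one less_imp_le)
    show "0 < b * \<tau>"
      using b \<tau> by simp
  qed
  have b\<tau>s: "(b * \<tau>) powr s = \<tau>"
  proof -
    have "(1 - m) * s = - m"
      using m(2) by (simp add: algebra_simps)
    then show ?thesis
      unfolding b\<tau>(1) powr_powr by (simp add: \<tau>_def)
  qed
  \<comment> \<open>The first entry keeps the bases of the powers below 1; the second is the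
    smallness needed to pass from \<open>j\<close> to \<open>Suc j\<close>.\<close>
  define \<epsilon> where "\<epsilon> = min (1 / b\<^sup>2) ((\<tau> / (2 * C * b\<^sup>2 powr s)) powr (1 / (s - 1)))"
  have \<epsilon>: "0 < \<epsilon>"
    using b C \<tau> by (simp add: \<epsilon>_def)
  have \<epsilon>1: "b\<^sup>2 * \<epsilon> \<le> 1"
  proof -
    have "b\<^sup>2 * \<epsilon> \<le> b\<^sup>2 * (1 / b\<^sup>2)"
      by (intro mult_left_mono) (simp_all add: \<epsilon>_def)
    then show ?thesis using b by simp
  qed
  have \<epsilon>2: "2 * C * (b\<^sup>2 * \<epsilon>) powr s \<le> \<epsilon> * \<tau>"
  proof -
    have "\<epsilon> powr (s - 1) \<le> ((\<tau> / (2 * C * b\<^sup>2 powr s)) powr (1 / (s - 1))) powr (s - 1)"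
      using \<epsilon> s by (intro powr_mono2) (simp_all add: \<epsilon>_def)
    also have "\<dots> = \<tau> / (2 * C * b\<^sup>2 powr s)"
      using s \<tau> C b by (simp add: powr_powr)
    finally have "\<epsilon> powr (s - 1) * (2 * C * b\<^sup>2 powr s) \<le> \<tau>"
      using C b by (simp add: pos_le_divide_eq)
    then have "\<epsilon> * (\<epsilon> powr (s - 1) * (2 * C * b\<^sup>2 powr s)) \<le> \<epsilon> * \<tau>"
      using \<epsilon> by (intro mult_left_mono) auto
    moreover have e: "\<epsilon> powr s = \<epsilon> * \<epsilon> powr (s - 1)"
      using powr_mult_base[of \<epsilon> "s - 1"] \<epsilon> by simp
    ultimately show ?thesis
      using b \<epsilon> by (simp add: powr_mult e mult_ac)
  qed
  show ?thesis
  proof (rule exI[of _ \<epsilon>], intro conjI \<epsilon> allI impI)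
    fix T :: real and X :: "nat \<Rightarrow> real"
    assume T: "1 \<le> T" and X: "\<forall>j. 0 \<le> X j"
      and step: "\<forall>j. X (Suc j) \<le> C * ((b ^ (j + 2) * T * X j) powr \<alpha> + (b ^ (j + 2) * T * X j) powr \<beta>)"
      and X0: "X 0 \<le> \<epsilon> * T powr (- (s / (s - 1)))"
    define P where "P = T powr (- m)"
    have P: "0 < P"
      using T by (simp add: P_def)
    have TP: "T * P = T powr (1 - m)" "T * P \<le> 1" "0 < T * P"
    proof -
      show "T * P = T powr (1 - m)"
        using T by (simp add: P_def powr_diff powr_minus divide_inverse)
      then show "T * P \<le> 1"
        using T m powr_mono[of "1 - m" 0 T] by simp
      show "0 < T * P"
        using T P by simp
    qed
    have TPs: "(T * P) powr s = P"
    proof -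
      have "(1 - m) * s = - m"
        using m(2) by (simp add: algebra_simps)
      then show ?thesis
        unfolding TP(1) powr_powr by (simp add: P_def)
    qed
    have bound: "X j \<le> \<epsilon> * P * \<tau> ^ j" for j
    proof (induction j)
      case 0
      then show ?case
        using X0 by (simp add: P_def m_def)
    next
      case (Suc j)
      define y where "y = b ^ (j + 2) * T * X j"
      have y: "0 \<le> y"
        using b T X by (simp add: y_def)
      have "y \<le> b ^ (j + 2) * T * (\<epsilon> * P * \<tau> ^ j)"
        unfolding y_def using Suc b T by (intro mult_left_mono) auto
      also have "\<dots> = (b\<^sup>2 * \<epsilon>) * ((b * \<tau>) ^ j * (T * P))"
        by (simp add: power_add power_mult_distrib mult_ac power2_eq_square)
      finally have y_le: "y \<le> (b\<^sup>2 * \<epsilon>) * ((b * \<tau>) ^ j * (T * P))" .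
      have "(b * \<tau>) ^ j * (T * P) \<le> 1 * 1"
        using b\<tau> TP by (intro mult_mono power_le_one) auto
      then have "(b\<^sup>2 * \<epsilon>) * ((b * \<tau>) ^ j * (T * P)) \<le> 1 * 1"
        using \<epsilon>1 \<epsilon> b b\<tau> TP by (intro mult_mono) auto
      then have y1: "y \<le> 1"
        using y_le by simp
      have "y powr \<alpha> \<le> y powr s" "y powr \<beta> \<le> y powr s"
        using y y1 s by (auto intro!: powr_mono' simp: s_def)
      then have "X (Suc j) \<le> C * (y powr s + y powr s)"
        using step[rule_format, of j] C unfolding y_def[symmetric]
        by (meson add_mono mult_left_mono less_imp_le order_trans)
      also have "y powr s \<le> ((b\<^sup>2 * \<epsilon>) * ((b * \<tau>) ^ j * (T * P))) powr s"
        using y y_le s by (intro powr_mono2) auto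
      also have "\<dots> = (b\<^sup>2 * \<epsilon>) powr s * (\<tau> ^ j * P)"
      proof -
        have "((b * \<tau>) ^ j) powr s = ((b * \<tau>) powr s) ^ j"
          using b\<tau>(3) by (simp only: powr_realpow[symmetric] powr_powr powr_power)
        moreover have "(c * (d * e)) powr s = c powr s * (d powr s * e powr s)"
          if "0 \<le> c" "0 \<le> d" "0 \<le> e" for c d e :: real
          using that by (simp add: powr_mult)
        ultimately show ?thesis
          using b \<epsilon> b\<tau>(3) TP(3) b\<tau>s TPs by auto
      qed
      finally have "X (Suc j) \<le> (2 * C * (b\<^sup>2 * \<epsilon>) powr s) * (\<tau> ^ j * P)"
        using C by (simp add: algebra_simps)
      also have "\<dots> \<le> (\<epsilon> * \<tau>) * (\<tau> ^ j * P)"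
        using \<epsilon>2 \<tau> P by (intro mult_right_mono) auto
      finally show ?case
        by (simp add: mult_ac)
    qed
    have "(\<lambda>j. \<epsilon> * P * \<tau> ^ j) \<longlonglongrightarrow> \<epsilon> * P * 0"
      using \<tau> by (intro tendsto_mult tendsto_const LIMSEQ_power_zero) auto
    then have lim0: "(\<lambda>j. \<epsilon> * P * \<tau> ^ j) \<longlonglongrightarrow> 0"
      by simp
    show "X \<longlonglongrightarrow> 0"
      by (rule tendsto_sandwich[OF _ _ tendsto_const lim0]) (use X bound in auto)
  qed
qed

context critical_solution
begin

lemma norm_measurable [measurable]: "norm \<in> borel_measurable L"
  by (rule continuous_imp_measurable_lebesgue_on) (intro continuous_intros)

definition super1 :: "real \<Rightarrow> real \<Rightarrow> real" where
  "super1 a k = (LINT x|M1. (if a < norm x then max 0 (u x - k) powr q1 else 0))"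

definition super2 :: "real \<Rightarrow> real \<Rightarrow> real" where
  "super2 a k = (LINT x|M2. (if a < norm x then max 0 (u x - k) powr q else 0))"

lemma super_integrable:
  assumes "0 \<le> k"
  shows "integrable M1 (\<lambda>x. if a < norm x then max 0 (u x - k) powr q1 else 0)"
    and "integrable M2 (\<lambda>x. if a < norm x then max 0 (u x - k) powr q else 0)"
proof -
  show "integrable M1 (\<lambda>x. if a < norm x then max 0 (u x - k) powr q1 else 0)"
  proof (rule Bochner_Integration.integrable_bound[OF u_integrable1])
    show "AE x in M1. norm (if a < norm x then max 0 (u x - k) powr q1 else 0) \<le> norm (\<bar>u x\<bar> powr q1)"
      using assms exponents_pos by (intro AE_I2) (auto intro!: powr_mono2)
  qed simp
  show "integrable M2 (\<lambda>x. if a < norm x then max 0 (u x - k) powr q else 0)"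
  proof (rule Bochner_Integration.integrable_bound[OF u_integrable2])
    show "AE x in M2. norm (if a < norm x then max 0 (u x - k) powr q else 0) \<le> norm (\<bar>u x\<bar> powr q)"
      using assms exponents_pos by (intro AE_I2) (auto intro!: powr_mono2)
  qed simp
qed

lemma super_nonneg: "0 \<le> super1 a k" "0 \<le> super2 a k"
  unfolding super1_def super2_def by (auto intro!: integral_nonneg)

lemma super_antimono:
  assumes "0 \<le> h" "h \<le> k" "a \<le> b"
  shows "super1 b k \<le> super1 a h" "super2 b k \<le> super2 a h"
  unfolding super1_def super2_def using assms exponents_pos
  by (auto intro!: integral_mono super_integrable powr_mono2)

text \<open>The right-hand side of Caccioppoli's inequality for the positive part of
  \<open>u - k\<close>: the first term comes from the gradient of the cutoff, the second from the
  right-hand side of the equation.\<close>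

definition excess :: "real \<Rightarrow> real \<Rightarrow> real \<Rightarrow> real" where
  "excess a b k = (b - a) powr (- p) * (LINT x|M1. (if a < norm x then max 0 (u x - k) powr p else 0))
     + (LINT x|M2. (if a < norm x then \<bar>u x\<bar> powr (q - 1) * max 0 (u x - k) else 0))"

text \<open>For the first integral, \<open>u > k\<close> and \<open>p < q1\<close> bound the power
  \<open>p\<close> by \<open>k powr (p - q1)\<close> times the power \<open>q1\<close>; this uses
  \<open>k > 0\<close>.\<close>

lemma excess_integrable:
  assumes "0 < k"
  shows "integrable M1 (\<lambda>x. if a < norm x then max 0 (u x - k) powr p else 0)"
    and "integrable M2 (\<lambda>x. if a < norm x then \<bar>u x\<bar> powr (q - 1) * max 0 (u x - k) else 0)"
proof -
  show "integrable M1 (\<lambda>x. if a < norm x then max 0 (u x - k) powr p else 0)"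
  proof (rule Bochner_Integration.integrable_bound)
    show "integrable M1 (\<lambda>x. k powr (p - q1) * \<bar>u x\<bar> powr q1)"
      using u_integrable1 by simp
    show "AE x in M1. norm (if a < norm x then max 0 (u x - k) powr p else 0) \<le> norm (k powr (p - q1) * \<bar>u x\<bar> powr q1)"
    proof (rule AE_I2)
      fix x
      have "(u x - k) powr p \<le> k powr (p - q1) * u x powr q1" if "k \<le> u x"
      proof -
        have "(u x - k) powr p \<le> u x powr p"
          using that assms exponents_pos by (intro powr_mono2) auto
        also have "\<dots> = u x powr (p - q1) * u x powr q1"
          using that assms by (simp flip: powr_add)
        also have "\<dots> \<le> k powr (p - q1) * u x powr q1"
          using that assms p_less_q1 by (intro mult_right_mono powr_mono2') auto
        finally show ?thesis .
      qed
      then show "norm (if a < norm x then max 0 (u x - k) powr p else 0) \<le> norm (k powr (p - q1) * \<bar>u x\<bar> powr q1)"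
        using assms by (auto simp: max_def)
    qed
  qed simp
  show "integrable M2 (\<lambda>x. if a < norm x then \<bar>u x\<bar> powr (q - 1) * max 0 (u x - k) else 0)"
  proof (rule Bochner_Integration.integrable_bound[OF u_integrable2])
    show "AE x in M2. norm (if a < norm x then \<bar>u x\<bar> powr (q - 1) * max 0 (u x - k) else 0) \<le> norm (\<bar>u x\<bar> powr q)"
    proof (rule AE_I2)
      fix x
      have "\<bar>u x\<bar> powr (q - 1) * max 0 (u x - k) \<le> \<bar>u x\<bar> powr (q - 1) * \<bar>u x\<bar>"
        using assms by (intro mult_left_mono) auto
      also have "\<dots> = \<bar>u x\<bar> powr q"
        using powr_mult_base[of "\<bar>u x\<bar>" "q - 1"] by (simp add: mult.commute)
      finally show "norm (if a < norm x then \<bar>u x\<bar> powr (q - 1) * max 0 (u x - k) else 0) \<le> norm (\<bar>u x\<bar> powr q)"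
        by simp
    qed
  qed simp
qed

lemma excess_nonneg: "0 \<le> excess a b k"
  unfolding excess_def by (intro add_nonneg_nonneg mult_nonneg_nonneg integral_nonneg) auto

lemma powr_minus_2_self: "norm g powr (s - 2) * (g \<bullet> g) = norm g powr s" for g :: "'b::real_inner"
proof (cases "g = 0")
  case False
  then have "norm g powr s = norm g powr (s - 2) * norm g powr 2"
    by (simp only: powr_add[symmetric]) simp
  also have "norm g powr 2 = g \<bullet> g"
    by (simp add: power2_norm_eq_inner)
  finally show ?thesis by simp
qed simp

text \<open>The equation is tested with \<open>\<zeta> * v\<close>, the cutoff entering to the first
  power, since its gradient is already bounded by its power \<open>1 - 1 / p\<close>. This controls
  the integral of \<open>T\<close>, the energy above \<open>k\<close> weighted by
  \<open>\<zeta>\<close>; the energy of \<open>\<zeta> * v\<close> is then bounded by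
  \<open>excess\<close>, and the two Sobolev inequalities conclude. The constant is independent of
  the radii and the level.\<close>

lemma caccioppoli_sobolev:
  "\<exists>C>0. \<forall>a b k. 0 \<le> a \<longrightarrow> a < b \<longrightarrow> 0 < k \<longrightarrow>
     super1 b k \<le> C * excess a b k powr (q1 / p) \<and> super2 b k \<le> C * excess a b k powr (q / p)"
proof -
  define c0 where "c0 = 8 * p\<^sup>2 + 2 * p"
  have c0: "0 < c0"
    using exponents_pos by (simp add: c0_def add_pos_pos)
  define D where "D = 2 powr p * (1 + 2 * 2 powr p) * (c0 powr p + 1)"
  have D: "0 < D"
    by (simp add: D_def add_pos_pos add_nonneg_pos)
  define C where "C = exp (q1 + q) * K * (D powr (q1 / p) + D powr (q / p))"
  have C: "0 < C"
    using D K_pos by (simp add: C_def add_pos_pos)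
  show ?thesis
  proof (rule exI[of _ C], intro conjI C allI impI)
    fix a b k :: real
    assume a: "0 \<le> a" and ab: "a < b" and k: "0 < k"
    define \<zeta> where "\<zeta> = (cutoff a b :: 'a \<Rightarrow> real)"
    define v where "v x = max 0 (u x - k)" for x
    define \<theta> :: "'a \<Rightarrow> real" where "\<theta> x = (if 0 < u x - k then 1 else 0)" for x
    define H where "H x = v x *\<^sub>R grad \<zeta> x + (\<zeta> x * \<theta> x) *\<^sub>R G x" for x
    define l where "l = c0 / (b - a)"
    have l: "0 < l"
      using c0 ab by (simp add: l_def)
    have \<zeta>b: "0 \<le> \<zeta> x" "\<zeta> x \<le> 1" for x
      using cutoff_bounds by (simp_all add: \<zeta>_def)
    have \<zeta>0: "\<zeta> x = 0" "grad \<zeta> x = 0" if "\<not> a < norm x" for x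
      using cutoff_eq_0[OF a ab, of x] that by (simp_all add: \<zeta>_def)
    have g\<zeta>: "norm (grad \<zeta> x) \<le> l * \<zeta> x powr (1 - 1 / p)" for x
      using norm_grad_cutoff_le[OF a ab exponents_pos(1)] by (simp add: \<zeta>_def l_def c0_def)
    have g\<zeta>': "norm (grad \<zeta> x) \<le> l" for x
    proof -
      have "\<zeta> x powr (1 - 1 / p) \<le> 1"
        using \<zeta>b p_gt_1 by (intro powr_le1) auto
      then have "l * \<zeta> x powr (1 - 1 / p) \<le> l * 1"
        using l by (intro mult_left_mono) auto
      then show ?thesis
        using g\<zeta>[of x] by simp
    qed
    have tp: "test_pair (\<lambda>x. \<zeta> x * v x) H"
      unfolding H_def v_def \<theta>_def
      by (rule test_pair_truncation[OF _ _ g\<zeta>' k]) (use Ck_on_cutoff \<zeta>b in \<open>simp_all add: \<zeta>_def\<close>)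
    have [measurable]: "H \<in> borel_measurable L" "(\<lambda>x. \<zeta> x * v x) \<in> borel_measurable L"
      using tp unfolding test_pair_def by blast+
    define P where "P x = (if a < norm x then v x powr p else 0)" for x
    define Q where "Q x = (if a < norm x then \<bar>u x\<bar> powr (q - 1) * v x else 0)" for x
    define T where "T x = \<zeta> x * \<theta> x * norm (G x) powr p" for x
    have intP: "integrable M1 P" and intQ: "integrable M2 Q"
      using excess_integrable[OF k] unfolding P_def[abs_def] Q_def[abs_def] v_def by auto
    have [measurable]: "\<zeta> \<in> borel_measurable L"
      using Ck_on_cutoff[of 0] unfolding \<zeta>_def by (intro continuous_imp_measurable_lebesgue_on) simp
    have [measurable]: "\<theta> \<in> borel_measurable L"
      unfolding \<theta>_def by measurable
    have \<theta>b: "0 \<le> \<theta> x" "\<theta> x \<le> 1" for x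
      by (simp_all add: \<theta>_def)
    have intT: "integrable M1 T"
    proof (rule Bochner_Integration.integrable_bound[OF G_integrable])
      show "AE x in M1. norm (T x) \<le> norm (norm (G x) powr p)"
      proof (rule AE_I2)
        fix x
        have "\<zeta> x * \<theta> x * norm (G x) powr p \<le> 1 * 1 * norm (G x) powr p"
          using \<zeta>b \<theta>b by (intro mult_mono) auto
        then show "norm (T x) \<le> norm (norm (G x) powr p)"
          using \<zeta>b \<theta>b by (simp add: T_def abs_mult)
      qed
    qed (simp add: T_def[abs_def])
    have intGH: "integrable M1 (\<lambda>x. norm (G x) powr (p - 2) * (G x \<bullet> H x))"
    proof (rule Bochner_Integration.integrable_bound)
      show "integrable M1 (\<lambda>x. norm (G x) powr p + norm (H x) powr p)"
        using tp G_integrable by (simp add: test_pair_def)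
      show "AE x in M1. norm (norm (G x) powr (p - 2) * (G x \<bullet> H x)) \<le> norm (norm (G x) powr p + norm (H x) powr p)"
        using powr_minus_2_bound[OF p_gt_1 order_refl, of "G x" "H x" for x] by simp
      show "(\<lambda>x. norm (G x) powr (p - 2) * (G x \<bullet> H x)) \<in> borel_measurable M1"
        by simp
    qed
    have pt1: "T x / 2 \<le> norm (G x) powr (p - 2) * (G x \<bullet> H x) + 2 powr p * l powr p * P x" for x
    proof (cases "a < norm x")
      case False
      then show ?thesis
        by (simp add: T_def P_def H_def \<zeta>0)
    next
      case True
      have v: "0 \<le> v x" by (simp add: v_def)
      \<comment> \<open>With this \<open>g\<close> the bound on the gradient of the cutoff turns the
        mixed term into \<open>g powr (p - 1) * (l * v x)\<close>, while \<open>g powr p\<close> is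
        the weighted energy density, so Young's inequality can absorb it.\<close>
      define g where "g = norm (G x) * \<zeta> x powr (1 / p)"
      have g: "0 \<le> g" by (simp add: g_def)
      have gp: "g powr p = \<zeta> x * norm (G x) powr p"
        using exponents_pos \<zeta>b by (simp add: g_def powr_mult powr_powr)
      have gp1: "g powr (p - 1) = norm (G x) powr (p - 1) * \<zeta> x powr (1 - 1 / p)"
        using exponents_pos \<zeta>b by (simp add: g_def powr_mult powr_powr field_simps)
      have "\<bar>norm (G x) powr (p - 2) * (G x \<bullet> grad \<zeta> x)\<bar> \<le> norm (G x) powr (p - 2) * (norm (G x) * norm (grad \<zeta> x))"
        unfolding abs_mult by (intro mult_mono Cauchy_Schwarz_ineq2) auto
      also have "\<dots> = norm (G x) powr (p - 1) * norm (grad \<zeta> x)"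
        using powr_mult_base[of "norm (G x)" "p - 2"] by (simp add: mult_ac)
      also have "\<dots> \<le> norm (G x) powr (p - 1) * (l * \<zeta> x powr (1 - 1 / p))"
        using g\<zeta> by (intro mult_left_mono) auto
      finally have "v x * \<bar>norm (G x) powr (p - 2) * (G x \<bullet> grad \<zeta> x)\<bar> \<le> v x * (norm (G x) powr (p - 1) * (l * \<zeta> x powr (1 - 1 / p)))"
        using v by (intro mult_left_mono) auto
      also have "\<dots> = g powr (p - 1) * (l * v x)"
        by (simp add: gp1)
      finally have "v x * \<bar>norm (G x) powr (p - 2) * (G x \<bullet> grad \<zeta> x)\<bar> \<le> g powr (p - 1) * (l * v x)" .
      moreover have "v x * (- \<bar>norm (G x) powr (p - 2) * (G x \<bullet> grad \<zeta> x)\<bar>)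
          \<le> v x * (norm (G x) powr (p - 2) * (G x \<bullet> grad \<zeta> x))"
        using v by (intro mult_left_mono) linarith+
      ultimately have 1: "- (g powr (p - 1) * (l * v x)) \<le> v x * (norm (G x) powr (p - 2) * (G x \<bullet> grad \<zeta> x))"
        unfolding mult_minus_right by linarith
      \<comment> \<open>\<open>T\<close> lives only where \<open>u > k\<close>. Elsewhere
        \<open>v\<close> vanishes and there is nothing to absorb.\<close>
      have 2: "g powr (p - 1) * (l * v x) \<le> T x / 2 + 2 powr p * l powr p * P x"
      proof (cases "0 < u x - k")
        case True
        then show ?thesis
          using young_absorb[OF g, of "l * v x" p] l v p_gt_1 \<open>a < norm x\<close>
          by (simp add: T_def P_def gp \<theta>_def powr_mult mult_ac)
      next
        case False
        then show ?thesis
          by (simp add: v_def T_def P_def \<theta>_def)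
      qed
      have "norm (G x) powr (p - 2) * (G x \<bullet> H x)
          = v x * (norm (G x) powr (p - 2) * (G x \<bullet> grad \<zeta> x)) + \<zeta> x * \<theta> x * (norm (G x) powr (p - 2) * (G x \<bullet> G x))"
        by (simp add: H_def inner_add_right algebra_simps)
      also have "norm (G x) powr (p - 2) * (G x \<bullet> G x) = norm (G x) powr p"
        by (rule powr_minus_2_self)
      finally show ?thesis
        using 1 2 unfolding T_def by linarith
    qed
    have pt2: "norm (H x) powr p \<le> 2 powr p * (l powr p * P x + T x)" for x
    proof (cases "a < norm x")
      case False
      then show ?thesis
        by (simp add: T_def P_def H_def \<zeta>0)
    next
      case True
      have v: "0 \<le> v x" by (simp add: v_def)
      have "norm (H x) \<le> v x * norm (grad \<zeta> x) + (\<zeta> x * \<theta> x) * norm (G x)"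
        unfolding H_def using norm_triangle_ineq[of "v x *\<^sub>R grad \<zeta> x" "(\<zeta> x * \<theta> x) *\<^sub>R G x"] v \<zeta>b \<theta>b by simp
      also have "\<dots> \<le> l * v x + (\<zeta> x * \<theta> x) * norm (G x)"
        using mult_left_mono[OF g\<zeta>'[of x] v] by (simp add: mult.commute)
      finally have "norm (H x) powr p \<le> (l * v x + (\<zeta> x * \<theta> x) * norm (G x)) powr p"
        using exponents_pos by (intro powr_mono2) auto
      also have "\<dots> \<le> 2 powr p * ((l * v x) powr p + ((\<zeta> x * \<theta> x) * norm (G x)) powr p)"
        using l v \<zeta>b \<theta>b exponents_pos by (intro powr_add_le) auto
      also have "((\<zeta> x * \<theta> x) * norm (G x)) powr p \<le> T x"
      proof -
        \<comment> \<open>For a number between 0 and 1 the power \<open>p > 1\<close> may be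
          replaced by the power 1, which returns to \<open>T\<close>.\<close>
        have "(\<zeta> x * \<theta> x) powr p \<le> (\<zeta> x * \<theta> x) powr 1"
          using \<zeta>b[of x] \<theta>b[of x] p_gt_1 by (intro powr_mono') (auto intro: mult_le_one)
        then have "(\<zeta> x * \<theta> x) powr p * norm (G x) powr p \<le> (\<zeta> x * \<theta> x) * norm (G x) powr p"
          using \<zeta>b[of x] \<theta>b[of x] by (intro mult_right_mono) auto
        then show ?thesis
          using \<zeta>b[of x] \<theta>b[of x] by (simp add: T_def powr_mult)
      qed
      finally show ?thesis
        using True l v by (simp add: P_def powr_mult)
    qed
    have pt3: "\<bar>u x\<bar> powr (q - 2) * u x * (\<zeta> x * v x) \<le> Q x" for x
    proof (cases "a < norm x \<and> k < u x")
      case True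
      have "\<bar>u x\<bar> powr (q - 2) * u x = \<bar>u x\<bar> powr (q - 1)"
        using powr_mult_base[of "u x" "q - 2"] True k by (simp add: mult_ac)
      moreover have "\<zeta> x * v x \<le> 1 * v x"
        using \<zeta>b by (intro mult_right_mono) (auto simp: v_def)
      ultimately show ?thesis
        using True by (simp add: Q_def mult_left_mono)
    next
      case False
      then show ?thesis
        by (auto simp: Q_def v_def \<zeta>0)
    qed
    have intuv: "integrable M2 (\<lambda>x. \<bar>u x\<bar> powr (q - 2) * u x * (\<zeta> x * v x))"
    proof (rule Bochner_Integration.integrable_bound)
      show "integrable M2 (\<lambda>x. \<bar>u x\<bar> powr q + \<bar>\<zeta> x * v x\<bar> powr q)"
        using tp u_integrable2 by (simp add: test_pair_def)
      show "AE x in M2. norm (\<bar>u x\<bar> powr (q - 2) * u x * (\<zeta> x * v x)) \<le> norm (\<bar>u x\<bar> powr q + \<bar>\<zeta> x * v x\<bar> powr q)"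
        using powr_minus_2_bound[of q "\<zeta> x * v x" "\<bar>\<zeta> x * v x\<bar>" "u x" for x] p_gt_1 p_less_q
        by (simp add: mult_ac)
      show "(\<lambda>x. \<bar>u x\<bar> powr (q - 2) * u x * (\<zeta> x * v x)) \<in> borel_measurable M2"
        by simp
    qed
    have IP: "0 \<le> (LINT x|M1. P x)" and IQ: "0 \<le> (LINT x|M2. Q x)"
      by (auto intro!: integral_nonneg simp: P_def Q_def v_def)
    have "(LINT x|M1. T x / 2) \<le> (LINT x|M1. norm (G x) powr (p - 2) * (G x \<bullet> H x) + 2 powr p * l powr p * P x)"
      by (rule integral_mono) (use intT intGH intP pt1 in auto)
    then have "(LINT x|M1. T x) / 2 \<le> (LINT x|M1. norm (G x) powr (p - 2) * (G x \<bullet> H x)) + 2 powr p * l powr p * (LINT x|M1. P x)"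
      using intGH intP by simp
    \<comment> \<open>The equation enters here, tested with \<open>\<zeta> * v\<close>.\<close>
    also have "(LINT x|M1. norm (G x) powr (p - 2) * (G x \<bullet> H x)) = (LINT x|M2. \<bar>u x\<bar> powr (q - 2) * u x * (\<zeta> x * v x))"
      using tp by (simp add: test_pair_def)
    also have "\<dots> \<le> (LINT x|M2. Q x)"
      by (rule integral_mono[OF intuv intQ pt3])
    finally have IT: "(LINT x|M1. T x) \<le> 2 * (LINT x|M2. Q x) + 2 * 2 powr p * l powr p * (LINT x|M1. P x)"
      by simp
    have "(LINT x|M1. norm (H x) powr p) \<le> (LINT x|M1. 2 powr p * (l powr p * P x + T x))"
      by (rule integral_mono) (use tp intT intP pt2 in \<open>auto simp: test_pair_def\<close>)
    also have "\<dots> = 2 powr p * (l powr p * (LINT x|M1. P x) + (LINT x|M1. T x))"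
      using intT intP by simp
    also have "\<dots> \<le> 2 powr p * ((1 + 2 * 2 powr p) * (l powr p * (LINT x|M1. P x)) + (1 + 2 * 2 powr p) * (LINT x|M2. Q x))"
    proof (intro mult_left_mono)
      have "1 * (LINT x|M2. Q x) \<le> 2 powr p * (LINT x|M2. Q x)"
        using IQ exponents_pos by (intro mult_right_mono) (auto simp: ge_one_powr_ge_zero)
      then have "2 * (LINT x|M2. Q x) \<le> (1 + 2 * 2 powr p) * (LINT x|M2. Q x)"
        using IQ by (simp add: distrib_right)
      then show "l powr p * (LINT x|M1. P x) + (LINT x|M1. T x)
          \<le> (1 + 2 * 2 powr p) * (l powr p * (LINT x|M1. P x)) + (1 + 2 * 2 powr p) * (LINT x|M2. Q x)"
        using IT by (simp add: distrib_right)
    qed simp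
    also have "\<dots> = 2 powr p * (1 + 2 * 2 powr p) * (l powr p * (LINT x|M1. P x) + (LINT x|M2. Q x))"
      by (simp add: algebra_simps)
    also have "\<dots> \<le> 2 powr p * (1 + 2 * 2 powr p) * ((c0 powr p + 1) * excess a b k)"
    proof (intro mult_left_mono)
      have "l powr p = c0 powr p / (b - a) powr p"
        using c0 ab by (simp add: l_def powr_divide)
      then have "l powr p = c0 powr p * (b - a) powr (- p)"
        by (simp add: powr_minus divide_inverse)
      moreover have "excess a b k = (b - a) powr (- p) * (LINT x|M1. P x) + (LINT x|M2. Q x)"
        unfolding excess_def P_def Q_def v_def ..
      moreover have "0 \<le> c0 powr p * (LINT x|M2. Q x)" "0 \<le> (b - a) powr (- p) * (LINT x|M1. P x)"
        using IP IQ by auto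
      ultimately show "l powr p * (LINT x|M1. P x) + (LINT x|M2. Q x) \<le> (c0 powr p + 1) * excess a b k"
        by (simp add: algebra_simps)
    qed simp
    finally have IH: "(LINT x|M1. norm (H x) powr p) \<le> D * excess a b k"
      by (simp add: D_def mult.assoc)
    have final: "J \<le> C * excess a b k powr (s / p)"
      if "I \<le> K * (LINT x|M1. norm (H x) powr p) powr (s / p)" "J \<le> exp s * I" "s = q1 \<or> s = q" for s I J
    proof -
      have s: "0 < s" "s \<le> q1 + q"
        using that exponents_pos by auto
      have "(LINT x|M1. norm (H x) powr p) powr (s / p) \<le> (D * excess a b k) powr (s / p)"
        using IH s exponents_pos by (intro powr_mono2) auto
      then have "I \<le> K * (D * excess a b k) powr (s / p)"
        using that(1) K_pos by (meson mult_left_mono less_imp_le order_trans)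
      then have "J \<le> exp s * (K * (D * excess a b k) powr (s / p))"
        using that(2) by (meson mult_left_mono exp_ge_zero order_trans)
      also have "\<dots> = exp s * (K * D powr (s / p)) * excess a b k powr (s / p)"
        using D excess_nonneg by (simp add: powr_mult)
      also have "\<dots> \<le> C * excess a b k powr (s / p)"
      proof (intro mult_right_mono)
        have "D powr (s / p) \<le> D powr (q1 / p) + D powr (q / p)"
          using that(3) by auto
        then show "exp s * (K * D powr (s / p)) \<le> C"
          unfolding C_def mult.assoc using s K_pos by (intro mult_mono) auto
      qed simp
      finally show ?thesis .
    qed
    have pt4: "(if b < norm x then v x powr s else 0) \<le> exp s * \<bar>\<zeta> x * v x\<bar> powr s" if "0 < s" for s x
    proof (cases "b < norm x")
      case True
      have v: "0 \<le> v x" by (simp add: v_def)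
      have "exp (- 1) * v x \<le> \<zeta> x * v x"
        using cutoff_ge[OF a ab, of x] True v by (intro mult_right_mono) (simp_all add: \<zeta>_def)
      then have "(exp (- 1) * v x) powr s \<le> \<bar>\<zeta> x * v x\<bar> powr s"
        using that v by (intro powr_mono2) auto
      then have "exp s * (exp (- 1) * v x) powr s \<le> exp s * \<bar>\<zeta> x * v x\<bar> powr s"
        by (intro mult_left_mono) auto
      moreover have "exp s * (exp (- 1) * v x) powr s = v x powr s"
      proof -
        have "exp (- 1) powr s = exp (- s)"
          by (subst exp_powr_real) simp
        then have "exp s * exp (- 1) powr s = 1"
          by (simp only: exp_add[symmetric]) simp
        then show ?thesis
          using v by (simp only: powr_mult mult.assoc[symmetric] exp_ge_zero)
      qed
      ultimately show ?thesis
        using True by simp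
    qed simp
    have sint: "integrable M1 (\<lambda>x. if b < norm x then v x powr q1 else 0)"
      "integrable M2 (\<lambda>x. if b < norm x then v x powr q else 0)"
      using super_integrable[OF less_imp_le[OF k]] unfolding v_def by blast+
    have "super1 b k \<le> (LINT x|M1. exp q1 * \<bar>\<zeta> x * v x\<bar> powr q1)"
      unfolding super1_def v_def[symmetric]
      by (rule integral_mono)
        (use tp pt4[OF exponents_pos(3)] sint in \<open>simp_all add: test_pair_def\<close>)
    then show "super1 b k \<le> C * excess a b k powr (q1 / p)"
      by (intro final[where I="LINT x|M1. \<bar>\<zeta> x * v x\<bar> powr q1"]) (use tp in \<open>simp_all add: test_pair_def\<close>)
    have "super2 b k \<le> (LINT x|M2. exp q * \<bar>\<zeta> x * v x\<bar> powr q)"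
      unfolding super2_def v_def[symmetric]
      by (rule integral_mono)
        (use tp pt4[OF exponents_pos(2)] sint in \<open>simp_all add: test_pair_def\<close>)
    then show "super2 b k \<le> C * excess a b k powr (q / p)"
      by (intro final[where I="LINT x|M2. \<bar>\<zeta> x * v x\<bar> powr q"]) (use tp in \<open>simp_all add: test_pair_def\<close>)
  qed
qed

section \<open>De Giorgi iteration and decay\<close>

text \<open>Where \<open>u > k\<close>, the gap \<open>u - h > k - h\<close> lets negative powers of
  \<open>k - h\<close> trade the exponent \<open>p\<close> for \<open>q1\<close>, and lets
  \<open>u\<close> itself be bounded by a multiple of \<open>u - h\<close>. Both terms become linear
  in the masses at the lower level.\<close>

lemma excess_le:
  assumes h: "0 < h" "h < k" and "a < b"
  shows "excess a b k \<le> (b - a) powr (- p) * (k - h) powr (- (q1 - p)) * super1 a h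
     + (k / (k - h)) powr (q - 1) * super2 a h"
proof -
  have k: "0 < k" using h by simp
  have "(LINT x|M1. (if a < norm x then max 0 (u x - k) powr p else 0))
      \<le> (LINT x|M1. (k - h) powr (- (q1 - p)) * (if a < norm x then max 0 (u x - h) powr q1 else 0))"
  proof (rule integral_mono)
    show "integrable M1 (\<lambda>x. if a < norm x then max 0 (u x - k) powr p else 0)"
      by (rule excess_integrable(1)[OF k])
    show "integrable M1 (\<lambda>x. (k - h) powr (- (q1 - p)) * (if a < norm x then max 0 (u x - h) powr q1 else 0))"
      using super_integrable(1)[of h a] h by simp
    fix x
    have "max 0 (u x - k) powr p \<le> (k - h) powr (- (q1 - p)) * max 0 (u x - h) powr q1"
    proof (cases "k < u x")
      case True
      have "(u x - k) powr p \<le> (u x - h) powr p"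
        using True h exponents_pos by (intro powr_mono2) auto
      also have "\<dots> = (u x - h) powr (- (q1 - p)) * (u x - h) powr q1"
        using True h by (simp flip: powr_add)
      also have "\<dots> \<le> (k - h) powr (- (q1 - p)) * (u x - h) powr q1"
        using True h p_less_q1 by (intro mult_right_mono powr_mono2') auto
      finally show ?thesis
        using True h by (simp add: max_def)
    qed (simp add: max_def)
    then show "(if a < norm x then max 0 (u x - k) powr p else 0)
        \<le> (k - h) powr (- (q1 - p)) * (if a < norm x then max 0 (u x - h) powr q1 else 0)"
      by simp
  qed
  also have "\<dots> = (k - h) powr (- (q1 - p)) * super1 a h"
    by (simp add: super1_def)
  finally have 1: "(LINT x|M1. (if a < norm x then max 0 (u x - k) powr p else 0)) \<le> (k - h) powr (- (q1 - p)) * super1 a h" .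
  have "(LINT x|M2. (if a < norm x then \<bar>u x\<bar> powr (q - 1) * max 0 (u x - k) else 0))
      \<le> (LINT x|M2. (k / (k - h)) powr (q - 1) * (if a < norm x then max 0 (u x - h) powr q else 0))"
  proof (rule integral_mono)
    show "integrable M2 (\<lambda>x. if a < norm x then \<bar>u x\<bar> powr (q - 1) * max 0 (u x - k) else 0)"
      by (rule excess_integrable(2)[OF k])
    show "integrable M2 (\<lambda>x. (k / (k - h)) powr (q - 1) * (if a < norm x then max 0 (u x - h) powr q else 0))"
      using super_integrable(2)[of h a] h by simp
    fix x
    have "\<bar>u x\<bar> powr (q - 1) * max 0 (u x - k) \<le> (k / (k - h)) powr (q - 1) * max 0 (u x - h) powr q"
    proof (cases "k < u x")
      case True
      \<comment> \<open>The quotient of \<open>t\<close> by \<open>t - h\<close> decreases in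
        \<open>t\<close>, so beyond \<open>k\<close> it is at most its value at
        \<open>k\<close>.\<close>
      have "u x * (k - h) \<le> k * (u x - h)"
        using True h mult_strict_left_mono[of k "u x" h] by (simp add: algebra_simps)
      then have "u x \<le> k / (k - h) * (u x - h)"
        using h by (simp add: field_simps)
      then have "\<bar>u x\<bar> powr (q - 1) * (u x - k) \<le> (k / (k - h) * (u x - h)) powr (q - 1) * (u x - h)"
        using True h p_gt_1 p_less_q by (intro mult_mono powr_mono2) auto
      also have "\<dots> = (k / (k - h)) powr (q - 1) * ((u x - h) * (u x - h) powr (q - 1))"
        by (subst powr_mult) (use True h in \<open>simp_all add: mult_ac\<close>)
      also have "(u x - h) * (u x - h) powr (q - 1) = (u x - h) powr q"
        using powr_mult_base[of "u x - h" "q - 1"] True h by simp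
      finally show ?thesis
        using True h by (simp add: max_def)
    qed (simp add: max_def)
    then show "(if a < norm x then \<bar>u x\<bar> powr (q - 1) * max 0 (u x - k) else 0)
        \<le> (k / (k - h)) powr (q - 1) * (if a < norm x then max 0 (u x - h) powr q else 0)"
      by simp
  qed
  also have "\<dots> = (k / (k - h)) powr (q - 1) * super2 a h"
    by (simp add: super2_def)
  finally have 2: "(LINT x|M2. (if a < norm x then \<bar>u x\<bar> powr (q - 1) * max 0 (u x - k) else 0)) \<le> (k / (k - h)) powr (q - 1) * super2 a h" .
  show ?thesis
    unfolding excess_def using mult_left_mono[OF 1, of "(b - a) powr (- p)"] 2 by (simp add: mult.assoc)
qed

lemma super1_eq_0_imp:
  assumes "super1 a k = 0" "0 \<le> k"
  shows "AE x in L. a < norm x \<longrightarrow> u x \<le> k"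
proof -
  have "AE x in M1. (if a < norm x then max 0 (u x - k) powr q1 else 0) = 0"
    using assms(1) integral_nonneg_eq_0_iff_AE[OF super_integrable(1)[OF assms(2), of a]]
    unfolding super1_def by simp
  then show ?thesis
    unfolding AE_M1 by eventually_elim (auto split: if_splits simp: max_def)
qed

text \<open>The levels \<open>\<kappa> (2 - 2\<^sup>-\<^sup>j)\<close> are tested on the exterior regions \<open>\<bar>x\<bar> > R (2 - 2\<^sup>-\<^sup>j)\<close>. The
  critical term needs no absorption, since \<open>u\<close> is at most \<open>2\<^bsup>j+2\<^esup>\<close> times its excess over the
  previous level wherever it exceeds the next one.\<close>

lemma de_giorgi:
  "\<exists>m>0. \<exists>\<epsilon>>0. \<forall>R>0. \<forall>\<kappa>>0. 1 \<le> R powr (- p) * \<kappa> powr (- (q1 - p)) \<longrightarrow>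
     super1 R \<kappa> + super2 R \<kappa> \<le> \<epsilon> * (R powr (- p) * \<kappa> powr (- (q1 - p))) powr (- m) \<longrightarrow>
     (AE x in L. 2 * R < norm x \<longrightarrow> u x \<le> 2 * \<kappa>)"
proof -
  obtain C where C: "0 < C" and cs: "\<And>a b k. 0 \<le> a \<Longrightarrow> a < b \<Longrightarrow> 0 < k \<Longrightarrow>
     super1 b k \<le> C * excess a b k powr (q1 / p) \<and> super2 b k \<le> C * excess a b k powr (q / p)"
    using caccioppoli_sobolev by blast
  define s where "s = min (q1 / p) (q / p)"
  have exps: "1 < q1 / p" "1 < q / p"
    using p_less_q p_less_q1 exponents_pos by simp_all
  \<comment> \<open>Large enough to dominate every power of 2 whose exponent is at most
    \<open>q1 + q\<close>, hence all the losses from the shrinking gaps between radii and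
    levels.\<close>
  define B where "B = (2::real) powr (q1 + q)"
  have B: "1 < B"
    using powr_less_mono[of 0 "q1 + q" "2::real"] exponents_pos by (simp add: B_def)
  obtain \<epsilon> where \<epsilon>: "0 < \<epsilon>" and fast: "\<And>T X. 1 \<le> T \<Longrightarrow> (\<And>j::nat. 0 \<le> X j) \<Longrightarrow>
    (\<And>j. X (Suc j) \<le> C * ((B ^ (j + 2) * T * X j) powr (q1 / p) + (B ^ (j + 2) * T * X j) powr (q / p))) \<Longrightarrow>
    X 0 \<le> \<epsilon> * T powr (- (s / (s - 1))) \<Longrightarrow> X \<longlonglongrightarrow> 0"
    using fast_geometric_convergence[OF C exps B] unfolding s_def by blast
  show ?thesis
  proof (rule exI[of _ "s / (s - 1)"], rule conjI, use exps in \<open>simp add: s_def\<close>,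
      rule exI[of _ \<epsilon>], intro conjI \<epsilon> allI impI)
    fix R \<kappa> :: real
    assume R: "0 < R" and \<kappa>: "0 < \<kappa>"
      and T1: "1 \<le> R powr (- p) * \<kappa> powr (- (q1 - p))"
      and init: "super1 R \<kappa> + super2 R \<kappa> \<le> \<epsilon> * (R powr (- p) * \<kappa> powr (- (q1 - p))) powr (- (s / (s - 1)))"
    define T where "T = R powr (- p) * \<kappa> powr (- (q1 - p))"
    define \<delta> where "\<delta> j = (1 / 2 :: real) ^ j" for j :: nat
    define a where "a j = R * (2 - \<delta> j)" for j
    define k where "k j = \<kappa> * (2 - \<delta> j)" for j
    define X where "X j = super1 (a j) (k j) + super2 (a j) (k j)" for j
    have \<delta>: "0 < \<delta> j" "\<delta> j \<le> 1" "\<delta> (Suc j) = \<delta> j / 2" for j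
      by (simp_all add: \<delta>_def power_le_one)
    have a: "0 \<le> a j" "a j < a (Suc j)" "a (Suc j) - a j = R * \<delta> (Suc j)" "a j \<le> 2 * R" for j
      using R \<delta>[of j] by (simp_all add: a_def algebra_simps)
    have k: "0 < k j" "k j < k (Suc j)" "k (Suc j) - k j = \<kappa> * \<delta> (Suc j)" "k j \<le> 2 * \<kappa>" for j
      using \<kappa> \<delta>[of j] by (simp_all add: k_def algebra_simps)
    have X_nn: "0 \<le> X j" for j
      by (simp add: X_def super_nonneg)
    have two: "(2::real) powr t \<le> B" if "t \<le> q1 + q" for t
      using that by (simp add: B_def)
    have \<delta>_powr: "\<delta> j powr (- t) \<le> B ^ j" if "0 \<le> t" "t \<le> q1 + q" for j t
    proof -
      have "\<delta> j powr (- t) = (2 powr t) ^ j"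
        by (simp add: \<delta>_def powr_minus powr_power powr_realpow[symmetric] powr_powr powr_divide inverse_eq_divide mult.commute)
      also have "\<dots> \<le> B ^ j"
        using two[OF that(2)] by (intro power_mono) auto
      finally show ?thesis .
    qed
    have step: "X (Suc j) \<le> C * ((B ^ (j + 2) * T * X j) powr (q1 / p) + (B ^ (j + 2) * T * X j) powr (q / p))" for j
    proof -
      let ?E = "excess (a j) (a (Suc j)) (k (Suc j))"
      have c1: "(a (Suc j) - a j) powr (- p) * (k (Suc j) - k j) powr (- (q1 - p)) \<le> B ^ (j + 2) * T"
      proof -
        have "\<delta> (Suc j) powr (- p) * \<delta> (Suc j) powr (- (q1 - p)) = \<delta> (Suc j) powr (- q1)"
          by (simp flip: powr_add)
        also have "\<dots> \<le> B ^ Suc j"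
          using exponents_pos by (intro \<delta>_powr) auto
        also have "\<dots> \<le> B ^ (j + 2)"
          using B by (intro power_increasing) auto
        finally have "T * (\<delta> (Suc j) powr (- p) * \<delta> (Suc j) powr (- (q1 - p))) \<le> T * B ^ (j + 2)"
          using T1 by (intro mult_left_mono) (simp_all add: T_def)
        moreover have "(a (Suc j) - a j) powr (- p) * (k (Suc j) - k j) powr (- (q1 - p))
            = T * (\<delta> (Suc j) powr (- p) * \<delta> (Suc j) powr (- (q1 - p)))"
          unfolding a(3) k(3) T_def using R \<kappa> \<delta>(1)[of "Suc j"] by (simp add: powr_mult mult_ac)
        ultimately show ?thesis
          by (simp only: mult.commute[of T])
      qed
      \<comment> \<open>The ratio of the new level to the gap is at most \<open>2 ^ (j + 2)\<close>,
        which explains the shift by 2 in the recursion. This coefficient does not depend on the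
        scale; the factor \<open>T \<ge> 1\<close> is inserted to give both coefficients the same
        form.\<close>
      have c2: "(k (Suc j) / (k (Suc j) - k j)) powr (q - 1) \<le> B ^ (j + 2) * T"
      proof -
        have "k (Suc j) / (k (Suc j) - k j) \<le> 2 * \<kappa> / (\<kappa> * \<delta> (Suc j))"
          unfolding k(3) using \<kappa> \<delta>(1)[of "Suc j"] k(4)[of "Suc j"] by (intro divide_right_mono) auto
        also have "\<dots> = inverse (\<delta> (j + 2))"
          using \<kappa> by (simp add: \<delta>_def)
        finally have "(k (Suc j) / (k (Suc j) - k j)) powr (q - 1) \<le> inverse (\<delta> (j + 2)) powr (q - 1)"
          using k[of "Suc j"] k(2)[of j] p_gt_1 p_less_q by (intro powr_mono2) auto
        also have "\<dots> = \<delta> (j + 2) powr (- (q - 1))"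
          by (simp only: powr_minus inverse_powr less_imp_le[OF \<delta>(1)])
        also have "\<dots> \<le> B ^ (j + 2)"
          using p_gt_1 p_less_q exponents_pos by (intro \<delta>_powr) auto
        also have "\<dots> \<le> B ^ (j + 2) * T"
          using T1 B by (simp add: T_def)
        finally show ?thesis .
      qed
      have "?E \<le> (a (Suc j) - a j) powr (- p) * (k (Suc j) - k j) powr (- (q1 - p)) * super1 (a j) (k j)
          + (k (Suc j) / (k (Suc j) - k j)) powr (q - 1) * super2 (a j) (k j)"
        by (rule excess_le[OF k(1,2) a(2)])
      also have "\<dots> \<le> B ^ (j + 2) * T * super1 (a j) (k j) + B ^ (j + 2) * T * super2 (a j) (k j)"
        by (intro add_mono mult_right_mono c1 c2 super_nonneg)
      also have "\<dots> = B ^ (j + 2) * T * X j"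
        by (simp add: X_def distrib_left)
      finally have E: "?E \<le> B ^ (j + 2) * T * X j" .
      have Es: "C * ?E powr t \<le> C * (B ^ (j + 2) * T * X j) powr t" if "0 < t" for t
        using C that E excess_nonneg by (intro mult_left_mono powr_mono2) auto
      have "super1 (a (Suc j)) (k (Suc j)) \<le> C * ?E powr (q1 / p)"
        "super2 (a (Suc j)) (k (Suc j)) \<le> C * ?E powr (q / p)"
        using cs[OF a(1,2) k(1)] by auto
      then show ?thesis
        using Es[of "q1 / p"] Es[of "q / p"] exps unfolding X_def[of "Suc j"] distrib_left by linarith
    qed
    have "X \<longlonglongrightarrow> 0"
    proof (rule fast[of T])
      show "1 \<le> T" using T1 by (simp add: T_def)
      show "X 0 \<le> \<epsilon> * T powr (- (s / (s - 1)))"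
        using init by (simp add: X_def a_def k_def \<delta>_def T_def)
    qed (fact X_nn step)+
    \<comment> \<open>All radii and levels stay below \<open>2 * R\<close> and
      \<open>2 * \<kappa>\<close>, so every \<open>X j\<close> bounds this one mass, which must
      therefore vanish.\<close>
    moreover have "super1 (2 * R) (2 * \<kappa>) \<le> X j" for j
      using super_antimono(1)[of "k j" "2 * \<kappa>" "a j" "2 * R"] super_nonneg[of "a j" "k j"] a(4)[of j] k(1,4)[of j]
      by (simp add: X_def)
    ultimately have "super1 (2 * R) (2 * \<kappa>) \<le> 0"
      by (intro LIMSEQ_le_const) auto
    then have "super1 (2 * R) (2 * \<kappa>) = 0"
      using super_nonneg(1)[of "2 * R" "2 * \<kappa>"] by simp
    then show "AE x in L. 2 * R < norm x \<longrightarrow> u x \<le> 2 * \<kappa>"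
      using \<kappa> by (intro super1_eq_0_imp) auto
  qed
qed

section \<open>Power decay of the energy below small levels\<close>

definition low_energy :: "real \<Rightarrow> real" where
  "low_energy k = (LINT x|M2. \<bar>u x\<bar> powr (q - 2) * u x * min (max 0 (u x)) k)"

lemma low_energy_integrable:
  assumes "0 \<le> k"
  shows "integrable M2 (\<lambda>x. \<bar>u x\<bar> powr (q - 2) * u x * min (max 0 (u x)) k)"
proof (rule Bochner_Integration.integrable_bound)
  show "integrable M2 (\<lambda>x. \<bar>u x\<bar> powr q + \<bar>u x\<bar> powr q)"
    using u_integrable2 by simp
  show "AE x in M2. norm (\<bar>u x\<bar> powr (q - 2) * u x * min (max 0 (u x)) k) \<le> norm (\<bar>u x\<bar> powr q + \<bar>u x\<bar> powr q)"
  proof (rule AE_I2)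
    fix x
    have "norm (min (max 0 (u x)) k) \<le> \<bar>u x\<bar>"
      using assms by auto
    then show "norm (\<bar>u x\<bar> powr (q - 2) * u x * min (max 0 (u x)) k) \<le> norm (\<bar>u x\<bar> powr q + \<bar>u x\<bar> powr q)"
      using powr_minus_2_bound[of q "min (max 0 (u x)) k" "\<bar>u x\<bar>" "u x"] p_gt_1 p_less_q
      by (simp add: mult_ac)
  qed
qed simp

lemma powr_minus_2_times_nonneg: "0 \<le> t \<Longrightarrow> \<bar>r\<bar> powr (q - 2) * r * min (max 0 r) t = max 0 r powr (q - 1) * min (max 0 r) t"
  using powr_mult_base[of r "q - 2"] by (cases "0 < r") (simp_all add: mult_ac max_def min_def)

lemma low_energy_nonneg: "0 \<le> k \<Longrightarrow> 0 \<le> low_energy k"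
  unfolding low_energy_def by (intro Bochner_Integration.integral_nonneg) (simp add: powr_minus_2_times_nonneg)

lemma low_energy_mono:
  assumes "0 \<le> h" "h \<le> k"
  shows "low_energy h \<le> low_energy k"
  unfolding low_energy_def using assms
  by (intro integral_mono low_energy_integrable) (auto simp: powr_minus_2_times_nonneg intro!: mult_left_mono)

text \<open>The gradient of the truncation is \<open>G\<close> times an indicator, so its energy
  density is exactly the integrand on the left of the equation. Testing with the truncation
  identifies its energy with \<open>low_energy k\<close>, and the Sobolev inequalities
  apply.\<close>

lemma low_energy_controls:
  assumes "0 < k"
  shows "(LINT x|M1. min (max 0 (u x)) k powr q1) \<le> K * low_energy k powr (q1 / p)"
    and "(LINT x|M2. min (max 0 (u x)) k powr q) \<le> K * low_energy k powr (q / p)"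
    and "integrable M1 (\<lambda>x. min (max 0 (u x)) k powr q1)"
    and "integrable M2 (\<lambda>x. min (max 0 (u x)) k powr q)"
proof -
  note tp = test_pair_min[OF assms]
  define H where "H x = (if 0 < u x \<and> u x \<le> k then 1 else 0) *\<^sub>R G x" for x
  have "norm (H x) powr p = norm (G x) powr (p - 2) * (G x \<bullet> H x)" for x
    using powr_minus_2_self[of "G x" p] by (simp add: H_def)
  then have "(LINT x|M1. norm (H x) powr p) = low_energy k"
    using tp unfolding test_pair_def low_energy_def H_def by simp
  moreover have "\<bar>min (max 0 (u x)) k\<bar> = min (max 0 (u x)) k" for x
    using assms by simp
  ultimately show "(LINT x|M1. min (max 0 (u x)) k powr q1) \<le> K * low_energy k powr (q1 / p)"
    "(LINT x|M2. min (max 0 (u x)) k powr q) \<le> K * low_energy k powr (q / p)"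
    "integrable M1 (\<lambda>x. min (max 0 (u x)) k powr q1)"
    "integrable M2 (\<lambda>x. min (max 0 (u x)) k powr q)"
    using tp unfolding test_pair_def H_def by simp_all
qed

text \<open>A pointwise comparison. Where \<open>u > 2 * k\<close>, the truncation at
  \<open>k\<close> is half of that at \<open>2 * k\<close>; where
  \<open>0 \<le> u \<le> 2 * k\<close>, the integrand is at most \<open>u powr q\<close>, a critical
  power of the truncation at \<open>2 * k\<close>, which is superlinear in the energy.\<close>

lemma low_energy_double:
  assumes "0 < k"
  shows "low_energy k \<le> low_energy (2 * k) / 2 + K * low_energy (2 * k) powr (q / p)"
proof -
  have k2: "0 < 2 * k" using assms by simp
  have "low_energy k \<le> (LINT x|M2. (\<bar>u x\<bar> powr (q - 2) * u x * min (max 0 (u x)) (2 * k)) / 2 + min (max 0 (u x)) (2 * k) powr q)"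
    unfolding low_energy_def
  proof (rule integral_mono)
    show "integrable M2 (\<lambda>x. \<bar>u x\<bar> powr (q - 2) * u x * min (max 0 (u x)) k)"
      using assms by (intro low_energy_integrable) simp
    show "integrable M2 (\<lambda>x. (\<bar>u x\<bar> powr (q - 2) * u x * min (max 0 (u x)) (2 * k)) / 2 + min (max 0 (u x)) (2 * k) powr q)"
      using low_energy_integrable[of "2 * k"] low_energy_controls(4)[OF k2] assms by simp
    fix x
    define t where "t = max 0 (u x)"
    have t: "0 \<le> t" by (simp add: t_def)
    have "t powr (q - 1) * min t k \<le> t powr (q - 1) * min t (2 * k) / 2 + min t (2 * k) powr q"
    proof (cases "t \<le> 2 * k")
      case True
      have "t powr (q - 1) * min t k \<le> t powr (q - 1) * t"
        by (intro mult_left_mono) auto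
      also have "\<dots> = t powr q"
        using powr_mult_base[OF t, of "q - 1"] by (simp add: mult.commute)
      finally have "t powr (q - 1) * min t k \<le> t powr q" .
      moreover have "0 \<le> t powr (q - 1) * min t (2 * k)"
        using t assms by simp
      ultimately show ?thesis
        using True by (simp add: min_def)
    next
      case False
      then show ?thesis
        using assms by (simp add: min_def)
    qed
    then show "\<bar>u x\<bar> powr (q - 2) * u x * min (max 0 (u x)) k
        \<le> (\<bar>u x\<bar> powr (q - 2) * u x * min (max 0 (u x)) (2 * k)) / 2 + min (max 0 (u x)) (2 * k) powr q"
      using assms by (simp add: powr_minus_2_times_nonneg t_def)
  qed
  also have "\<dots> = low_energy (2 * k) / 2 + (LINT x|M2. min (max 0 (u x)) (2 * k) powr q)"
    using low_energy_integrable[of "2 * k"] low_energy_controls(4)[OF k2] assms by (simp add: low_energy_def)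
  also have "\<dots> \<le> low_energy (2 * k) / 2 + K * low_energy (2 * k) powr (q / p)"
    using low_energy_controls(2)[OF k2] by simp
  finally show ?thesis .
qed

lemma low_energy_tendsto_0: "(\<lambda>n. low_energy ((1 / 2) ^ n)) \<longlonglongrightarrow> 0"
proof -
  have "(\<lambda>n. LINT x|M2. \<bar>u x\<bar> powr (q - 2) * u x * min (max 0 (u x)) ((1 / 2) ^ n)) \<longlonglongrightarrow> (LINT x|M2. 0)"
  proof (rule integral_dominated_convergence)
    show "integrable M2 (\<lambda>x. \<bar>u x\<bar> powr q + \<bar>u x\<bar> powr q)"
      using u_integrable2 by simp
    show "AE x in M2. norm (\<bar>u x\<bar> powr (q - 2) * u x * min (max 0 (u x)) ((1 / 2) ^ n)) \<le> \<bar>u x\<bar> powr q + \<bar>u x\<bar> powr q" for n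
    proof (rule AE_I2)
      fix x
      have "0 \<le> (1 / 2 :: real) ^ n" by simp
      then have "norm (min (max 0 (u x)) ((1 / 2) ^ n)) \<le> \<bar>u x\<bar>"
        unfolding real_norm_def by linarith
      then show "norm (\<bar>u x\<bar> powr (q - 2) * u x * min (max 0 (u x)) ((1 / 2) ^ n)) \<le> \<bar>u x\<bar> powr q + \<bar>u x\<bar> powr q"
        using powr_minus_2_bound[of q "min (max 0 (u x)) ((1 / 2) ^ n)" "\<bar>u x\<bar>" "u x"] p_gt_1 p_less_q
        by (simp add: mult_ac)
    qed
    show "AE x in M2. (\<lambda>n. \<bar>u x\<bar> powr (q - 2) * u x * min (max 0 (u x)) ((1 / 2) ^ n)) \<longlonglongrightarrow> 0"
    proof (rule AE_I2)
      fix x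
      have "(\<lambda>n. min (max 0 (u x)) ((1 / 2) ^ n)) \<longlonglongrightarrow> min (max 0 (u x)) 0"
        by (intro tendsto_min tendsto_const LIMSEQ_power_zero) simp
      then have "(\<lambda>n. \<bar>u x\<bar> powr (q - 2) * u x * min (max 0 (u x)) ((1 / 2) ^ n)) \<longlonglongrightarrow> \<bar>u x\<bar> powr (q - 2) * u x * min (max 0 (u x)) 0"
        by (intro tendsto_mult tendsto_const)
      then show "(\<lambda>n. \<bar>u x\<bar> powr (q - 2) * u x * min (max 0 (u x)) ((1 / 2) ^ n)) \<longlonglongrightarrow> 0"
        by simp
    qed
  qed simp_all
  then show ?thesis
    by (simp add: low_energy_def)
qed

text \<open>The energy tends to 0 with the level, so eventually the superlinear term is negligible
  and each halving of the level multiplies the energy by at most 3/4. The exponent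
  \<open>\<sigma>\<close> solves \<open>(1 / 2) powr \<sigma> = 3 / 4\<close>.\<close>

lemma low_energy_power_decay:
  "\<exists>C>0. \<exists>\<sigma>>0. \<exists>k0>0. k0 \<le> 1 \<and> (\<forall>k. 0 < k \<longrightarrow> k \<le> k0 \<longrightarrow> low_energy k \<le> C * k powr \<sigma>)"
proof -
  define \<sigma> where "\<sigma> = log 2 (4 / 3)"
  have \<sigma>: "0 < \<sigma>" "(1 / 2) powr \<sigma> = 3 / 4"
    by (simp_all add: \<sigma>_def powr_divide)
  have q: "0 < q / p - 1"
    using p_less_q exponents_pos by simp
  define r where "r = q / p - 1"
  \<comment> \<open>Below this threshold the superlinear term is at most a quarter of the energy,
    which gives the factor 1/2 + 1/4.\<close>
  define \<delta> where "\<delta> = (1 / (4 * K)) powr (1 / r)"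
  have \<delta>: "0 < \<delta>" "K * \<delta> powr (q / p - 1) = 1 / 4"
    using K_pos q unfolding r_def[symmetric] by (simp_all add: \<delta>_def powr_powr)
  obtain N where N: "\<And>n. N \<le> n \<Longrightarrow> low_energy ((1 / 2) ^ n) < \<delta>"
    using order_tendstoD(2)[OF low_energy_tendsto_0 \<delta>(1)] by (auto simp: eventually_sequentially)
  have step: "low_energy ((1 / 2) ^ Suc n) \<le> 3 / 4 * low_energy ((1 / 2) ^ n)" if "N \<le> n" for n
  proof -
    let ?e = "low_energy ((1 / 2) ^ n)"
    have e: "0 \<le> ?e" "?e < \<delta>"
      using N[OF that] by (auto intro: low_energy_nonneg)
    have "K * ?e powr (q / p) = (K * ?e powr (q / p - 1)) * ?e"
      using powr_mult_base[OF e(1), of "q / p - 1"] by (simp add: mult_ac)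
    also have "\<dots> \<le> (K * \<delta> powr (q / p - 1)) * ?e"
      using e q K_pos by (intro mult_right_mono mult_left_mono powr_mono2) auto
    finally have "K * ?e powr (q / p) \<le> ?e / 4"
      by (simp add: \<delta>(2))
    then show ?thesis
      using low_energy_double[of "(1 / 2) ^ Suc n"] by simp
  qed
  have geo: "low_energy ((1 / 2) ^ (N + n)) \<le> (3 / 4) ^ n * low_energy ((1 / 2) ^ N)" for n
  proof (induction n)
    case (Suc n)
    have "low_energy ((1 / 2) ^ (N + Suc n)) \<le> 3 / 4 * low_energy ((1 / 2) ^ (N + n))"
      using step[of "N + n"] by simp
    also have "\<dots> \<le> 3 / 4 * ((3 / 4) ^ n * low_energy ((1 / 2) ^ N))"
      using Suc by (intro mult_left_mono) auto
    finally show ?case by simp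
  qed simp
  \<comment> \<open>The factor \<open>2 ^ (N + 1)\<close> pays for rounding \<open>k\<close> up to a
    dyadic level and for starting at \<open>N\<close>; adding 1 keeps \<open>C\<close> positive even
    if the energy vanishes.\<close>
  define C where "C = (low_energy ((1 / 2) ^ N) + 1) * (2 ^ (N + 1)) powr \<sigma>"
  have eN: "0 \<le> low_energy ((1 / 2) ^ N)"
    by (rule low_energy_nonneg) simp
  have C: "0 < C"
    using eN by (simp add: C_def)
  have bound: "low_energy k \<le> C * k powr \<sigma>" if k: "0 < k" "k \<le> (1 / 2) ^ N" for k
  proof -
    have "(\<lambda>n. (1 / 2 :: real) ^ (N + n)) \<longlonglongrightarrow> 0"
      using LIMSEQ_ignore_initial_segment[OF LIMSEQ_power_zero[of "1 / 2 :: real"], of N] by (simp add: add.commute)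
    from order_tendstoD(2)[OF this k(1)] have ex: "\<exists>n. (1 / 2) ^ (N + n) < k"
      by (auto simp: eventually_sequentially)
    \<comment> \<open>The first dyadic level below \<open>k\<close>. Its predecessor, with index
      \<open>m\<close>, is at least \<open>k\<close> and at most twice as large.\<close>
    define n where "n = (LEAST n. (1 / 2) ^ (N + n) < k)"
    have n: "(1 / 2) ^ (N + n) < k"
      unfolding n_def using ex by (rule LeastI_ex)
    then have "n \<noteq> 0"
      using k(2) by (metis add_0_right not_less)
    then obtain m where m: "n = Suc m"
      using not0_implies_Suc by blast
    have "\<not> (1 / 2) ^ (N + m) < k"
      using not_less_Least[of m "\<lambda>n. (1 / 2) ^ (N + n) < k"] by (simp add: m flip: n_def)
    then have "low_energy k \<le> low_energy ((1 / 2) ^ (N + m))"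
      using k by (intro low_energy_mono) auto
    also have "\<dots> \<le> (3 / 4) ^ m * low_energy ((1 / 2) ^ N)"
      by (rule geo)
    also have "\<dots> \<le> (3 / 4) ^ m * (low_energy ((1 / 2) ^ N) + 1)"
      by (intro mult_left_mono) auto
    also have "(3 / 4 :: real) ^ m \<le> (2 ^ (N + 1)) powr \<sigma> * k powr \<sigma>"
    proof -
      have "(3 / 4 :: real) ^ m = ((1 / 2) ^ m) powr \<sigma>"
        unfolding \<sigma>(2)[symmetric] by (simp only: powr_power powr_realpow[symmetric] powr_powr)
      also have "\<dots> \<le> (2 ^ (N + 1) * k) powr \<sigma>"
      proof (intro powr_mono2)
        have "(1 / 2) ^ m = 2 ^ (N + 1) * (1 / 2 :: real) ^ (N + n)"
          by (simp add: m power_add power_divide)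
        also have "\<dots> \<le> 2 ^ (N + 1) * k"
          using n by (intro mult_left_mono) auto
        finally show "(1 / 2) ^ m \<le> 2 ^ (N + 1) * k" .
      qed (use \<sigma> in auto)
      also have "\<dots> = (2 ^ (N + 1)) powr \<sigma> * k powr \<sigma>"
        using k by (simp only: powr_mult)
      finally show ?thesis .
    qed
    then have "(3 / 4) ^ m * (low_energy ((1 / 2) ^ N) + 1) \<le> ((2 ^ (N + 1)) powr \<sigma> * k powr \<sigma>) * (low_energy ((1 / 2) ^ N) + 1)"
      using eN by (intro mult_right_mono) auto
    finally show ?thesis
      by (simp add: C_def mult_ac)
  qed
  show ?thesis
    using C \<sigma>(1) bound by (intro exI[of _ C] exI[of _ \<sigma>] exI[of _ "(1 / 2) ^ N"] conjI) (auto simp: power_le_one)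
qed

section \<open>From smallness at infinity to the improved exponent\<close>

lemma super_tendsto_0: "((\<lambda>R. super1 R 0 + super2 R 0) \<longlongrightarrow> 0) at_top"
proof -
  have "((\<lambda>R. super1 R 0 + super2 R 0) \<longlongrightarrow> (LINT x|M1. 0) + (LINT x|M2. 0)) at_top"
    unfolding super1_def super2_def
  proof (intro tendsto_add integral_dominated_convergence_at_top)
    show "integrable M1 (\<lambda>x. \<bar>u x\<bar> powr q1)" "integrable M2 (\<lambda>x. \<bar>u x\<bar> powr q)"
      by (rule u_integrable1 u_integrable2)+
    have lim: "((\<lambda>R. if R < norm x then t else (0::real)) \<longlongrightarrow> 0) at_top" for t and x :: 'a
      by (rule tendsto_eventually, rule eventually_mono[OF eventually_ge_at_top[of "norm x"]]) simp
    show "AE x in M1. ((\<lambda>R. if R < norm x then max 0 (u x - 0) powr q1 else 0) \<longlongrightarrow> 0) at_top"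
      "AE x in M2. ((\<lambda>R. if R < norm x then max 0 (u x - 0) powr q else 0) \<longlongrightarrow> 0) at_top"
      by (intro AE_I2 lim)+
    show "\<forall>\<^sub>F R in at_top. AE x in M1. norm (if R < norm x then max 0 (u x - 0) powr q1 else 0) \<le> \<bar>u x\<bar> powr q1"
      "\<forall>\<^sub>F R in at_top. AE x in M2. norm (if R < norm x then max 0 (u x - 0) powr q else 0) \<le> \<bar>u x\<bar> powr q"
      using exponents_pos by (auto intro!: always_eventually AE_I2 powr_mono2)
  qed simp_all
  then show ?thesis by simp
qed

theorem one_sided_decay:
  "\<exists>R0>1. \<exists>C>0. \<exists>lam>0. AE x in L. norm x > R0 \<longrightarrow> u x \<le> C / norm x powr (p / (q1 - p) + lam)"
proof -
  obtain m \<epsilon> where m: "0 < m" and \<epsilon>: "0 < \<epsilon>" and dg: "\<And>R \<kappa>. 0 < R \<Longrightarrow> 0 < \<kappa> \<Longrightarrow>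
      1 \<le> R powr (- p) * \<kappa> powr (- (q1 - p)) \<Longrightarrow>
      super1 R \<kappa> + super2 R \<kappa> \<le> \<epsilon> * (R powr (- p) * \<kappa> powr (- (q1 - p))) powr (- m) \<Longrightarrow>
      AE x in L. 2 * R < norm x \<longrightarrow> u x \<le> 2 * \<kappa>"
    using de_giorgi by blast
  obtain C1 \<sigma> k0 where C1: "0 < C1" and \<sigma>: "0 < \<sigma>" and k0: "0 < k0" "k0 \<le> 1"
    and le: "\<And>k. 0 < k \<Longrightarrow> k \<le> k0 \<Longrightarrow> low_energy k \<le> C1 * k powr \<sigma>"
    using low_energy_power_decay by blast
  define c where "c = p / (q1 - p)"
  have d: "0 < q1 - p" using p_less_q1 by simp
  have c: "0 < c" "c * (q1 - p) = p"
    using d exponents_pos by (simp_all add: c_def)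
  define C2 where "C2 = K * C1 powr (q1 / p) + K * C1 powr (q / p)"
  have C2: "0 < C2"
    using K_pos C1 by (simp add: C2_def add_pos_pos)
  have mass: "(LINT x|M1. min (max 0 (u x)) k powr q1) + (LINT x|M2. min (max 0 (u x)) k powr q) \<le> C2 * k powr \<sigma>"
    if k: "0 < k" "k \<le> k0" for k
  proof -
    have est: "K * low_energy k powr t \<le> K * C1 powr t * k powr \<sigma>" if "1 < t" for t
    proof -
      have "low_energy k powr t \<le> (C1 * k powr \<sigma>) powr t"
        using le[OF k] low_energy_nonneg[of k] k that by (intro powr_mono2) auto
      also have "\<dots> = C1 powr t * k powr (\<sigma> * t)"
        using C1 by (simp add: powr_mult powr_powr)
      \<comment> \<open>As \<open>k \<le> 1\<close>, the larger exponent \<open>\<sigma> * t\<close>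
        may be lowered to \<open>\<sigma>\<close>, so both masses decay at a common rate.\<close>
      also have "\<dots> \<le> C1 powr t * k powr \<sigma>"
        using k k0 \<sigma> that by (intro mult_left_mono powr_mono') auto
      finally show ?thesis
        using K_pos by (simp add: mult_left_mono mult.assoc)
    qed
    have "1 < q1 / p" "1 < q / p"
      using p_less_q p_less_q1 exponents_pos by simp_all
    from est[OF this(1)] est[OF this(2)] show ?thesis
      using low_energy_controls(1,2)[OF k(1)] by (simp add: C2_def distrib_right)
  qed
  have ev1: "\<forall>\<^sub>F R in at_top. super1 R 0 + super2 R 0 < \<epsilon>"
    by (rule order_tendstoD(2)[OF super_tendsto_0 \<epsilon>])
  have first: "AE x in L. 2 * R < norm x \<longrightarrow> u x \<le> 2 * R powr (- c)"
    if R: "0 < R" and small: "super1 R 0 + super2 R 0 < \<epsilon>" for R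
  proof (rule dg[OF R])
    have T: "R powr (- p) * (R powr (- c)) powr (- (q1 - p)) = 1"
    proof -
      have "- p + - c * - (q1 - p) = 0"
        using c(2) by (simp add: algebra_simps)
      then show ?thesis
        unfolding powr_powr powr_add[symmetric] using R by simp
    qed
    then show "1 \<le> R powr (- p) * (R powr (- c)) powr (- (q1 - p))"
      by simp
    have "super1 R (R powr (- c)) + super2 R (R powr (- c)) \<le> super1 R 0 + super2 R 0"
      by (intro add_mono super_antimono) auto
    then show "super1 R (R powr (- c)) + super2 R (R powr (- c)) \<le> \<epsilon> * (R powr (- p) * (R powr (- c)) powr (- (q1 - p))) powr (- m)"
      using small unfolding T by simp
  qed (use R in simp)
  \<comment> \<open>At the level with exponent \<open>c + lam\<close> the tolerated mass decays like
    the power \<open>- (lam * (q1 - p) * m)\<close> of the radius, while the available mass decays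
    like the power \<open>- (c * \<sigma>)\<close>. This choice sets the first rate to half of the
    second, and the spare half beats the constants.\<close>
  define lam where "lam = c * \<sigma> / (2 * (q1 - p) * m)"
  have "c * \<sigma> / (2 * e * m) * e * m = c * \<sigma> / 2" if "0 < e" for e
    using that m by simp
  from this[OF d] have lam: "0 < lam" "lam * (q1 - p) * m = c * \<sigma> / 2"
    using c \<sigma> d m by (simp_all add: lam_def)
  have "((\<lambda>R. 2 * R powr (- c)) \<longlongrightarrow> 2 * 0) at_top"
    using c by (intro tendsto_mult tendsto_const tendsto_neg_powr filterlim_ident) auto
  then have ev2: "\<forall>\<^sub>F R in at_top. 2 * R powr (- c) < k0"
    using order_tendstoD(2)[of _ "2 * 0" at_top k0] k0 by simp
  \<comment> \<open>The factor \<open>2 powr \<sigma>\<close> comes from the level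
    \<open>2 * R powr (- c)\<close>, the other one from writing half of the decay in terms of
    \<open>2 * R\<close>.\<close>
  define C3 where "C3 = C2 * 2 powr \<sigma> * 2 powr (c * \<sigma> / 2)"
  have "((\<lambda>R. C3 * R powr (- (c * \<sigma> / 2))) \<longlongrightarrow> C3 * 0) at_top"
    using c \<sigma> by (intro tendsto_mult tendsto_const tendsto_neg_powr filterlim_ident) auto
  then have ev3: "\<forall>\<^sub>F R in at_top. C3 * R powr (- (c * \<sigma> / 2)) < \<epsilon>"
    using order_tendstoD(2)[of _ "C3 * 0" at_top \<epsilon>] \<epsilon> by simp
  obtain R1 where R1: "\<And>R. R1 \<le> R \<Longrightarrow> super1 R 0 + super2 R 0 < \<epsilon> \<and> 2 * R powr (- c) < k0 \<and>
      C3 * R powr (- (c * \<sigma> / 2)) < \<epsilon>"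
    using eventually_conj[OF ev1 eventually_conj[OF ev2 ev3]] unfolding eventually_at_top_linorder by blast
  have second: "AE x in L. 2 * (2 * R) < norm x \<longrightarrow> u x \<le> 2 * (2 * R) powr (- (c + lam))"
    if R: "1 \<le> R" "R1 \<le> R" for R
  proof -
    define k where "k = 2 * R powr (- c)"
    define \<kappa> where "\<kappa> = (2 * R) powr (- (c + lam))"
    have k: "0 < k" "k \<le> k0"
      using R R1[OF R(2)] by (simp_all add: k_def)
    have \<kappa>: "0 < \<kappa>"
      using R by (simp add: \<kappa>_def)
    have T: "(2 * R) powr (- p) * \<kappa> powr (- (q1 - p)) = (2 * R) powr (lam * (q1 - p))"
    proof -
      have "- p + - (c + lam) * - (q1 - p) = lam * (q1 - p)"
        using c(2) by (simp add: algebra_simps)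
      then show ?thesis
        unfolding \<kappa>_def powr_powr powr_add[symmetric] by (simp only:)
    qed
    have AE: "AE x in L. 2 * R < norm x \<longrightarrow> u x \<le> k"
      unfolding k_def using R R1[OF R(2)] by (intro first) auto
    \<comment> \<open>By the first bound \<open>u\<close> does not exceed \<open>k\<close> beyond
      \<open>2 * R\<close>, so there it may be replaced by its truncation, whose critical norms are
      controlled by the energy.\<close>
    have "super1 (2 * R) \<kappa> \<le> (LINT x|M1. min (max 0 (u x)) k powr q1)"
      unfolding super1_def
    proof (rule integral_mono_AE)
      show "AE x in M1. (if 2 * R < norm x then max 0 (u x - \<kappa>) powr q1 else 0) \<le> min (max 0 (u x)) k powr q1"
        unfolding AE_M1 by (rule eventually_mono[OF AE]) (use \<kappa> k exponents_pos in \<open>auto intro!: powr_mono2\<close>)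
    qed (use super_integrable(1)[of \<kappa> "2 * R"] low_energy_controls(3)[OF k(1)] \<kappa> in auto)
    moreover have "super2 (2 * R) \<kappa> \<le> (LINT x|M2. min (max 0 (u x)) k powr q)"
      unfolding super2_def
    proof (rule integral_mono_AE)
      show "AE x in M2. (if 2 * R < norm x then max 0 (u x - \<kappa>) powr q else 0) \<le> min (max 0 (u x)) k powr q"
        unfolding AE_M2 by (rule eventually_mono[OF AE]) (use \<kappa> k exponents_pos in \<open>auto intro!: powr_mono2\<close>)
    qed (use super_integrable(2)[of \<kappa> "2 * R"] low_energy_controls(4)[OF k(1)] \<kappa> in auto)
    ultimately have "super1 (2 * R) \<kappa> + super2 (2 * R) \<kappa> \<le> C2 * k powr \<sigma>"
      using mass[OF k] by linarith
    also have "C2 * k powr \<sigma> = C2 * 2 powr \<sigma> * (R powr (- (c * \<sigma> / 2)) * R powr (- (c * \<sigma> / 2)))"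
      using R by (simp add: k_def powr_mult powr_powr mult.commute flip: powr_add)
    also have "\<dots> = (C3 * R powr (- (c * \<sigma> / 2))) * (2 * R) powr (- (c * \<sigma> / 2))"
      using R by (simp add: C3_def powr_mult powr_minus)
    also have "\<dots> \<le> \<epsilon> * (2 * R) powr (- (c * \<sigma> / 2))"
      using R1[OF R(2)] by (intro mult_right_mono) auto
    also have "(2 * R) powr (- (c * \<sigma> / 2)) = ((2 * R) powr (- p) * \<kappa> powr (- (q1 - p))) powr (- m)"
    proof -
      have "lam * (q1 - p) * - m = - (c * \<sigma> / 2)"
        using lam(2) by simp
      then show ?thesis
        unfolding T powr_powr by (simp only:)
    qed
    finally have "super1 (2 * R) \<kappa> + super2 (2 * R) \<kappa> \<le> \<epsilon> * ((2 * R) powr (- p) * \<kappa> powr (- (q1 - p))) powr (- m)" .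
    moreover have "1 \<le> (2 * R) powr (- p) * \<kappa> powr (- (q1 - p))"
      unfolding T using R lam d by (intro ge_one_powr_ge_zero) auto
    ultimately show ?thesis
      using dg[of "2 * R" \<kappa>] R \<kappa> unfolding \<kappa>_def by simp
  qed
  obtain N where N: "R1 \<le> 2 ^ N"
    using real_arch_pow[of 2 R1] by (auto intro: less_imp_le)
  have N': "R1 \<le> 2 ^ n" if "N \<le> n" for n
  proof -
    have "(2::real) ^ N \<le> 2 ^ n"
      using that by (intro power_increasing) auto
    then show ?thesis
      using N by linarith
  qed
  \<comment> \<open>Only dyadic radii are used, so that the union of the exceptional sets is still a
    null set.\<close>
  have "AE x in L. \<forall>n. N \<le> n \<longrightarrow> 2 * (2 * 2 ^ n) < norm x \<longrightarrow> u x \<le> 2 * (2 * 2 ^ n) powr (- (c + lam))"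
    unfolding AE_all_countable
  proof
    fix n
    show "AE x in L. N \<le> n \<longrightarrow> 2 * (2 * 2 ^ n) < norm x \<longrightarrow> u x \<le> 2 * (2 * 2 ^ n) powr (- (c + lam))"
    proof (cases "N \<le> n")
      case True
      then show ?thesis
        using second[of "2 ^ n"] N'[of n] by simp
    qed simp
  qed
  then have "AE x in L. norm x > 4 * 2 ^ N \<longrightarrow> u x \<le> (2 * 4 powr (c + lam)) / norm x powr (c + lam)"
  proof eventually_elim
    case (elim x)
    show ?case
    proof
      assume x: "4 * 2 ^ N < norm x"
      obtain n0 where "norm x < 2 ^ n0"
        using real_arch_pow[of 2 "norm x"] by auto
      then have ex: "\<exists>n. norm x \<le> 4 * 2 ^ n"
        by (intro exI[of _ n0]) (smt (verit) zero_less_power)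
      \<comment> \<open>With \<open>n = Suc j\<close> minimal, \<open>norm x\<close> lies between
        \<open>4 * 2 ^ j\<close> and \<open>8 * 2 ^ j\<close>; the bound for the radius
        \<open>2 ^ j\<close> applies and loses the factor \<open>4 powr (c + lam)\<close>.\<close>
      define n where "n = (LEAST n. norm x \<le> 4 * 2 ^ n)"
      have n: "norm x \<le> 4 * 2 ^ n"
        unfolding n_def using ex by (rule LeastI_ex)
      have "N < n"
      proof (rule ccontr)
        assume "\<not> N < n"
        then have "(2::real) ^ n \<le> 2 ^ N"
          by (intro power_increasing) auto
        then show False
          using n x by linarith
      qed
      then obtain j where j: "n = Suc j" "N \<le> j"
        by (cases n) auto
      have "\<not> norm x \<le> 4 * 2 ^ j"
        using not_less_Least[of j "\<lambda>n. norm x \<le> 4 * 2 ^ n"] j by (simp flip: n_def)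
      then have "u x \<le> 2 * (2 * 2 ^ j) powr (- (c + lam))"
        using elim j by simp
      also have "\<dots> \<le> 2 * (norm x / 4) powr (- (c + lam))"
      proof (intro mult_left_mono powr_mono2')
        show "norm x / 4 \<le> 2 * 2 ^ j"
          using n j by simp
        have "0 < (2::real) ^ N" by simp
        then show "0 < norm x / 4"
          using x by linarith
      qed (use c lam in auto)
      also have "\<dots> = (2 * 4 powr (c + lam)) / norm x powr (c + lam)"
        by (simp only: powr_minus powr_divide norm_ge_zero) (simp add: powr_divide)
      finally show "u x \<le> (2 * 4 powr (c + lam)) / norm x powr (c + lam)" .
    qed
  qed
  moreover have "1 < 4 * (2::real) ^ N"
    using one_le_power[of "2::real" N] by linarith
  ultimately show ?thesis
    using lam(1) unfolding c_def[symmetric]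
    by (intro exI[of _ "4 * 2 ^ N"] exI[of _ "2 * 4 powr (c + lam)"] exI[of _ lam] conjI) auto
qed

end

section \<open>The bound for both signs of the solution\<close>

theorem theorem1p4:
  fixes \<Omega> :: "'a::euclidean_space set"
    and w1 w2 :: "'a \<Rightarrow> ennreal"
    and p q D1 D q1 :: real
    and u :: "'a \<Rightarrow> real" and G :: "'a \<Rightarrow> 'a"
  assumes "open \<Omega>"
    and "admissible_weight \<Omega> w1" and "admissible_weight \<Omega> w2"
    and "local_poincare \<Omega> p w1"
    and "q > p" and "weights_balance \<Omega> p q w1 w2"
    and "D1 = log 2 (doubling_const \<Omega> w1)"
    and "D = q * p / (q - p)"
    and "q1 = D1 * p / (D1 - p)"
    and "1 < p" and "p < min D1 D"
    and sobolev: "\<exists>C>0. \<forall>v\<in>C1c \<Omega>.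
        (LINT x|weighted \<Omega> w1. \<bar>v x\<bar> powr q1) powr (1 / q1)
          \<le> C * (LINT x|weighted \<Omega> w1. norm (grad v x) powr p) powr (1 / p) \<and>
        (LINT x|weighted \<Omega> w2. \<bar>v x\<bar> powr q) powr (1 / q)
          \<le> C * (LINT x|weighted \<Omega> w1. norm (grad v x) powr p) powr (1 / p)"
    and "(u, G) \<in> D1p \<Omega> p q1 w1"
    and "weak_solution \<Omega> p q w1 w2 u G"
  shows "\<exists>R0>1. \<exists>C>0. \<exists>lam>0. AE x in lebesgue_on \<Omega>.
           norm x > R0 \<longrightarrow> \<bar>u x\<bar> \<le> C / norm x powr (p / (q1 - p) + lam)"
proof -
  have "p * (D1 - p) < D1 * p"
    using \<open>1 < p\<close> by (simp add: algebra_simps)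
  then have p_q1: "p < q1"
    using \<open>p < min D1 D\<close> \<open>q1 = D1 * p / (D1 - p)\<close> by (simp add: pos_less_divide_eq)
  obtain C where C: "0 < C" and sob: "\<And>v. v \<in> C1c \<Omega> \<Longrightarrow>
        (LINT x|weighted \<Omega> w1. \<bar>v x\<bar> powr q1) powr (1 / q1)
          \<le> C * (LINT x|weighted \<Omega> w1. norm (grad v x) powr p) powr (1 / p) \<and>
        (LINT x|weighted \<Omega> w2. \<bar>v x\<bar> powr q) powr (1 / q)
          \<le> C * (LINT x|weighted \<Omega> w1. norm (grad v x) powr p) powr (1 / p)"
    using sobolev by blast
  \<comment> \<open>Raising the Sobolev inequalities to the powers \<open>q1\<close> and
    \<open>q\<close> produces two constants; their sum serves for both.\<close>
  define K where "K = C powr q1 + C powr q"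
  have K: "0 < K"
    using C by (simp add: K_def add_pos_pos)
  have raise: "I \<le> K * J powr (s / p)"
    if "I powr (1 / s) \<le> C * J powr (1 / p)" "0 \<le> I" "0 \<le> J" "s = q1 \<or> s = q" for I J s
  proof -
    have s: "0 < s"
      using that(4) p_q1 \<open>p < q\<close> \<open>1 < p\<close> by auto
    have "I = (I powr (1 / s)) powr s"
      using s that(2) by (simp add: powr_powr)
    also have "\<dots> \<le> (C * J powr (1 / p)) powr s"
      using that(1) s by (intro powr_mono2) auto
    also have "\<dots> = C powr s * J powr (s / p)"
      using C by (simp add: powr_mult powr_powr)
    also have "\<dots> \<le> K * J powr (s / p)"
      using that(4) by (intro mult_right_mono) (auto simp: K_def)
    finally show ?thesis .
  qed
  have data: "loc_integrable_weight \<Omega> w1" "loc_integrable_weight \<Omega> w2"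
    "AE x in lebesgue_on \<Omega>. 0 < w1 x" "AE x in lebesgue_on \<Omega>. 0 < w2 x"
    using \<open>admissible_weight \<Omega> w1\<close> \<open>admissible_weight \<Omega> w2\<close>
    by (auto simp: admissible_weight_def)
  have sob1: "(LINT x|weighted \<Omega> w1. \<bar>v x\<bar> powr q1)
        \<le> K * (LINT x|weighted \<Omega> w1. norm (grad v x) powr p) powr (q1 / p)"
    and sob2: "(LINT x|weighted \<Omega> w2. \<bar>v x\<bar> powr q)
        \<le> K * (LINT x|weighted \<Omega> w1. norm (grad v x) powr p) powr (q / p)" if "v \<in> C1c \<Omega>" for v
    using sob[OF that] by (auto intro!: raise)
  interpret pos: critical_solution \<Omega> w1 w2 p q q1 K u G
    by unfold_locales (fact data \<open>1 < p\<close> \<open>p < q\<close> p_q1 K sob1 sob2 \<open>(u, G) \<in> D1p \<Omega> p q1 w1\<close>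
        \<open>weak_solution \<Omega> p q w1 w2 u G\<close>)+
  \<comment> \<open>The one-sided bound is also wanted for \<open>- u\<close>. Both sides of the
    equation are odd in the pair of \<open>u\<close> and \<open>G\<close>, and test functions are
    stable under negation.\<close>
  have grad_minus: "grad (\<lambda>x. - v x) x = - grad v x" and Cinfc_minus: "(\<lambda>x. - v x) \<in> Cinfc \<Omega>"
    if "v \<in> Cinfc \<Omega>" for v x
  proof -
    have v: "Ck_on k UNIV v" for k
      using that unfolding Cinfc_def by blast
    show "grad (\<lambda>x. - v x) x = - grad v x"
      by (rule grad_eq) (rule GDERIV_minus[OF Ck_on_Suc_gderiv[OF v]])
    have "Ck_on k UNIV (\<lambda>x. - v x)" for k
      using Ck_on_diff[OF Ck_on_const v, of k 0] by simp
    then show "(\<lambda>x. - v x) \<in> Cinfc \<Omega>"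
      using that unfolding Cinfc_def compact_support_in_def by simp
  qed
  have D1p_minus: "(\<lambda>x. - u x, \<lambda>x. - G x) \<in> D1p \<Omega> p q1 w1"
  proof -
    obtain \<phi> where \<phi>: "\<And>n::nat. \<phi> n \<in> Cinfc \<Omega>"
      "(\<lambda>n. \<integral>\<^sup>+x. ennreal (norm (grad (\<phi> n) x - G x) powr p) \<partial>weighted \<Omega> w1) \<longlonglongrightarrow> 0"
      "(\<lambda>n. \<integral>\<^sup>+x. ennreal (\<bar>\<phi> n x - u x\<bar> powr q1) \<partial>weighted \<Omega> w1) \<longlonglongrightarrow> 0"
      using \<open>(u, G) \<in> D1p \<Omega> p q1 w1\<close> unfolding D1p_def by auto
    have e: "norm (- grad (\<phi> n) x - - G x) = norm (grad (\<phi> n) x - G x)"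
      "\<bar>- \<phi> n x - - u x\<bar> = \<bar>\<phi> n x - u x\<bar>" for n x
      by (simp_all add: norm_minus_commute abs_minus_commute)
    show ?thesis
      unfolding D1p_def mem_Collect_eq prod.case
    proof (intro conjI exI[of _ "\<lambda>n x. - \<phi> n x"] allI)
      show "(\<lambda>n. \<integral>\<^sup>+x. ennreal (norm (grad (\<lambda>x. - \<phi> n x) x - - G x) powr p) \<partial>weighted \<Omega> w1) \<longlonglongrightarrow> 0"
        unfolding grad_minus[OF \<phi>(1)] e by (rule \<phi>(2))
      show "(\<lambda>n. \<integral>\<^sup>+x. ennreal (\<bar>- \<phi> n x - - u x\<bar> powr q1) \<partial>weighted \<Omega> w1) \<longlonglongrightarrow> 0"
        unfolding e by (rule \<phi>(3))
      show "(\<lambda>x. - \<phi> n x) \<in> Cinfc \<Omega>" for n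
        by (rule Cinfc_minus[OF \<phi>(1)])
    qed (use pos.u_measurable pos.G_measurable in simp_all)
  qed
  have weak_minus: "weak_solution \<Omega> p q w1 w2 (\<lambda>x. - u x) (\<lambda>x. - G x)"
    using \<open>weak_solution \<Omega> p q w1 w2 u G\<close> by (simp add: weak_solution_def)
  interpret neg: critical_solution \<Omega> w1 w2 p q q1 K "\<lambda>x. - u x" "\<lambda>x. - G x"
    by unfold_locales (fact data \<open>1 < p\<close> \<open>p < q\<close> p_q1 K sob1 sob2 D1p_minus weak_minus)+
  define c where "c = p / (q1 - p)"
  obtain R1 C1 l1 where 1: "1 < R1" "0 < C1" "0 < l1"
    and u1: "AE x in lebesgue_on \<Omega>. norm x > R1 \<longrightarrow> u x \<le> C1 / norm x powr (c + l1)"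
    using pos.one_sided_decay unfolding c_def by blast
  obtain R2 C2 l2 where 2: "1 < R2" "0 < C2" "0 < l2"
    and u2: "AE x in lebesgue_on \<Omega>. norm x > R2 \<longrightarrow> - u x \<le> C2 / norm x powr (c + l2)"
    using neg.one_sided_decay unfolding c_def by blast
  \<comment> \<open>Because \<open>norm x > 1\<close>, lowering the exponent and enlarging the
    constant weakens a bound, so the two one-sided bounds can share their parameters.\<close>
  have weaken: "t \<le> max C1 C2 / y powr (c + min l1 l2)"
    if "t \<le> C' / y powr (c + l')" "1 < y" "C' \<le> max C1 C2" "min l1 l2 \<le> l'" for t y C' l'
  proof -
    have "t \<le> C' / y powr (c + l')"
      by (rule that(1))
    also have "\<dots> \<le> max C1 C2 / y powr (c + min l1 l2)"
      using that 1 2 by (intro frac_le powr_mono) auto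
    finally show ?thesis .
  qed
  have "AE x in lebesgue_on \<Omega>. norm x > max R1 R2 \<longrightarrow> \<bar>u x\<bar> \<le> max C1 C2 / norm x powr (c + min l1 l2)"
    using u1 u2
  proof eventually_elim
    case (elim x)
    show ?case
    proof
      assume x: "max R1 R2 < norm x"
      then have "u x \<le> max C1 C2 / norm x powr (c + min l1 l2)"
        using elim 1 by (intro weaken[of "u x" C1 "norm x" l1]) auto
      moreover have "- u x \<le> max C1 C2 / norm x powr (c + min l1 l2)"
        using x elim 2 by (intro weaken[of "- u x" C2 "norm x" l2]) auto
      ultimately show "\<bar>u x\<bar> \<le> max C1 C2 / norm x powr (c + min l1 l2)"
        by linarith
    qed
  qed
  then show ?thesis
    using 1 2 unfolding c_def
    by (intro exI[of _ "max R1 R2"] exI[of _ "max C1 C2"] exI[of _ "min l1 l2"] conjI) auto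
qed

end
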